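(* A daisy cube $H$ with at least one edge is isomorphic to the resonance graph of a plane bipartite graph if and only if its $\tau$-graph $H^{\tau}$ is a forest. In particular, a daisy cube $H$ is isomorphic to the resonance graph of a plane elementary bipartite graph different from $K_2$ if and only if its $\tau$-graph $H^{\tau}$ is a tree.
   Context: All graphs are simple; plane bipartite graphs need not be connected. Daisy cubes: for a positive integer $h$, let $\mathcal{B}^h$ be the set of binary strings of length $h$, partially ordered by $u_1\ldots u_h \le v_1\ldots v_h$ iff $u_i\le v_i$ for all $i$. The hypercube $Q_h$ has vertex set $\mathcal{B}^h$, two strings being adjacent iff they differ in exactly one position; $Q_0$ is the one-vertex graph. For $X\subseteq \mathcal{B}^h$ (nonempty), the daisy cube generated by $X$ is the subgraph of $Q_h$ induced by $\{u\in\mathcal{B}^h : u\le x \text{ for some } x\in X\}$. A daisy cube is a graph (isomorphic to one) of this form. Daisy cubes are partial cubes, i.e. isometric subgraphs of hypercubes. $\tau$-graphs: for a connected graph $G$ with distance $d_G$, two edges $x_1x_2$ and $y_1y_2$ are in relation $\Theta$ if $d_G(x_1,y_1)+d_G(x_2,y_2)\ne d_G(x_1,y_2)+d_G(x_2,y_1)$. On a partial cube $\Theta$ is an equivalence relation on the edge set; its classes are the $\Theta$-classes. The $\tau$-graph $H^\tau$ of a partial cube $H$ is the graph whose vertices are the $\Theta$-classes of $H$, with two distinct $\Theta$-classes $\mathcal{E},\mathcal{F}$ adjacent iff there are edges $uv\in\mathcal{E}$ and $vw\in\mathcal{F}$ of $H$ such that $u,w$ are nonadjacent and $v$ is their only common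 neighbor. A forest may have no edges; a tree has at least one vertex. Resonance graphs: a perfect matching of $G$ is a set $M\subseteq E(G)$ such that every vertex is incident with exactly one edge of $M$. An edge is allowed if it lies in some perfect matching of $G$, and forbidden otherwise. A graph with a perfect matching is elementary if the subgraph induced by all allowed edges is connected; a bipartite graph with a perfect matching is elementary iff it is connected and all of its edges are allowed. A face of a plane graph is a region enclosed by a set of edges, which forms the periphery of the face; a face is finite if its periphery encloses a finite region, and infinite otherwise. The resonance graph $R(G)$ of a plane bipartite graph $G$ is the graph whose vertices are the perfect matchings of $G$, two perfect matchings $M_1,M_2$ being adjacent iff their symmetric difference $M_1\oplus M_2$ is the edge set of exactly one cycle that is the periphery of a finite face of $G$. *)

theory Defs
  imports "HOL-Analysis.Analysis"
begin

section \<open>Finite simple graphs\<close>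

text \<open>Edges are two-element sets of vertices.\<close>

record 'a sgraph =
  verts :: "'a set"
  edges :: "'a set set"

definition simple_graph :: "'a sgraph \<Rightarrow> bool" where
  "simple_graph G \<longleftrightarrow> finite (verts G) \<and> (\<forall>e\<in>edges G. e \<subseteq> verts G \<and> card e = 2)"

definition adj :: "'a sgraph \<Rightarrow> 'a \<Rightarrow> 'a \<Rightarrow> bool" where
  "adj G u v \<longleftrightarrow> {u, v} \<in> edges G"

definition graph_iso :: "'a sgraph \<Rightarrow> 'b sgraph \<Rightarrow> bool" (infix "\<simeq>\<^sub>g" 50) where
  "G \<simeq>\<^sub>g G' \<longleftrightarrow> (\<exists>f. bij_betw f (verts G) (verts G') \<and>
     (\<forall>u\<in>verts G. \<forall>v\<in>verts G. adj G u v \<longleftrightarrow> adj G' (f u) (f v)))"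

definition induced_subgraph :: "'a sgraph \<Rightarrow> 'a set \<Rightarrow> 'a sgraph" where
  "induced_subgraph G S = \<lparr> verts = verts G \<inter> S, edges = {e \<in> edges G. e \<subseteq> S} \<rparr>"

definition edge_induced_subgraph :: "'a set set \<Rightarrow> 'a sgraph" where
  "edge_induced_subgraph F = \<lparr> verts = \<Union>F, edges = F \<rparr>"

definition bipartite :: "'a sgraph \<Rightarrow> bool" where
  "bipartite G \<longleftrightarrow> (\<exists>A B. A \<inter> B = {} \<and> A \<union> B = verts G \<and>
     (\<forall>e\<in>edges G. \<exists>a\<in>A. \<exists>b\<in>B. e = {a, b}))"

definition K2 :: "bool sgraph" where
  "K2 = \<lparr> verts = {False, True}, edges = {{False, True}} \<rparr>"

definition walk :: "'a sgraph \<Rightarrow> 'a \<Rightarrow> 'a list \<Rightarrow> 'a \<Rightarrow> bool" where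
  "walk G u xs v \<longleftrightarrow> xs \<noteq> [] \<and> hd xs = u \<and> last xs = v \<and>
     set xs \<subseteq> verts G \<and> successively (adj G) xs"

text \<open>The graph without vertices is not connected; in particular it is neither a tree nor
  elementary.\<close>

definition connected_graph :: "'a sgraph \<Rightarrow> bool" where
  "connected_graph G \<longleftrightarrow> verts G \<noteq> {} \<and> (\<forall>u\<in>verts G. \<forall>v\<in>verts G. \<exists>xs. walk G u xs v)"

text \<open>Only meaningful for vertices joined by a walk.\<close>

definition graph_dist :: "'a sgraph \<Rightarrow> 'a \<Rightarrow> 'a \<Rightarrow> nat" where
  "graph_dist G u v = (LEAST n. \<exists>xs. walk G u xs v \<and> length xs = Suc n)"

text \<open>A cycle is given by the cyclic list of its vertices.\<close>

definition is_cycle :: "'a sgraph \<Rightarrow> 'a list \<Rightarrow> bool" where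
  "is_cycle G xs \<longleftrightarrow> 3 \<le> length xs \<and> distinct xs \<and> set xs \<subseteq> verts G \<and>
     successively (adj G) xs \<and> adj G (last xs) (hd xs)"

definition cycle_edges :: "'a list \<Rightarrow> 'a set set" where
  "cycle_edges xs = {{xs ! i, xs ! (Suc i mod length xs)} | i. i < length xs}"

definition forest :: "'a sgraph \<Rightarrow> bool" where
  "forest G \<longleftrightarrow> (\<nexists>xs. is_cycle G xs)"

definition tree :: "'a sgraph \<Rightarrow> bool" where
  "tree G \<longleftrightarrow> connected_graph G \<and> forest G"

section \<open>Daisy cubes\<close>

text \<open>Binary strings are Boolean lists; on \<^typ>\<open>bool\<close>, the order is False \<open><\<close> True, so
  \<open>list_all2 (\<le>)\<close> is the componentwise order on strings of equal length.\<close>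

definition hypercube :: "nat \<Rightarrow> bool list sgraph" where
  "hypercube h = \<lparr> verts = {u. length u = h},
     edges = {{u, v} | u v. length u = h \<and> length v = h \<and> card {i. i < h \<and> u ! i \<noteq> v ! i} = 1} \<rparr>"

definition daisy_cube_generated :: "nat \<Rightarrow> bool list set \<Rightarrow> bool list sgraph" where
  "daisy_cube_generated h X =
     induced_subgraph (hypercube h) {u. length u = h \<and> (\<exists>x\<in>X. list_all2 (\<le>) u x)}"

definition daisy_cube :: "'a sgraph \<Rightarrow> bool" where
  "daisy_cube H \<longleftrightarrow> simple_graph H \<and>
     (\<exists>h X. 0 < h \<and> X \<noteq> {} \<and> X \<subseteq> {u. length u = h} \<and> H \<simeq>\<^sub>g daisy_cube_generated h X)"

section \<open>The tau-graph\<close>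

text \<open>The inequality does not depend on the order in which the ends of the two edges are listed.\<close>

definition Theta :: "'a sgraph \<Rightarrow> ('a set \<times> 'a set) set" where
  "Theta G = {({x1, x2}, {y1, y2}) | x1 x2 y1 y2. {x1, x2} \<in> edges G \<and> {y1, y2} \<in> edges G \<and>
     graph_dist G x1 y1 + graph_dist G x2 y2 \<noteq> graph_dist G x1 y2 + graph_dist G x2 y1}"

definition tau_graph :: "'a sgraph \<Rightarrow> 'a set set sgraph" where
  "tau_graph H = \<lparr> verts = edges H // Theta H,
     edges = {{E, F} | E F. E \<in> edges H // Theta H \<and> F \<in> edges H // Theta H \<and> E \<noteq> F \<and>
       (\<exists>u v w. {u, v} \<in> E \<and> {v, w} \<in> F \<and> \<not> adj H u w \<and>
          {x \<in> verts H. adj H u x \<and> adj H w x} = {v})} \<rparr>"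

section \<open>Perfect matchings\<close>

definition perfect_matching :: "'a sgraph \<Rightarrow> 'a set set \<Rightarrow> bool" where
  "perfect_matching G M \<longleftrightarrow> M \<subseteq> edges G \<and> (\<forall>v\<in>verts G. \<exists>!e. e \<in> M \<and> v \<in> e)"

definition allowed_edges :: "'a sgraph \<Rightarrow> 'a set set" where
  "allowed_edges G = {e \<in> edges G. \<exists>M. perfect_matching G M \<and> e \<in> M}"

definition elementary :: "'a sgraph \<Rightarrow> bool" where
  "elementary G \<longleftrightarrow> (\<exists>M. perfect_matching G M) \<and>
     connected_graph (edge_induced_subgraph (allowed_edges G))"

section \<open>Plane graphs and resonance graphs\<close>

text \<open>A plane graph has points of the plane as vertices, and \<open>\<gamma> e\<close> is the arc drawing the edge
  \<open>e\<close>. No arc passes through a vertex other than its two ends, and two arcs meet only in common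
  ends.\<close>

definition plane_graph :: "complex sgraph \<Rightarrow> (complex set \<Rightarrow> real \<Rightarrow> complex) \<Rightarrow> bool" where
  "plane_graph G \<gamma> \<longleftrightarrow> simple_graph G \<and>
     (\<forall>e\<in>edges G. arc (\<gamma> e) \<and> {pathstart (\<gamma> e), pathfinish (\<gamma> e)} = e \<and>
        path_image (\<gamma> e) \<inter> verts G = e) \<and>
     (\<forall>e\<in>edges G. \<forall>f\<in>edges G. e \<noteq> f \<longrightarrow> path_image (\<gamma> e) \<inter> path_image (\<gamma> f) = e \<inter> f)"

definition plane_bipartite_graph :: "complex sgraph \<Rightarrow> (complex set \<Rightarrow> real \<Rightarrow> complex) \<Rightarrow> bool" where
  "plane_bipartite_graph G \<gamma> \<longleftrightarrow> plane_graph G \<gamma> \<and> bipartite G"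

definition drawing :: "complex sgraph \<Rightarrow> (complex set \<Rightarrow> real \<Rightarrow> complex) \<Rightarrow> complex set" where
  "drawing G \<gamma> = verts G \<union> (\<Union>e\<in>edges G. path_image (\<gamma> e))"

definition faces :: "complex sgraph \<Rightarrow> (complex set \<Rightarrow> real \<Rightarrow> complex) \<Rightarrow> complex set set" where
  "faces G \<gamma> = components (- drawing G \<gamma>)"

definition finite_faces :: "complex sgraph \<Rightarrow> (complex set \<Rightarrow> real \<Rightarrow> complex) \<Rightarrow> complex set set" where
  "finite_faces G \<gamma> = {F \<in> faces G \<gamma>. bounded F}"

text \<open>The periphery consists of all edges on the boundary of the face. If another component of the
  graph lies inside a cycle, the face between them has edges of both on its periphery, which then
  is not a single cycle.\<close>

definition periphery ::
  "complex sgraph \<Rightarrow> (complex set \<Rightarrow> real \<Rightarrow> complex) \<Rightarrow> complex set \<Rightarrow> complex set set" where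
  "periphery G \<gamma> F = {e \<in> edges G. path_image (\<gamma> e) \<subseteq> frontier F}"

definition resonance_graph ::
  "complex sgraph \<Rightarrow> (complex set \<Rightarrow> real \<Rightarrow> complex) \<Rightarrow> complex set set sgraph" where
  "resonance_graph G \<gamma> = \<lparr> verts = {M. perfect_matching G M},
     edges = {{M1, M2} | M1 M2. perfect_matching G M1 \<and> perfect_matching G M2 \<and>
       (\<exists>xs. is_cycle G xs \<and> (M1 - M2) \<union> (M2 - M1) = cycle_edges xs \<and>
          (\<exists>F\<in>finite_faces G \<gamma>. periphery G \<gamma> F = cycle_edges xs))} \<rparr>"

end

theory Submission imports Defs begin

text \<open>
  Reading binary strings as sets, a daisy cube is a family \<open>D\<close> of finite sets closed under subsets, in
  which sets differing in one element are adjacent (\<open>daisy_cube_complex\<close>). Its \<open>\<Theta>\<close>-classes are the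
  elements \<open>i\<close> with \<open>{i} \<in> D\<close>, and two of them are joined in the \<open>\<tau>\<close>-graph iff some path
  \<open>\<rho> \<union> {i}\<close>, \<open>\<rho>\<close>, \<open>\<rho> \<union> {j}\<close> does not extend to a square (\<open>tau_graph_iso\<close>). The pairs inside a
  minimal non-face of \<open>D\<close> are all joined, so if the \<open>\<tau>\<close>-graph is a forest, then \<open>D\<close> consists of its
  independent sets (\<open>complex_eq_independent_sets\<close>).

  Suppose that \<open>D\<close> is the resonance graph of a plane bipartite graph \<open>G\<close>. The peripheries of bounded
  faces are linearly independent modulo two (\<open>peripheries_independent\<close>), so opposite edges of a square
  of the resonance graph rotate the same face, and every direction \<open>i\<close> belongs to one face with a
  cycle \<open>C i\<close> that alternates with respect to the matching \<open>M {}\<close>. Directions joined in the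
  \<open>\<tau>\<close>-graph have cycles sharing an edge of \<open>M {}\<close>, and the cycles of all other pairs are
  vertex-disjoint. A chordless cycle in the \<open>\<tau>\<close>-graph would thus give a ring of faces with edges
  \<open>e j\<close> of \<open>M {}\<close> between consecutive ones. By the Jordan curve theorem, in the form
  \<open>edge_changes_side\<close>, every cycle of \<open>G\<close> contains an even number of these edges, so they are a cut,
  as if one had drawn a closed curve through the ring. The ring is two-coloured because \<open>G\<close> is
  bipartite. Rotate one half of the ring on one side of the cut and the other half on the other side:
  this is a perfect matching that no set of independent face rotations can produce (\<open>contradiction\<close>).
  If \<open>G\<close> is elementary, its allowed edges are those of \<open>M {}\<close> and of the cycles \<open>C i\<close>, and a
  disconnected \<open>\<tau>\<close>-graph would disconnect them.

  Conversely, a forest is represented by nested intervals on the real line, each vertex covering its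
  children. Draw a parabola over each interval, and join the consecutive end points visible below it:
  below the parabola of each vertex of the forest there is a bounded face, the faces of adjacent
  vertices share a parabola, and a parity argument shows that every perfect matching arises from the
  one formed by the parabolas over all intervals by rotating an independent set of faces (\<open>matching_is_rotation\<close>). Linear
  independence of the peripheries excludes further adjacencies, so the resonance graph is \<open>D\<close>.
\<close>

section \<open>Edge sets of cycles\<close>

fun path_edges :: "'a list \<Rightarrow> 'a set set" where
  "path_edges (x # y # zs) = insert {x, y} (path_edges (y # zs))"
| "path_edges _ = {}"

definition crosses :: "'a set \<Rightarrow> 'a set \<Rightarrow> bool" where
  "crosses Y e \<longleftrightarrow> e \<inter> Y \<noteq> {} \<and> \<not> e \<subseteq> Y"

lemma crosses_pair: "crosses Y {u, v} \<longleftrightarrow> (u \<in> Y) \<noteq> (v \<in> Y)"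
  by (auto simp: crosses_def)

lemma adj_commute: "adj G u v \<longleftrightarrow> adj G v u"
  by (simp add: adj_def insert_commute)

lemma simple_graph_adjD:
  assumes "simple_graph G" "adj G u v"
  shows "u \<noteq> v" "u \<in> verts G" "v \<in> verts G"
proof -
  have "{u, v} \<subseteq> verts G" "card {u, v} = 2"
    using assms by (auto simp: simple_graph_def adj_def)
  then show "u \<noteq> v" "u \<in> verts G" "v \<in> verts G" by auto
qed

lemma simple_graph_edgeE:
  assumes "simple_graph G" "e \<in> edges G"
  obtains u v where "e = {u, v}" "u \<noteq> v" "u \<in> verts G" "v \<in> verts G"
proof -
  have "e \<subseteq> verts G" "card e = 2"
    using assms by (auto simp: simple_graph_def)
  then show thesis using that by (auto simp: card_2_iff)
qed

lemma finite_edges: "simple_graph G \<Longrightarrow> finite (edges G)"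
  by (rule finite_subset[of _ "Pow (verts G)"]) (auto simp: simple_graph_def)

lemma path_edges_conv_nth: "path_edges xs = {{xs ! i, xs ! Suc i} | i. Suc i < length xs}"
proof (induction xs rule: path_edges.induct)
  case (1 x y zs)
  have "{{(x # y # zs) ! i, (x # y # zs) ! Suc i} | i. Suc i < length (x # y # zs)} =
      insert {x, y} {{(y # zs) ! i, (y # zs) ! Suc i} | i. Suc i < length (y # zs)}"
    (is "?L = insert _ ?R")
  proof (intro set_eqI iffI)
    fix e assume "e \<in> ?L"
    then obtain i where i: "e = {(x # y # zs) ! i, (x # y # zs) ! Suc i}" "Suc i < length (x # y # zs)"
      by blast
    show "e \<in> insert {x, y} ?R"
    proof (cases i)
      case 0 then show ?thesis using i by simp
    next
      case (Suc j) then show ?thesis using i by auto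
    qed
  next
    fix e assume "e \<in> insert {x, y} ?R"
    then consider "e = {x, y}"
      | j where "e = {(y # zs) ! j, (y # zs) ! Suc j}" "Suc j < length (y # zs)" by blast
    then show "e \<in> ?L"
    proof cases
      case 1 then have "e = {(x # y # zs) ! 0, (x # y # zs) ! Suc 0}" by simp
      then show ?thesis by fastforce
    next
      case (2 j)
      then have "e = {(x # y # zs) ! Suc j, (x # y # zs) ! Suc (Suc j)}"
        "Suc (Suc j) < length (x # y # zs)" by auto
      then show ?thesis by blast
    qed
  qed
  then show ?case using 1 by simp
qed auto

lemma path_edges_append:
  "xs \<noteq> [] \<Longrightarrow> ys \<noteq> [] \<Longrightarrow>
     path_edges (xs @ ys) = insert {last xs, hd ys} (path_edges xs \<union> path_edges ys)"
proof (induction xs rule: path_edges.induct)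
  case ("2_2" x)
  then show ?case by (cases ys) auto
qed auto

lemma path_edges_subset: "e \<in> path_edges xs \<Longrightarrow> e \<subseteq> set xs"
  by (induction xs rule: path_edges.induct) auto

lemma path_edges_successively: "successively (adj G) xs \<Longrightarrow> path_edges xs \<subseteq> edges G"
  by (induction xs rule: path_edges.induct) (auto simp: adj_def)

lemma cycle_edges_conv:
  assumes "xs \<noteq> []"
  shows "cycle_edges xs = insert {last xs, hd xs} (path_edges xs)"
proof -
  let ?n = "length xs"
  have n: "?n > 0" using assms by simp
  let ?f = "\<lambda>i. {xs ! i, xs ! (Suc i mod ?n)}"
  have "{..<?n} = insert (?n - 1) {i. Suc i < ?n}" using n by auto
  moreover have "cycle_edges xs = ?f ` {..<?n}" by (auto simp: cycle_edges_def)
  ultimately have "cycle_edges xs = insert (?f (?n - 1)) (?f ` {i. Suc i < ?n})"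
    by (simp only: image_insert)
  also have "?f ` {i. Suc i < ?n} = path_edges xs"
    by (auto simp: path_edges_conv_nth)
  also have "{xs ! (?n - 1), xs ! (Suc (?n - 1) mod ?n)} = {last xs, hd xs}"
    using assms n by (simp add: last_conv_nth hd_conv_nth)
  finally show ?thesis .
qed

lemma cycle_rotate:
  assumes "is_cycle G (us @ vs)"
  shows "is_cycle G (vs @ us)" "cycle_edges (vs @ us) = cycle_edges (us @ vs)"
proof -
  have "is_cycle G (vs @ us) \<and> cycle_edges (vs @ us) = cycle_edges (us @ vs)"
  proof (cases "us = [] \<or> vs = []")
    case True then show ?thesis using assms by auto
  next
    case False
    then have ne: "us \<noteq> []" "vs \<noteq> []" by auto
    have "is_cycle G (vs @ us)"
      using assms ne by (auto simp: is_cycle_def successively_append_iff)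
    moreover have "cycle_edges (vs @ us) = cycle_edges (us @ vs)"
      using ne by (auto simp: cycle_edges_conv path_edges_append insert_commute)
    ultimately show ?thesis by blast
  qed
  then show "is_cycle G (vs @ us)" "cycle_edges (vs @ us) = cycle_edges (us @ vs)" by auto
qed

lemma cycle_edges_subset: "is_cycle G xs \<Longrightarrow> cycle_edges xs \<subseteq> edges G"
  using path_edges_successively[of G xs] by (subst cycle_edges_conv) (auto simp: is_cycle_def adj_def)

lemma finite_cycle_edges [simp]: "finite (cycle_edges xs)"
proof -
  have "cycle_edges xs = (\<lambda>i. {xs ! i, xs ! (Suc i mod length xs)}) ` {..<length xs}"
    by (auto simp: cycle_edges_def)
  then show ?thesis by simp
qed

lemma cycle_edges_nonempty: "is_cycle G xs \<Longrightarrow> cycle_edges xs \<noteq> {}"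
  by (subst cycle_edges_conv) (auto simp: is_cycle_def)

lemma cycle_start_at:
  assumes "is_cycle G xs" "x \<in> set xs"
  obtains ys where "is_cycle G (x # ys)" "cycle_edges (x # ys) = cycle_edges xs"
proof -
  obtain us vs where "xs = us @ x # vs" using assms(2) by (meson split_list)
  then show thesis
    using cycle_rotate[of G us "x # vs"] assms(1) that[of "vs @ us"] by simp
qed

lemma Union_cycle_edges:
  assumes "is_cycle G xs"
  shows "\<Union>(cycle_edges xs) = set xs"
proof
  have ne: "xs \<noteq> []" using assms by (auto simp: is_cycle_def)
  show "\<Union>(cycle_edges xs) \<subseteq> set xs"
    using path_edges_subset ne by (fastforce simp: cycle_edges_conv)
  show "set xs \<subseteq> \<Union>(cycle_edges xs)"
  proof
    fix x assume "x \<in> set xs"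
    then obtain ys where "is_cycle G (x # ys)" "cycle_edges (x # ys) = cycle_edges xs"
      using cycle_start_at assms by metis
    then show "x \<in> \<Union>(cycle_edges xs)"
      using cycle_edges_conv[of "x # ys"] by auto
  qed
qed

lemma cycle_end_at_edge:
  assumes "is_cycle G xs" "e \<in> cycle_edges xs"
  obtains ys where "is_cycle G ys" "cycle_edges ys = cycle_edges xs" "e = {last ys, hd ys}"
proof -
  obtain i where i: "i < length xs" "e = {xs ! i, xs ! (Suc i mod length xs)}"
    using assms(2) by (auto simp: cycle_edges_def)
  show thesis
  proof (cases "Suc i < length xs")
    case True
    let ?us = "take (Suc i) xs" and ?vs = "drop (Suc i) xs"
    have "last (?vs @ ?us) = xs ! i" "hd (?vs @ ?us) = xs ! Suc i"
      using True by (auto simp: take_Suc_conv_app_nth hd_drop_conv_nth hd_append)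
    then show thesis
      using that[of "?vs @ ?us"] cycle_rotate[of G ?us ?vs] assms(1) i True by simp
  next
    case False
    then have "Suc i = length xs" using i by simp
    then have "e = {last xs, hd xs}"
      using i by (cases "xs = []") (auto simp: hd_conv_nth last_conv_nth simp flip: \<open>Suc i = length xs\<close>)
    then show thesis using that assms by blast
  qed
qed

lemma cycle_degree:
  assumes "is_cycle G xs" "x \<in> set xs"
  shows "card {e \<in> cycle_edges xs. x \<in> e} = 2"
proof -
  obtain ys where ys: "is_cycle G (x # ys)" "cycle_edges (x # ys) = cycle_edges xs"
    using cycle_start_at assms by metis
  then obtain a b zs where z: "ys = a # zs @ [b]"
  proof -
    have "length ys \<ge> 2" using ys by (simp add: is_cycle_def)
    then obtain a ws where a: "ys = a # ws" "ws \<noteq> []" by (cases ys) (auto simp: Suc_le_eq)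
    then obtain zs b where "ws = zs @ [b]" by (metis append_butlast_last_id)
    then show thesis using that a by blast
  qed
  have d: "x \<notin> set ys" "a \<noteq> b" using ys(1) z by (auto simp: is_cycle_def)
  have "cycle_edges xs = insert {b, x} (insert {x, a} (path_edges ys))"
    using ys(2)[symmetric] z by (simp add: cycle_edges_conv)
  then have "{e \<in> cycle_edges xs. x \<in> e} = {{b, x}, {x, a}}"
    using d(1) path_edges_subset by fastforce
  moreover have "{b, x} \<noteq> {x, a}" using d by (auto simp: doubleton_eq_iff)
  ultimately show ?thesis by simp
qed

text \<open>Handshake argument: count the incidences between \<open>Y\<close> and \<open>C\<close> from both sides; an edge
  contributes an odd number exactly when it crosses \<open>Y\<close>.\<close>

lemma crossing_parity:
  assumes "finite C" "\<And>e. e \<in> C \<Longrightarrow> card e = 2" "finite Y"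
  shows "even (card {e \<in> C. crosses Y e} + (\<Sum>y\<in>Y. card {e \<in> C. y \<in> e}))"
proof -
  have "(\<Sum>y\<in>Y. card {e \<in> C. y \<in> e}) = (\<Sum>e\<in>C. card {y \<in> Y. y \<in> e})"
    using sum_multicount_gen[of Y C "\<lambda>y e. y \<in> e" "\<lambda>e. card {y \<in> Y. y \<in> e}"] assms by simp
  also have "even (\<dots> + card {e \<in> C. crosses Y e})"
  proof -
    have "card {y \<in> Y. y \<in> e} mod 2 = (if crosses Y e then 1 else 0)" if e: "e \<in> C" for e
    proof -
      obtain u v where "e = {u, v}" "u \<noteq> v" using assms(2)[OF e] by (auto simp: card_2_iff)
      moreover have "{y \<in> Y. y \<in> {u, v}} = (if u \<in> Y then {u} else {}) \<union> (if v \<in> Y then {v} else {})"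
        by auto
      ultimately show ?thesis by (auto simp: crosses_pair)
    qed
    then have "(\<Sum>e\<in>C. card {y \<in> Y. y \<in> e}) mod 2 = (\<Sum>e\<in>C. if crosses Y e then 1 else 0) mod 2"
      by (subst mod_sum_eq[symmetric]) (auto intro!: arg_cong[where f="\<lambda>x. x mod 2"] sum.cong)
    also have "(\<Sum>e\<in>C. if crosses Y e then 1 else 0) = card {e \<in> C. crosses Y e}"
      using assms(1) by (simp add: sum.If_cases Int_def)
    finally show ?thesis by presburger
  qed
  finally show ?thesis by (simp add: add.commute)
qed

lemma simple_graph_card_edge: "simple_graph G \<Longrightarrow> e \<in> edges G \<Longrightarrow> card e = 2"
  by (auto simp: simple_graph_def)

lemma cycle_crosses_even:
  assumes "simple_graph G" "is_cycle G xs"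
  shows "even (card {e \<in> cycle_edges xs. crosses Y e})"
proof -
  let ?Y = "Y \<inter> set xs"
  have "crosses ?Y e \<longleftrightarrow> crosses Y e" if "e \<in> cycle_edges xs" for e
    using Union_cycle_edges[OF assms(2)] that by (auto simp: crosses_def)
  then have "{e \<in> cycle_edges xs. crosses ?Y e} = {e \<in> cycle_edges xs. crosses Y e}" by auto
  moreover have "even (\<Sum>y\<in>?Y. card {e \<in> cycle_edges xs. y \<in> e})"
    by (rule dvd_sum) (use cycle_degree[OF assms(2)] in auto)
  moreover have "card e = 2" if "e \<in> cycle_edges xs" for e
    using cycle_edges_subset[OF assms(2)] simple_graph_card_edge assms(1) that by blast
  ultimately show ?thesis
    using crossing_parity[of "cycle_edges xs" ?Y] by simp
qed

lemma cycle_connected: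
  assumes "is_cycle G xs" "\<And>e. e \<in> cycle_edges xs \<Longrightarrow> \<not> crosses Y e"
  shows "set xs \<subseteq> Y \<or> set xs \<inter> Y = {}"
proof -
  have "set zs \<subseteq> Y \<or> set zs \<inter> Y = {}" if "path_edges zs \<subseteq> cycle_edges xs" for zs
    using that
  proof (induction zs rule: path_edges.induct)
    case (1 x y zs)
    have "\<not> crosses Y {x, y}" using 1(2) assms(2) by auto
    then show ?case using 1 by (auto simp: crosses_pair)
  qed auto
  moreover have "path_edges xs \<subseteq> cycle_edges xs"
    using assms(1) by (subst cycle_edges_conv) (auto simp: is_cycle_def)
  ultimately show ?thesis by blast
qed

section \<open>Faces on the two sides of an edge\<close>

text \<open>A face that touches an arc of the drawing at one point touches it further along. If not, cut
  the arc just beyond the last point under consideration: the face survives as a component, but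
  it now touches a hair attached to the rest of the drawing at one end. A hair does not separate
  (Janiszewski), so the face would leak around its tip.\<close>

lemma arc_frontier_forward:
  fixes g :: "real \<Rightarrow> complex"
  assumes "arc g" "closed R" "pathstart g \<in> R" "path_image g \<inter> R \<subseteq> {pathstart g, pathfinish g}"
    and F: "F \<in> components (- (R \<union> path_image g))"
    and st: "0 < s" "s < t" "t < 1" and s: "g s \<in> closure F"
  shows "g t \<in> closure F"
proof (rule ccontr)
  assume nt: "g t \<notin> closure F"
  have cg: "continuous_on {0..1} g" and inj: "inj_on g {0..1}"
    using assms(1) by (auto simp: arc_def path_def)
  obtain \<epsilon> where \<epsilon>: "\<epsilon> > 0" "ball (g t) \<epsilon> \<inter> closure F = {}"
    using nt by (meson open_Compl closed_closure ComplI open_contains_ball disjoint_eq_subset_Compl)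
  obtain \<delta> where \<delta>: "\<delta> > 0" "\<And>x. x \<in> {0..1} \<Longrightarrow> dist x t < \<delta> \<Longrightarrow> dist (g x) (g t) < \<epsilon>"
  proof -
    have "t \<in> {0..1}" using st by simp
    then show thesis using cg \<epsilon>(1) that unfolding continuous_on_iff by blast
  qed
  define u where "u = min (t + \<delta> / 2) ((t + 1) / 2)"
  have u: "t < u" "u < 1" using \<delta>(1) st by (auto simp: u_def min_def)
  have off: "g x \<notin> closure F" if "t \<le> x" "x \<le> u" for x
  proof -
    have "dist x t < \<delta>" using that \<delta>(1) by (auto simp: dist_real_def u_def min_def split: if_splits)
    then have "g x \<in> ball (g t) \<epsilon>" using \<delta>(2)[of x] that st u by (auto simp: dist_commute)
    then show ?thesis using \<epsilon>(2) by auto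
  qed
  define m where "m = (t + u) / 2"
  have m: "t < m" "m < u" using u by (auto simp: m_def)
  define \<alpha> where "\<alpha> = g ` {0..t}"
  define Y where "Y = R \<union> g ` {u..1}"
  have sp: "arc (subpath 0 t g)" "path_image (subpath 0 t g) = \<alpha>"
    using arc_subpath_arc[OF assms(1), of 0 t] st by (auto simp: path_image_subpath \<alpha>_def)
  have comp\<alpha>: "compact \<alpha>" using sp compact_arc_image by metis
  have clY: "closed Y"
    unfolding Y_def using cg u st
    by (intro closed_Un assms(2) compact_imp_closed compact_continuous_image continuous_on_subset[OF cg]) auto
  have gR: "g x \<in> R \<Longrightarrow> x = 0 \<or> x = 1" if "0 \<le> x" "x \<le> 1" for x
  proof -
    assume "g x \<in> R"
    then have "g x \<in> path_image g \<inter> R" using that by (simp add: path_image_def)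
    then have "g x \<in> {g 0, g 1}" using assms(4) by (auto simp: pathstart_def pathfinish_def)
    then show ?thesis using inj that by (auto simp: inj_on_def)
  qed
  have gY: "g x \<notin> Y" if "0 < x" "x < u" for x
    using gR[of x] that u inj by (fastforce simp: Y_def inj_on_def)
  have "Y \<inter> \<alpha> = {g 0}"
  proof
    show "Y \<inter> \<alpha> \<subseteq> {g 0}"
    proof
      fix y assume "y \<in> Y \<inter> \<alpha>"
      then obtain x where "y = g x" "0 \<le> x" "x \<le> t" "g x \<in> Y" by (auto simp: \<alpha>_def)
      then show "y \<in> {g 0}" using gY[of x] u by (cases "x = 0") auto
    qed
    show "{g 0} \<subseteq> Y \<inter> \<alpha>" using assms(3) st by (auto simp: Y_def \<alpha>_def pathstart_def)
  qed
  then have conn: "connected (\<alpha> \<inter> Y)" by (simp add: Int_commute)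
  have "g s \<notin> Y" using gY st u by auto
  then obtain r where r: "r > 0" "ball (g s) r \<inter> Y = {}"
    using clY by (meson open_Compl ComplI open_contains_ball disjoint_eq_subset_Compl)
  obtain a where a: "a \<in> F" "dist a (g s) < r"
    using s r(1) by (auto simp: closure_approachable)
  have F': "F \<subseteq> - (R \<union> path_image g)" using F in_components_subset by blast
  have "connected (g ` {s..m})"
    using st m u by (intro connected_continuous_image continuous_on_subset[OF cg]) auto
  moreover have "g s \<in> ball (g s) r \<inter> g ` {s..m}" using r(1) st m by auto
  ultimately have "connected (ball (g s) r \<union> g ` {s..m})"
    using connected_Un[OF connected_ball, of "g ` {s..m}" "g s" r] by blast
  moreover have "ball (g s) r \<union> g ` {s..m} \<subseteq> - Y"
    using r(2) gY st m by auto
  moreover have "a \<in> ball (g s) r" using a by (simp add: dist_commute)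
  moreover have "g m \<in> g ` {s..m}" using st m by auto
  ultimately have ccY: "connected_component (- Y) a (g m)"
    unfolding connected_component_def by blast
  have "g m \<notin> \<alpha>" using inj st m u by (fastforce simp: \<alpha>_def inj_on_def)
  moreover have "\<alpha> \<subseteq> path_image g" using st by (auto simp: \<alpha>_def path_image_def)
  ultimately have "connected_component (- \<alpha>) a (g m)"
    using connected_arc_complement[OF sp(1)] sp(2) a F' unfolding connected_component_def by auto
  then have "connected_component (- (\<alpha> \<union> Y)) a (g m)"
    using Janiszewski[OF comp\<alpha> clY conn] ccY by blast
  then obtain T where T: "connected T" "T \<subseteq> - (\<alpha> \<union> Y)" "a \<in> T" "g m \<in> T"
    unfolding connected_component_def by blast
  have "g m \<notin> F" using F' st m u by (auto simp: path_image_def)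
  then have "T \<inter> frontier F \<noteq> {}"
    using connected_Int_frontier[OF T(1), of F] T a by blast
  then obtain x where x: "x \<in> T" "x \<in> frontier F" by blast
  have "closed (R \<union> path_image g)"
    using assms(1,2) by (simp add: closed_Un closed_arc_image)
  then have "x \<in> R \<union> path_image g"
    using frontier_of_components_closed_complement F x by blast
  then obtain v where v: "x = g v" "0 \<le> v" "v \<le> 1"
    using T(2) x(1) by (auto simp: Y_def path_image_def)
  have "v \<notin> {0..t}" "v \<notin> {u..1}"
    using T(2) x(1) v by (auto simp: Y_def \<alpha>_def)
  then have "g v \<notin> closure F" using off[of v] v by auto
  then show False using x v by (simp add: frontier_def)
qed

definition open_edge :: "(complex set \<Rightarrow> real \<Rightarrow> complex) \<Rightarrow> complex set \<Rightarrow> complex set" where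
  "open_edge \<gamma> e = path_image (\<gamma> e) - e"

definition curve :: "(complex set \<Rightarrow> real \<Rightarrow> complex) \<Rightarrow> complex set set \<Rightarrow> complex set" where
  "curve \<gamma> C = (\<Union>e\<in>C. path_image (\<gamma> e))"

locale plane =
  fixes G :: "complex sgraph" and \<gamma> :: "complex set \<Rightarrow> real \<Rightarrow> complex"
  assumes plane: "plane_graph G \<gamma>"
begin

lemma simple: "simple_graph G"
  and arc_edge: "e \<in> edges G \<Longrightarrow> arc (\<gamma> e)"
  and ends_edge: "e \<in> edges G \<Longrightarrow> {pathstart (\<gamma> e), pathfinish (\<gamma> e)} = e"
  and edge_verts: "e \<in> edges G \<Longrightarrow> path_image (\<gamma> e) \<inter> verts G = e"
  and edges_meet: "e \<in> edges G \<Longrightarrow> f \<in> edges G \<Longrightarrow> e \<noteq> f \<Longrightarrow>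
      path_image (\<gamma> e) \<inter> path_image (\<gamma> f) = e \<inter> f"
  using plane by (auto simp: plane_graph_def)

lemma edge_image: "e \<in> edges G \<Longrightarrow> path_image (\<gamma> e) = open_edge \<gamma> e \<union> e"
  using edge_verts by (auto simp: open_edge_def)

lemma open_edge_conv:
  assumes "e \<in> edges G"
  shows "open_edge \<gamma> e = \<gamma> e ` {0<..<1}"
proof -
  have inj: "inj_on (\<gamma> e) {0..1}" using arc_edge[OF assms] by (auto simp: arc_def)
  have e: "e = {\<gamma> e 0, \<gamma> e 1}"
    using ends_edge[OF assms] by (simp add: pathstart_def pathfinish_def)
  show ?thesis
  proof
    show "open_edge \<gamma> e \<subseteq> \<gamma> e ` {0<..<1}"
    proof
      fix p assume "p \<in> open_edge \<gamma> e"
      then obtain t where t: "p = \<gamma> e t" "0 \<le> t" "t \<le> 1" "p \<notin> e"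
        by (auto simp: open_edge_def path_image_def)
      then have "t \<noteq> 0" "t \<noteq> 1" using e by auto
      then show "p \<in> \<gamma> e ` {0<..<1}" using t by auto
    qed
    have "\<gamma> e t \<notin> e" if "0 < t" "t < 1" for t
    proof -
      have "\<gamma> e t \<noteq> \<gamma> e 0" "\<gamma> e t \<noteq> \<gamma> e 1" using inj_onD[OF inj, of t] that by fastforce+
      then show ?thesis using e by blast
    qed
    then show "\<gamma> e ` {0<..<1} \<subseteq> open_edge \<gamma> e"
      by (auto simp: open_edge_def path_image_def)
  qed
qed

definition rest :: "complex set \<Rightarrow> complex set" where
  "rest e = verts G \<union> curve \<gamma> (edges G - {e})"

lemma finite_verts: "finite (verts G)"
  using simple by (simp add: simple_graph_def)

lemma compact_curve: "C \<subseteq> edges G \<Longrightarrow> compact (curve \<gamma> C)"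
  unfolding curve_def using finite_subset finite_edges[OF simple] arc_edge
  by (intro compact_UN) (blast intro: compact_arc_image)+

lemma drawing_rest: "e \<in> edges G \<Longrightarrow> drawing G \<gamma> = rest e \<union> path_image (\<gamma> e)"
  by (auto simp: drawing_def rest_def curve_def)

lemma compact_drawing: "compact (drawing G \<gamma>)"
  using compact_curve[of "edges G"] finite_verts
  by (auto simp: drawing_def curve_def finite_imp_compact intro: compact_Un)

lemma closed_rest: "closed (rest e)"
  unfolding rest_def using compact_curve[of "edges G - {e}"] finite_verts
  by (auto simp: compact_imp_closed finite_imp_closed)

lemma open_edge_disjoint_rest: "e \<in> edges G \<Longrightarrow> open_edge \<gamma> e \<inter> rest e = {}"
  using edge_verts edges_meet by (fastforce simp: open_edge_def rest_def curve_def)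

lemma rest_meets_edge: "e \<in> edges G \<Longrightarrow> rest e \<inter> path_image (\<gamma> e) = e"
  using open_edge_disjoint_rest[of e] edge_image[of e] simple
  by (auto simp: rest_def simple_graph_def)

lemma open_edge_subset_drawing: "e \<in> edges G \<Longrightarrow> open_edge \<gamma> e \<subseteq> drawing G \<gamma>"
  by (auto simp: open_edge_def drawing_def)

lemma face_connected: "F \<in> faces G \<gamma> \<Longrightarrow> connected F"
  by (simp add: faces_def in_components_connected)

lemma face_drawing: "F \<in> faces G \<gamma> \<Longrightarrow> F \<inter> drawing G \<gamma> = {}"
  using in_components_subset by (fastforce simp: faces_def)

lemma face_frontier: "F \<in> faces G \<gamma> \<Longrightarrow> frontier F \<subseteq> drawing G \<gamma>"
  using frontier_of_components_closed_complement[OF compact_imp_closed[OF compact_drawing]]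
  by (simp add: faces_def)

lemma face_open: "F \<in> faces G \<gamma> \<Longrightarrow> open F"
  using open_components[OF open_Compl[OF compact_imp_closed[OF compact_drawing]]]
  by (simp add: faces_def)

lemma face_eq:
  assumes "F \<in> faces G \<gamma>" "F' \<in> faces G \<gamma>" "a \<in> F" "b \<in> F'"
    "connected_component (- drawing G \<gamma>) a b"
  shows "F = F'"
proof -
  obtain T where T: "connected T" "T \<subseteq> - drawing G \<gamma>" "a \<in> T" "b \<in> T"
    using assms(5) by (auto simp: connected_component_def)
  have "T \<subseteq> F" using components_maximal[of F _ T] assms T by (auto simp: faces_def)
  then show ?thesis using components_nonoverlap[of F _ F'] assms T by (auto simp: faces_def)
qed

text \<open>The previous lemma, applied to the edge in both directions, carries contact with a face over the
  whole open edge; the two ends follow because the closure is closed.\<close>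

lemma periphery_if_touches:
  assumes F: "F \<in> faces G \<gamma>" and e: "e \<in> edges G" and p: "p \<in> open_edge \<gamma> e" "p \<in> closure F"
  shows "e \<in> periphery G \<gamma> F"
proof -
  let ?g = "\<gamma> e"
  obtain s where s: "p = ?g s" "0 < s" "s < 1"
    using p(1) open_edge_conv[OF e] by auto
  have e2: "e \<subseteq> rest e" using rest_meets_edge[OF e] by blast
  have ends: "{pathstart ?g, pathfinish ?g} = e" using ends_edge e by blast
  have comp: "F \<in> components (- (rest e \<union> path_image ?g))"
    using F drawing_rest[OF e] by (simp add: faces_def)
  have inside: "?g t \<in> closure F" if t: "0 < t" "t < 1" for t
  proof -
    consider "s = t" | "s < t" | "t < s" by linarith
    then show ?thesis
    proof cases
      case 1 then show ?thesis using p s by simp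
    next
      case 2
      show ?thesis
        by (rule arc_frontier_forward[OF arc_edge[OF e] closed_rest _ _ comp s(2) 2 t(2)])
          (use rest_meets_edge[OF e] e2 ends p s in auto)
    next
      case 3
      have "reversepath ?g (1 - t) \<in> closure F"
      proof (rule arc_frontier_forward[of _ "rest e" _ "1 - s"])
        show "arc (reversepath ?g)" using arc_edge[OF e] by (rule arc_reversepath)
        show "path_image (reversepath ?g) \<inter> rest e \<subseteq>
            {pathstart (reversepath ?g), pathfinish (reversepath ?g)}"
          using rest_meets_edge[OF e] ends by auto
        show "pathstart (reversepath ?g) \<in> rest e" using e2 ends by auto
        show "F \<in> components (- (rest e \<union> path_image (reversepath ?g)))" using comp by simp
        show "reversepath ?g (1 - s) \<in> closure F" using s p by (simp add: reversepath_def)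
      qed (use s t 3 closed_rest in auto)
      then show ?thesis by (simp add: reversepath_def)
    qed
  qed
  have "continuous_on {0..1} ?g" using arc_edge[OF e] by (simp add: arc_def path_def)
  then have "?g ` closure {0<..<1} \<subseteq> closure (?g ` {0<..<1})"
    by (intro image_closure_subset[of _ _ "closure (?g ` {0<..<1})"])
      (auto intro: closure_subset[THEN subsetD])
  moreover have "closure (?g ` {0<..<1}) \<subseteq> closure F"
    using inside by (intro closure_minimal) auto
  ultimately have "path_image ?g \<subseteq> closure F"
    by (simp add: path_image_def)
  moreover have "path_image ?g \<inter> interior F = {}"
    using face_drawing[OF F] e interior_subset by (fastforce simp: drawing_def)
  ultimately show ?thesis using e by (auto simp: periphery_def frontier_def)
qed

lemma oriented_edge:
  assumes "{u, v} \<in> edges G"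
  obtains c where "arc c" "pathstart c = u" "pathfinish c = v"
    "path_image c = path_image (\<gamma> {u, v})"
proof -
  have "{pathstart (\<gamma> {u, v}), pathfinish (\<gamma> {u, v})} = {u, v}" using ends_edge assms by blast
  then consider "pathstart (\<gamma> {u, v}) = u" "pathfinish (\<gamma> {u, v}) = v"
    | "pathstart (\<gamma> {u, v}) = v" "pathfinish (\<gamma> {u, v}) = u"
    by (auto simp: doubleton_eq_iff)
  then show thesis
  proof cases
    case 1 then show ?thesis using that arc_edge[OF assms] by blast
  next
    case 2 then show ?thesis using that[of "reversepath (\<gamma> {u, v})"] arc_reversepath[OF arc_edge[OF assms]] by simp
  qed
qed

lemma path_arc:
  assumes "distinct (x # y # zs)" "successively (adj G) (x # y # zs)"
  shows "\<exists>c. arc c \<and> pathstart c = x \<and> pathfinish c = last (y # zs) \<and>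
    path_image c = curve \<gamma> (path_edges (x # y # zs))"
  using assms
proof (induction zs arbitrary: x y)
  case Nil
  then have "{x, y} \<in> edges G" by (simp add: adj_def)
  then obtain c where "arc c" "pathstart c = x" "pathfinish c = y"
    "path_image c = path_image (\<gamma> {x, y})" by (rule oriented_edge)
  then show ?case by (intro exI[of _ c]) (simp add: curve_def)
next
  case (Cons z zs)
  have "distinct (y # z # zs)" "successively (adj G) (y # z # zs)" using Cons.prems by auto
  then obtain c where c: "arc c" "pathstart c = y" "pathfinish c = last (z # zs)"
    "path_image c = curve \<gamma> (path_edges (y # z # zs))"
    using Cons.IH[of y z] by blast
  have xy: "{x, y} \<in> edges G" using Cons.prems by (simp add: adj_def)
  obtain d where d: "arc d" "pathstart d = x" "pathfinish d = y"
    "path_image d = path_image (\<gamma> {x, y})" using oriented_edge[OF xy] .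
  have sub: "path_edges (y # z # zs) \<subseteq> edges G"
    using Cons.prems path_edges_successively[of G "y # z # zs"] by auto
  have "path_image d \<inter> path_image c \<subseteq> {pathstart c}"
  proof
    fix p assume p: "p \<in> path_image d \<inter> path_image c"
    then obtain e where e: "e \<in> path_edges (y # z # zs)" "p \<in> path_image (\<gamma> e)"
      using c by (auto simp: curve_def)
    have "x \<notin> e" using path_edges_subset[OF e(1)] Cons.prems by auto
    have "e \<in> edges G" "e \<noteq> {x, y}" using e(1) sub \<open>x \<notin> e\<close> by auto
    then have "path_image (\<gamma> {x, y}) \<inter> path_image (\<gamma> e) = {x, y} \<inter> e"
      using edges_meet[OF xy, of e] by metis
    then have "p \<in> {x, y} \<inter> e" using p e(2) d(4) by blast
    then show "p \<in> {pathstart c}" using c(2) \<open>x \<notin> e\<close> by blast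
  qed
  then have "arc (d +++ c)" using d c by (intro arc_join) auto
  moreover have "path_image (d +++ c) = curve \<gamma> (path_edges (x # y # z # zs))"
    using d c by (subst path_image_join) (auto simp: curve_def)
  ultimately show ?case using c d by (intro exI[of _ "d +++ c"]) auto
qed

text \<open>Removing one edge from a cycle leaves an arc, and the edge closes this arc to a Jordan curve.\<close>

lemma cycle_curve:
  assumes "is_cycle G xs" "e \<in> cycle_edges xs"
  shows "connected (curve \<gamma> (cycle_edges xs - {e}))"
    and "\<exists>c. simple_path c \<and> pathfinish c = pathstart c \<and> path_image c = curve \<gamma> (cycle_edges xs)"
    and "e \<subseteq> curve \<gamma> (cycle_edges xs - {e})"
proof -
  obtain ys where ys: "is_cycle G ys" "cycle_edges ys = cycle_edges xs" "e = {last ys, hd ys}"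
    using cycle_end_at_edge assms by metis
  have "3 \<le> length ys" using ys by (simp add: is_cycle_def)
  then obtain x y z zs where z: "ys = x # y # z # zs"
    by (metis One_nat_def Suc_le_length_iff numeral_3_eq_3)
  have dist: "distinct ys" and succ: "successively (adj G) ys" and e': "{last ys, x} \<in> edges G"
    using ys(1) z by (auto simp: is_cycle_def adj_def)
  obtain c where c: "arc c" "pathstart c = x" "pathfinish c = last ys"
    "path_image c = curve \<gamma> (path_edges ys)"
    using path_arc[of x y "z # zs"] dist succ z by auto
  have "x \<notin> f" if "f \<in> path_edges (y # z # zs)" for f
    using path_edges_subset[OF that] dist z by auto
  moreover have "last ys \<noteq> y" using dist z by auto
  ultimately have "e \<notin> path_edges ys" using z ys(3) dist by (auto simp: doubleton_eq_iff)
  moreover have "cycle_edges xs = insert e (path_edges ys)"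
    using ys cycle_edges_conv[of ys] z by auto
  ultimately have pe: "cycle_edges xs - {e} = path_edges ys" by auto
  show "connected (curve \<gamma> (cycle_edges xs - {e}))"
    using c pe connected_arc_image by metis
  show "e \<subseteq> curve \<gamma> (cycle_edges xs - {e})"
  proof -
    have "{pathstart c, pathfinish c} \<subseteq> path_image c" by auto
    then show ?thesis using c pe ys(3) z by auto
  qed
  obtain d where d: "arc d" "pathstart d = last ys" "pathfinish d = x"
    "path_image d = path_image (\<gamma> e)" using oriented_edge[OF e'] ys(3) z by auto
  have eG: "e \<in> edges G" using e' ys(3) z by simp
  have "path_image c \<inter> path_image d \<subseteq> {pathstart c, pathstart d}"
  proof
    fix p assume p: "p \<in> path_image c \<inter> path_image d"
    then obtain f where f: "f \<in> path_edges ys" "p \<in> path_image (\<gamma> f)"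
      using c by (auto simp: curve_def)
    have "f \<in> edges G" using f path_edges_successively[OF succ] by auto
    then have "path_image (\<gamma> f) \<inter> path_image (\<gamma> e) = f \<inter> e"
      using edges_meet[OF _ eG] f(1) \<open>e \<notin> path_edges ys\<close> by metis
    then have "p \<in> e" using p f(2) d(4) by blast
    then show "p \<in> {pathstart c, pathstart d}" using d(2) c(2) ys(3) z by auto
  qed
  then have "simple_path (c +++ d)" using c d by (intro simple_path_join_loop) auto
  moreover have "path_image (c +++ d) = curve \<gamma> (cycle_edges xs)"
    using c d \<open>cycle_edges xs = insert e (path_edges ys)\<close>
    by (subst path_image_join) (auto simp: curve_def)
  ultimately show "\<exists>c. simple_path c \<and> pathfinish c = pathstart c \<and> path_image c = curve \<gamma> (cycle_edges xs)"
    using c(2) d(3) by (intro exI[of _ "c +++ d"]) (simp only: pathstart_join pathfinish_join simp_thms)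
qed

text \<open>Near an interior point of an edge \<open>e\<close> of a cycle there are at most two faces, one for each side of
  the cycle: two points on the same side are not separated by the cycle, nor by the drawing without
  the open edge, and these two closed sets meet in a connected set (the rest of the cycle), so by
  Janiszewski's theorem their union, the whole drawing, does not separate the points.\<close>

lemma same_side_connected:
  assumes cyc: "is_cycle G xs" "e \<in> cycle_edges xs"
    and ab: "a \<notin> drawing G \<gamma>" "b \<notin> drawing G \<gamma>"
    and ball: "a \<in> ball p r" "b \<in> ball p r" "ball p r \<inter> rest e = {}"
    and side: "a \<in> inside (curve \<gamma> (cycle_edges xs)) \<longleftrightarrow> b \<in> inside (curve \<gamma> (cycle_edges xs))"
  shows "connected_component (- drawing G \<gamma>) a b"
proof -
  let ?C = "cycle_edges xs" and ?K = "curve \<gamma> (cycle_edges xs)"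
  have sub: "?C \<subseteq> edges G" using cycle_edges_subset cyc by blast
  have e: "e \<in> edges G" using sub cyc by blast
  have K: "?K \<subseteq> drawing G \<gamma>" using sub by (auto simp: curve_def drawing_def)
  have cl: "closed (rest e)" by (rule closed_rest)
  have "?K = path_image (\<gamma> e) \<union> curve \<gamma> (?C - {e})" using cyc by (auto simp: curve_def)
  moreover have "curve \<gamma> (?C - {e}) \<subseteq> rest e" using sub by (auto simp: rest_def curve_def)
  moreover have "e \<subseteq> curve \<gamma> (?C - {e})" using cycle_curve(3) cyc by blast
  ultimately have "?K \<inter> rest e = curve \<gamma> (?C - {e})"
    using rest_meets_edge[OF e] by blast
  then have conn: "connected (?K \<inter> rest e)" using cycle_curve(1) cyc by simp
  have "connected_component (- rest e) a b"
    unfolding connected_component_def using ball by (intro exI[of _ "ball p r"]) auto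
  moreover have "connected_component (- ?K) a b"
  proof -
    obtain c where c: "simple_path c" "pathfinish c = pathstart c" "path_image c = ?K"
      using cycle_curve(2) cyc by blast
    note J = Jordan_inside_outside[OF c(1,2), unfolded c(3)]
    have "a \<in> inside ?K \<union> outside ?K" "b \<in> inside ?K \<union> outside ?K"
      using ab K J by auto
    then have "a \<in> inside ?K \<and> b \<in> inside ?K \<or> a \<in> outside ?K \<and> b \<in> outside ?K"
      using side J by blast
    moreover have "inside ?K \<subseteq> - ?K" "outside ?K \<subseteq> - ?K" using J by blast+
    ultimately show ?thesis using J unfolding connected_component_def by meson
  qed
  ultimately have "connected_component (- (?K \<union> rest e)) a b"
    using Janiszewski[OF compact_curve[OF sub] cl conn] by blast
  moreover have "?K \<union> rest e = drawing G \<gamma>"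
    using drawing_rest[OF e] K cyc(2) by (auto simp: curve_def)
  ultimately show ?thesis by simp
qed

lemma open_edge_ball:
  assumes "e \<in> edges G" "p \<in> open_edge \<gamma> e"
  obtains r where "r > 0" "ball p r \<inter> rest e = {}"
proof -
  have "p \<in> - rest e" using open_edge_disjoint_rest assms by blast
  then show thesis
    using that closed_rest[of e] by (meson open_Compl open_contains_ball disjoint_eq_subset_Compl)
qed

lemma open_edge_nonempty:
  assumes "e \<in> edges G"
  obtains p where "p \<in> open_edge \<gamma> e"
  using open_edge_conv[OF assms] that[of "\<gamma> e (1/2)"] by auto

lemma periphery_closure:
  "e \<in> periphery G \<gamma> F \<Longrightarrow> p \<in> open_edge \<gamma> e \<Longrightarrow> p \<in> closure F"
  by (auto simp: periphery_def frontier_def open_edge_def)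

lemma face_one_side:
  assumes "F \<in> faces G \<gamma>" "is_cycle G xs" "a \<in> F"
  shows "a \<in> inside (curve \<gamma> (cycle_edges xs)) \<longleftrightarrow> F \<subseteq> inside (curve \<gamma> (cycle_edges xs))"
proof -
  let ?K = "curve \<gamma> (cycle_edges xs)"
  obtain e where e: "e \<in> cycle_edges xs" using cycle_edges_nonempty assms(2) by blast
  obtain c where c: "simple_path c" "pathfinish c = pathstart c" "path_image c = ?K"
    using cycle_curve(2)[OF assms(2) e] by blast
  note J = Jordan_inside_outside[OF c(1,2), unfolded c(3)]
  have "?K \<subseteq> drawing G \<gamma>"
    using cycle_edges_subset[OF assms(2)] by (auto simp: curve_def drawing_def)
  then have "F \<subseteq> inside ?K \<union> outside ?K" using J face_drawing[OF assms(1)] by auto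
  then have "F \<inter> inside ?K = {} \<or> F \<inter> outside ?K = {}"
    using J connectedD[OF face_connected[OF assms(1)], of "inside ?K" "outside ?K"] by blast
  then show ?thesis using assms(3) \<open>F \<subseteq> inside ?K \<union> outside ?K\<close> by blast
qed

text \<open>An interior point of an edge off the cycle has a neighbourhood on one side of the cycle. If the
  edge is on the cycle, then two faces on the same side would be connected near the edge.\<close>

lemma edge_changes_side:
  assumes F: "F \<in> faces G \<gamma>" "F' \<in> faces G \<gamma>" "F \<noteq> F'"
    and e: "e \<in> periphery G \<gamma> F" "e \<in> periphery G \<gamma> F'" and cyc: "is_cycle G xs"
  shows "e \<in> cycle_edges xs \<longleftrightarrow>
    (F \<subseteq> inside (curve \<gamma> (cycle_edges xs))) \<noteq> (F' \<subseteq> inside (curve \<gamma> (cycle_edges xs)))"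
proof -
  let ?C = "cycle_edges xs" and ?K = "curve \<gamma> (cycle_edges xs)"
  have eG: "e \<in> edges G" using e by (simp add: periphery_def)
  obtain p where p: "p \<in> open_edge \<gamma> e" using open_edge_nonempty[OF eG] .
  have cl: "p \<in> closure F" "p \<in> closure F'" using periphery_closure e p by blast+
  have sub: "?C \<subseteq> edges G" using cycle_edges_subset cyc by blast
  show ?thesis
  proof (cases "e \<in> ?C")
    case True
    obtain r where r: "r > 0" "ball p r \<inter> rest e = {}" using open_edge_ball[OF eG p] .
    obtain a b where ab: "a \<in> F" "dist a p < r" "b \<in> F'" "dist b p < r"
      using cl r(1) by (meson closure_approachable)
    have "\<not> connected_component (- drawing G \<gamma>) a b"
      using face_eq F ab by blast
    then have "(a \<in> inside ?K) \<noteq> (b \<in> inside ?K)"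
      using same_side_connected[OF cyc True, of a b p r] ab r F face_drawing
      by (auto simp: dist_commute)
    then show ?thesis using True face_one_side[OF F(1) cyc ab(1)] face_one_side[OF F(2) cyc ab(3)] by simp
  next
    case False
    obtain e0 where "e0 \<in> ?C" using cycle_edges_nonempty cyc by blast
    then obtain c where c: "simple_path c" "pathfinish c = pathstart c" "path_image c = ?K"
      using cycle_curve(2)[OF cyc] by blast
    note J = Jordan_inside_outside[OF c(1,2), unfolded c(3)]
    have "p \<notin> ?K"
      using p sub edges_meet[OF eG] False by (fastforce simp: curve_def open_edge_def)
    have "\<exists>S. open S \<and> p \<in> S \<and> (S = inside ?K \<or> S = outside ?K)" using J \<open>p \<notin> ?K\<close> by blast
    then obtain S where S: "open S" "p \<in> S" "S = inside ?K \<or> S = outside ?K" by blast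
    obtain a b where ab: "a \<in> F" "a \<in> S" "b \<in> F'" "b \<in> S"
      using cl S(1,2) by (metis IntE closure_iff_nhds_not_empty disjoint_iff subset_refl)
    have "a \<in> inside ?K \<longleftrightarrow> b \<in> inside ?K" using ab S J by blast
    then show ?thesis using False face_one_side[OF F(1) cyc ab(1)] face_one_side[OF F(2) cyc ab(3)] by simp
  qed
qed

text \<open>A cycle has only two sides, so two of the three faces lie on the same side.\<close>

lemma three_faces:
  assumes F: "F1 \<in> faces G \<gamma>" "F2 \<in> faces G \<gamma>" "F3 \<in> faces G \<gamma>"
    and e: "e \<in> periphery G \<gamma> F1" "e \<in> periphery G \<gamma> F2" "e \<in> periphery G \<gamma> F3"
    and cyc: "is_cycle G xs" "e \<in> cycle_edges xs"
  shows "F1 = F2 \<or> F1 = F3 \<or> F2 = F3"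
  using edge_changes_side[OF F(1,2) _ e(1,2) cyc(1)] edge_changes_side[OF F(1,3) _ e(1,3) cyc(1)]
    edge_changes_side[OF F(2,3) _ e(2,3) cyc(1)] cyc(2) by blast

text \<open>If the peripheries of some bounded faces cancelled modulo two, then these faces together with
  their open boundary edges would form a bounded set that is open and closed in the complement of
  the finitely many vertices.\<close>

theorem peripheries_independent:
  assumes S: "finite S" "S \<subseteq> finite_faces G \<gamma>"
    and cyc: "\<And>F. F \<in> S \<Longrightarrow> \<exists>xs. is_cycle G xs \<and> periphery G \<gamma> F = cycle_edges xs"
    and ev: "\<And>e. e \<in> edges G \<Longrightarrow> even (card {F \<in> S. e \<in> periphery G \<gamma> F})"
  shows "S = {}"
proof (rule ccontr)
  assume "S \<noteq> {}"
  define B where "B = (\<Union>F\<in>S. periphery G \<gamma> F)"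
  define U where "U = \<Union>S \<union> (\<Union>e\<in>B. open_edge \<gamma> e)"
  have face: "F \<in> faces G \<gamma>" "bounded F" if "F \<in> S" for F
    using S(2) that by (auto simp: finite_faces_def)
  have BG: "B \<subseteq> edges G" by (auto simp: B_def periphery_def)
  then have finB: "finite B" using finite_edges[OF simple] finite_subset by blast
  have Uv: "U \<inter> verts G = {}"
  proof -
    have "F \<inter> verts G = {}" if "F \<in> S" for F
      using face_drawing[OF face(1)[OF that]] by (auto simp: drawing_def)
    moreover have "open_edge \<gamma> e \<inter> verts G = {}" if "e \<in> B" for e
      using edge_verts[of e] BG that by (auto simp: open_edge_def)
    ultimately show ?thesis by (auto simp: U_def)
  qed
  have nbhd: "\<exists>r>0. ball p r \<subseteq> U" if e: "e \<in> B" and p: "p \<in> open_edge \<gamma> e" for e p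
  proof -
    obtain F where F: "F \<in> S" "e \<in> periphery G \<gamma> F" using e by (auto simp: B_def)
    have eG: "e \<in> edges G" using e BG by blast
    have "\<exists>F'\<in>S. F' \<noteq> F \<and> e \<in> periphery G \<gamma> F'"
    proof (rule ccontr)
      assume "\<not> ?thesis"
      then have "{F \<in> S. e \<in> periphery G \<gamma> F} = {F}" using F by auto
      then show False using ev[OF eG] by simp
    qed
    then obtain F' where F': "F' \<in> S" "F' \<noteq> F" "e \<in> periphery G \<gamma> F'" by blast
    obtain xs where xs: "is_cycle G xs" "periphery G \<gamma> F = cycle_edges xs" using cyc F by blast
    have exs: "e \<in> cycle_edges xs" using F xs by simp
    let ?K = "curve \<gamma> (cycle_edges xs)"
    obtain r where r: "r > 0" "ball p r \<inter> rest e = {}" using open_edge_ball[OF eG p] .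
    obtain a b where ab: "a \<in> F" "dist a p < r" "b \<in> F'" "dist b p < r"
      using periphery_closure[OF F(2) p] periphery_closure[OF F'(3) p] r(1)
      by (meson closure_approachable)
    have "(F \<subseteq> inside ?K) \<noteq> (F' \<subseteq> inside ?K)"
      using edge_changes_side[OF face(1)[OF F(1)] face(1)[OF F'(1)] _ F(2) F'(3) xs(1)] F'(2) exs by blast
    then have opp: "(a \<in> inside ?K) \<noteq> (b \<in> inside ?K)"
      using face_one_side[OF face(1)[OF F(1)] xs(1) ab(1)] face_one_side[OF face(1)[OF F'(1)] xs(1) ab(3)]
      by simp
    have "x \<in> U" if x: "x \<in> ball p r" for x
    proof (cases "x \<in> drawing G \<gamma>")
      case True
      then have "x \<in> path_image (\<gamma> e)" "x \<notin> e"
        using drawing_rest[OF eG] r(2) x rest_meets_edge[OF eG] by blast+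
      then show ?thesis using e by (auto simp: U_def open_edge_def)
    next
      case False
      have ball: "a \<in> ball p r" "b \<in> ball p r" using ab by (auto simp: dist_commute)
      have nd: "a \<notin> drawing G \<gamma>" "b \<notin> drawing G \<gamma>"
        using ab face_drawing[OF face(1)] F F' by blast+
      have "connected_component (- drawing G \<gamma>) a x \<or> connected_component (- drawing G \<gamma>) b x"
        using same_side_connected[OF xs(1) exs nd(1) False ball(1) x r(2)]
          same_side_connected[OF xs(1) exs nd(2) False ball(2) x r(2)] opp by blast
      then have "x \<in> F \<or> x \<in> F'"
      proof
        assume "connected_component (- drawing G \<gamma>) a x"
        then obtain T where "connected T" "T \<subseteq> - drawing G \<gamma>" "a \<in> T" "x \<in> T"
          by (auto simp: connected_component_def)
        then show ?thesis
          using components_maximal[of F "- drawing G \<gamma>" T] face(1)[OF F(1)] ab by (auto simp: faces_def)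
      next
        assume "connected_component (- drawing G \<gamma>) b x"
        then obtain T where "connected T" "T \<subseteq> - drawing G \<gamma>" "b \<in> T" "x \<in> T"
          by (auto simp: connected_component_def)
        then show ?thesis
          using components_maximal[of F' "- drawing G \<gamma>" T] face(1)[OF F'(1)] ab by (auto simp: faces_def)
      qed
      then show ?thesis using F F' by (auto simp: U_def)
    qed
    then show ?thesis using r(1) by blast
  qed
  have opU: "open U"
  proof (rule openI)
    fix p assume "p \<in> U"
    then consider F where "F \<in> S" "p \<in> F" | e where "e \<in> B" "p \<in> open_edge \<gamma> e"
      by (auto simp: U_def)
    then show "\<exists>r>0. ball p r \<subseteq> U"
    proof cases
      case (1 F)
      then obtain r where "r > 0" "ball p r \<subseteq> F"
        using face_open[OF face(1)] by (meson open_contains_ball)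
      then show ?thesis using 1 by (auto simp: U_def)
    qed (rule nbhd)
  qed
  have clF: "closure F \<subseteq> U \<union> verts G" if F: "F \<in> S" for F
  proof
    fix p assume p: "p \<in> closure F"
    show "p \<in> U \<union> verts G"
    proof (cases "p \<in> F \<or> p \<in> verts G")
      case True then show ?thesis using F by (auto simp: U_def)
    next
      case False
      then have "p \<in> frontier F" using p face_open[OF face(1)[OF F]] by (simp add: frontier_def interior_open)
      then obtain e where e: "e \<in> edges G" "p \<in> path_image (\<gamma> e)"
        using face_frontier[OF face(1)[OF F]] False by (auto simp: drawing_def)
      then have "p \<in> open_edge \<gamma> e" using False edge_verts[of e] by (auto simp: open_edge_def)
      moreover from this have "e \<in> B"
        using periphery_if_touches[OF face(1)[OF F] e(1) _ p] F by (auto simp: B_def)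
      ultimately show ?thesis by (auto simp: U_def)
    qed
  qed
  have "closed (U \<union> verts G)"
  proof -
    have "U \<union> verts G = (\<Union>F\<in>S. closure F) \<union> (\<Union>e\<in>B. path_image (\<gamma> e)) \<union> verts G"
    proof
      have "F \<subseteq> closure F" for F :: "complex set" by (rule closure_subset)
      then show "U \<union> verts G \<subseteq> (\<Union>F\<in>S. closure F) \<union> (\<Union>e\<in>B. path_image (\<gamma> e)) \<union> verts G"
        unfolding U_def open_edge_def by blast
      have "path_image (\<gamma> e) \<subseteq> U \<union> verts G" if "e \<in> B" for e
        using that BG edge_verts[of e] by (auto simp: U_def open_edge_def)
      then show "(\<Union>F\<in>S. closure F) \<union> (\<Union>e\<in>B. path_image (\<gamma> e)) \<union> verts G \<subseteq> U \<union> verts G"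
        using clF by blast
    qed
    moreover have "closed (\<Union>e\<in>B. path_image (\<gamma> e))"
      using compact_curve[OF BG] by (simp add: curve_def compact_imp_closed)
    moreover have "closed (\<Union>F\<in>S. closure F)" using S(1) by (intro closed_UN) auto
    ultimately show ?thesis using finite_imp_closed[OF finite_verts] by (simp add: closed_Un)
  qed
  moreover have conn: "connected (- verts G)"
    using path_connected_complement_countable[of "verts G"] finite_verts
    by (simp add: countable_finite path_connected_imp_connected)
  ultimately have "U \<inter> - verts G = {} \<or> - (U \<union> verts G) \<inter> - verts G = {}"
    using connectedD[OF conn opU, of "- (U \<union> verts G)"] by blast
  moreover obtain F where "F \<in> S" using \<open>S \<noteq> {}\<close> by blast
  then have "F \<noteq> {}" "F \<subseteq> U"
    using face(1) in_components_nonempty by (auto simp: U_def faces_def)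
  ultimately have "U \<union> verts G = UNIV" using Uv by blast
  moreover have "bounded (U \<union> verts G)"
  proof -
    have "bounded (\<Union>S)" using S(1) face(2) by (simp add: bounded_Union)
    moreover have "(\<Union>e\<in>B. open_edge \<gamma> e) \<subseteq> drawing G \<gamma>"
      using BG open_edge_subset_drawing by blast
    ultimately show ?thesis
      using bounded_subset[OF compact_imp_bounded[OF compact_drawing]] finite_verts
      by (auto simp: U_def finite_imp_bounded)
  qed
  ultimately show False using not_bounded_UNIV by metis
qed

end

section \<open>Graph isomorphisms\<close>

lemma graph_iso_sym:
  assumes "G \<simeq>\<^sub>g G'" shows "G' \<simeq>\<^sub>g G"
proof -
  obtain f where f: "bij_betw f (verts G) (verts G')"
    "\<And>u v. u \<in> verts G \<Longrightarrow> v \<in> verts G \<Longrightarrow> adj G u v \<longleftrightarrow> adj G' (f u) (f v)"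
    using assms by (auto simp: graph_iso_def)
  let ?g = "inv_into (verts G) f"
  have g: "bij_betw ?g (verts G') (verts G)" using bij_betw_inv_into f(1) by blast
  have "adj G' u v \<longleftrightarrow> adj G (?g u) (?g v)" if "u \<in> verts G'" "v \<in> verts G'" for u v
    using f(2)[of "?g u" "?g v"] that g f(1)
    by (simp add: bij_betw_apply bij_betw_inv_into_right[OF f(1)])
  then show ?thesis using g by (auto simp: graph_iso_def)
qed

lemma graph_iso_trans:
  assumes "G \<simeq>\<^sub>g G'" "G' \<simeq>\<^sub>g G''" shows "G \<simeq>\<^sub>g G''"
proof -
  obtain f where f: "bij_betw f (verts G) (verts G')"
    "\<And>u v. u \<in> verts G \<Longrightarrow> v \<in> verts G \<Longrightarrow> adj G u v \<longleftrightarrow> adj G' (f u) (f v)"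
    using assms by (auto simp: graph_iso_def)
  obtain g where g: "bij_betw g (verts G') (verts G'')"
    "\<And>u v. u \<in> verts G' \<Longrightarrow> v \<in> verts G' \<Longrightarrow> adj G' u v \<longleftrightarrow> adj G'' (g u) (g v)"
    using assms by (auto simp: graph_iso_def)
  have "bij_betw (g \<circ> f) (verts G) (verts G'')" using f g bij_betw_trans by blast
  moreover have "adj G u v \<longleftrightarrow> adj G'' ((g \<circ> f) u) ((g \<circ> f) v)" if "u \<in> verts G" "v \<in> verts G" for u v
    using f(2)[OF that] g(2)[of "f u" "f v"] that f(1) by (simp add: bij_betw_apply)
  ultimately show ?thesis unfolding graph_iso_def by blast
qed

lemma forest_iso:
  assumes "G \<simeq>\<^sub>g G'" "forest G'" shows "forest G"
  unfolding forest_def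
proof
  assume "\<exists>xs. is_cycle G xs"
  then obtain xs where xs: "is_cycle G xs" by blast
  obtain f where f: "bij_betw f (verts G) (verts G')"
    "\<And>u v. u \<in> verts G \<Longrightarrow> v \<in> verts G \<Longrightarrow> adj G u v \<longleftrightarrow> adj G' (f u) (f v)"
    using assms by (auto simp: graph_iso_def)
  have sub: "set xs \<subseteq> verts G" and ne: "xs \<noteq> []" using xs by (auto simp: is_cycle_def)
  have "is_cycle G' (map f xs)"
    unfolding is_cycle_def
  proof (intro conjI)
    show "distinct (map f xs)"
      using xs f(1) sub by (auto simp: is_cycle_def distinct_map bij_betw_def intro: inj_on_subset)
    show "set (map f xs) \<subseteq> verts G'" using sub f(1) by (auto simp: bij_betw_def)
    have "successively (\<lambda>x y. adj G' (f x) (f y)) xs"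
      using xs f(2) sub by (auto simp: is_cycle_def intro: successively_mono)
    then show "successively (adj G') (map f xs)" by (simp add: successively_map)
    show "adj G' (last (map f xs)) (hd (map f xs))"
      using f(2)[of "last xs" "hd xs"] last_in_set[OF ne] hd_in_set[OF ne] xs sub ne
      by (simp add: is_cycle_def last_map hd_map subset_iff)
  qed (use xs in \<open>auto simp: is_cycle_def\<close>)
  then show False using assms(2) by (auto simp: forest_def)
qed

lemma connected_iso:
  assumes "G \<simeq>\<^sub>g G'" "connected_graph G" shows "connected_graph G'"
proof -
  obtain f where f: "bij_betw f (verts G) (verts G')"
    "\<And>u v. u \<in> verts G \<Longrightarrow> v \<in> verts G \<Longrightarrow> adj G u v \<longleftrightarrow> adj G' (f u) (f v)"
    using assms by (auto simp: graph_iso_def)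
  have im: "verts G' = f ` verts G" using f(1) by (auto simp: bij_betw_def)
  have "\<exists>ys. walk G' (f u) ys (f v)" if uv: "u \<in> verts G" "v \<in> verts G" for u v
  proof -
    obtain xs where xs: "walk G u xs v" using assms(2) uv by (auto simp: connected_graph_def)
    have "successively (\<lambda>x y. adj G' (f x) (f y)) xs"
      using xs f(2) by (auto simp: walk_def intro: successively_mono)
    then have "walk G' (f u) (map f xs) (f v)"
      using xs im by (auto simp: walk_def successively_map last_map hd_map)
    then show ?thesis by blast
  qed
  then show ?thesis using assms(2) im by (auto simp: connected_graph_def)
qed

lemma tree_iso: "G \<simeq>\<^sub>g G' \<Longrightarrow> tree G \<longleftrightarrow> tree G'"
  using forest_iso connected_iso graph_iso_sym unfolding tree_def by metis

section \<open>Coordinates of a daisy cube\<close>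

text \<open>Reading a binary string as the set of its ones, a daisy cube becomes a family of finite sets
  that is closed under subsets (an abstract simplicial complex), in which two sets are adjacent if
  they differ in one element. The elements that occur are the directions of the edges.\<close>

definition coords :: "nat set set \<Rightarrow> nat set" where
  "coords D = {i. {i} \<in> D}"

text \<open>The path \<open>\<rho> \<union> {i}\<close>, \<open>\<rho>\<close>, \<open>\<rho> \<union> {j}\<close> cannot be completed to a square.\<close>

definition tau_adj :: "nat set set \<Rightarrow> nat \<Rightarrow> nat \<Rightarrow> bool" where
  "tau_adj D i j \<longleftrightarrow> i \<noteq> j \<and> (\<exists>\<rho>. insert i \<rho> \<in> D \<and> insert j \<rho> \<in> D \<and> insert i (insert j \<rho>) \<notin> D)"

definition coord_graph :: "nat set set \<Rightarrow> nat sgraph" where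
  "coord_graph D = \<lparr> verts = coords D,
     edges = {{i, j} | i j. i \<in> coords D \<and> j \<in> coords D \<and> tau_adj D i j} \<rparr>"

definition complex_graph :: "nat set set \<Rightarrow> nat set sgraph" where
  "complex_graph D = \<lparr> verts = D,
     edges = {{\<sigma>, \<rho>} | \<sigma> \<rho>. \<sigma> \<in> D \<and> \<rho> \<in> D \<and> card (sym_diff \<sigma> \<rho>) = 1} \<rparr>"

lemma tau_adj_sym: "tau_adj D i j \<longleftrightarrow> tau_adj D j i"
  unfolding tau_adj_def by (metis insert_commute)

lemma adj_coord_graph:
  "adj (coord_graph D) i j \<longleftrightarrow> i \<in> coords D \<and> j \<in> coords D \<and> tau_adj D i j"
  using tau_adj_sym[of D] by (auto simp: adj_def coord_graph_def doubleton_eq_iff)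

lemma doubleton_in_Collect: "{a, b} \<in> {{x, y} | x y. Q x y} \<longleftrightarrow> Q a b \<or> Q b a"
  unfolding mem_Collect_eq doubleton_eq_iff by blast

lemma sym_diff_comm: "sym_diff A B = sym_diff B A"
  by blast

lemma adj_complex_graph:
  "adj (complex_graph D) \<sigma> \<rho> \<longleftrightarrow> \<sigma> \<in> D \<and> \<rho> \<in> D \<and> card (sym_diff \<sigma> \<rho>) = 1"
  using sym_diff_comm[of \<sigma> \<rho>] by (auto simp: adj_def complex_graph_def doubleton_eq_iff)

locale simplicial_complex =
  fixes D :: "nat set set"
  assumes finite_complex: "finite D" and finite_simplex: "\<sigma> \<in> D \<Longrightarrow> finite \<sigma>"
    and down: "\<sigma> \<in> D \<Longrightarrow> \<rho> \<subseteq> \<sigma> \<Longrightarrow> \<rho> \<in> D" and empty: "{} \<in> D"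
begin

lemma coordsI: "\<sigma> \<in> D \<Longrightarrow> i \<in> \<sigma> \<Longrightarrow> i \<in> coords D"
  using down by (auto simp: coords_def)

lemma finite_coords: "finite (coords D)"
proof -
  have "coords D \<subseteq> \<Union>D" by (auto simp: coords_def)
  then show ?thesis using finite_complex finite_simplex finite_subset by blast
qed

lemma tau_adj_notin:
  assumes "insert i \<rho> \<in> D" "insert j \<rho> \<in> D" "insert i (insert j \<rho>) \<notin> D"
  shows "i \<notin> \<rho>" "j \<notin> \<rho>"
  using assms by (auto simp: insert_absorb insert_commute)

end

lemma hypercube_adj:
  "adj (hypercube h) u v \<longleftrightarrow> length u = h \<and> length v = h \<and> card {i. i < h \<and> u ! i \<noteq> v ! i} = 1"
proof -
  let ?P = "\<lambda>u v. length u = h \<and> length v = h \<and> card {i. i < h \<and> u ! i \<noteq> v ! i} = 1"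
  have sym: "?P v u" if "?P u v" for u v :: "bool list"
    using that by (simp add: eq_commute)
  show ?thesis
  proof
    assume "adj (hypercube h) u v"
    then have "\<exists>u' v'. {u, v} = {u', v'} \<and> ?P u' v'" by (simp add: adj_def hypercube_def)
    then obtain u' v' where "{u, v} = {u', v'}" "?P u' v'" by blast
    then show "?P u v" using sym[of u' v'] unfolding doubleton_eq_iff by blast
  next
    assume "?P u v"
    then show "adj (hypercube h) u v" unfolding adj_def hypercube_def by auto
  qed
qed

theorem daisy_cube_complex:
  assumes "daisy_cube H"
  obtains D where "simplicial_complex D" "H \<simeq>\<^sub>g complex_graph D"
proof -
  obtain h X where hX: "X \<noteq> {}" "X \<subseteq> {u. length u = h}" "H \<simeq>\<^sub>g daisy_cube_generated h X"
    using assms by (auto simp: daisy_cube_def)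
  define S where "S = {u. length u = h \<and> (\<exists>x\<in>X. list_all2 (\<le>) u x)}"
  define ones where "ones u = {i. i < h \<and> u ! i}" for u :: "bool list"
  have inj: "inj_on ones S"
  proof (rule inj_onI)
    fix u v assume uv: "u \<in> S" "v \<in> S" "ones u = ones v"
    then have "u ! i = v ! i" if "i < h" for i
      using that by (auto simp: ones_def set_eq_iff)
    then show "u = v" using uv by (auto simp: S_def intro: nth_equalityI)
  qed
  let ?D = "ones ` S"
  have "simplicial_complex ?D"
  proof
    have "S \<subseteq> {u. set u \<subseteq> UNIV \<and> length u = h}" by (auto simp: S_def)
    then show "finite ?D" using finite_lists_length_eq[of "UNIV :: bool set" h] finite_subset by auto
    show "finite \<sigma>" if "\<sigma> \<in> ?D" for \<sigma> using that by (auto simp: ones_def)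
    show down: "\<rho> \<in> ?D" if \<sigma>: "\<sigma> \<in> ?D" and sub: "\<rho> \<subseteq> \<sigma>" for \<sigma> \<rho>
    proof -
      obtain u x where u: "\<sigma> = ones u" "length u = h" "x \<in> X" "list_all2 (\<le>) u x"
        using \<sigma> by (auto simp: S_def)
      let ?w = "map (\<lambda>i. i \<in> \<rho>) [0..<h]"
      have "list_all2 (\<le>) ?w u" using u sub by (auto simp: list_all2_conv_all_nth ones_def)
      then have "list_all2 (\<le>) ?w x" using u(4) by (rule list_all2_trans[rotated]) auto
      then have "?w \<in> S" using u(3) by (auto simp: S_def)
      moreover have "ones ?w = \<rho>" using sub u(1) by (auto simp: ones_def)
      ultimately show ?thesis by (metis imageI)
    qed
    obtain x where "x \<in> X" using hX by blast
    then have "x \<in> S" using hX(2) by (auto simp: S_def list_all2_conv_all_nth)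
    then show "{} \<in> ?D" using down[of "ones x" "{}"] by blast
  qed
  moreover have "daisy_cube_generated h X \<simeq>\<^sub>g complex_graph ?D"
    unfolding graph_iso_def
  proof (intro exI[of _ ones] conjI ballI)
    have V: "verts (daisy_cube_generated h X) = S"
      by (auto simp: daisy_cube_generated_def induced_subgraph_def hypercube_def S_def)
    show "bij_betw ones (verts (daisy_cube_generated h X)) (verts (complex_graph ?D))"
      using inj V by (simp add: complex_graph_def bij_betw_def)
    fix u v assume uv: "u \<in> verts (daisy_cube_generated h X)" "v \<in> verts (daisy_cube_generated h X)"
    have "{i. i < h \<and> u ! i \<noteq> v ! i} = sym_diff (ones u) (ones v)" by (auto simp: ones_def)
    moreover have "adj (daisy_cube_generated h X) u v \<longleftrightarrow> adj (hypercube h) u v"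
      using uv by (auto simp: V adj_def daisy_cube_generated_def induced_subgraph_def S_def)
    ultimately show "adj (daisy_cube_generated h X) u v \<longleftrightarrow> adj (complex_graph ?D) (ones u) (ones v)"
      using uv by (simp add: hypercube_adj adj_complex_graph V) (auto simp: S_def)
  qed
  ultimately show thesis using that hX(3) graph_iso_trans by blast
qed

lemma card_toggle:
  assumes "finite S"
  shows "int (card (sym_diff S {i})) = int (card S) + (if i \<in> S then -1 else 1)"
proof (cases "i \<in> S")
  case True
  then have "sym_diff S {i} = S - {i}" by auto
  moreover have "card S > 0" using True assms card_gt_0_iff by blast
  ultimately show ?thesis using True by (simp add: card_Diff_singleton)
next
  case False
  then have "sym_diff S {i} = insert i S" by auto
  then show ?thesis using False assms by simp
qed

locale cube_coordinates = simplicial_complex D for D +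
  fixes H :: "'a sgraph" and f :: "'a \<Rightarrow> nat set"
  assumes bij: "bij_betw f (verts H) D"
    and adj_iff: "\<lbrakk>u \<in> verts H; v \<in> verts H\<rbrakk> \<Longrightarrow> adj H u v \<longleftrightarrow> card (sym_diff (f u) (f v)) = 1"
    and simple: "simple_graph H"
begin

lemma f_in: "u \<in> verts H \<Longrightarrow> f u \<in> D"
  using bij by (auto simp: bij_betw_def)

lemma f_eq: "u \<in> verts H \<Longrightarrow> v \<in> verts H \<Longrightarrow> f u = f v \<longleftrightarrow> u = v"
  using bij by (auto simp: bij_betw_def inj_on_def)

lemma f_surj: assumes "\<sigma> \<in> D" obtains u where "u \<in> verts H" "f u = \<sigma>"
  using assms bij by (auto simp: bij_betw_def)

lemma finite_f: "u \<in> verts H \<Longrightarrow> finite (f u)"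
  using f_in finite_simplex by blast

lemma walk_length:
  "walk H u xs v \<Longrightarrow> card (sym_diff (f u) (f v)) < length xs"
proof (induction xs arbitrary: u)
  case Nil then show ?case by (simp add: walk_def)
next
  case (Cons x xs)
  have "v \<in> set (x # xs)" using Cons.prems by (metis last_in_set list.discI walk_def)
  then have x: "x = u" "u \<in> verts H" "v \<in> verts H" using Cons.prems by (auto simp: walk_def)
  show ?case
  proof (cases xs)
    case Nil then show ?thesis using Cons.prems by (auto simp: walk_def)
  next
    case (Cons y ys)
    then have w: "walk H y xs v" "adj H u y" "y \<in> verts H"
      using Cons.prems by (auto simp: walk_def)
    have "sym_diff (f u) (f v) \<subseteq> sym_diff (f u) (f y) \<union> sym_diff (f y) (f v)" by blast
    then have "card (sym_diff (f u) (f v)) \<le> card (sym_diff (f u) (f y) \<union> sym_diff (f y) (f v))"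
      using finite_f x w(3) by (intro card_mono) auto
    also have "\<dots> \<le> card (sym_diff (f u) (f y)) + card (sym_diff (f y) (f v))"
      by (rule card_Un_le)
    also have "\<dots> < 1 + length xs" using Cons.IH[OF w(1)] w(2) adj_iff x w(3) by simp
    finally show ?thesis by simp
  qed
qed

lemma walk_exists:
  "u \<in> verts H \<Longrightarrow> v \<in> verts H \<Longrightarrow> card (sym_diff (f u) (f v)) = n \<Longrightarrow>
     \<exists>xs. walk H u xs v \<and> length xs = Suc n"
proof (induction n arbitrary: u)
  case 0
  then have "sym_diff (f u) (f v) = {}" using finite_f by simp
  then have "u = v" using 0 f_eq by blast
  then have "walk H u [u] v" using 0 by (simp add: walk_def)
  then show ?case by fastforce
next
  case (Suc n)
  have "\<exists>i \<in> sym_diff (f u) (f v). sym_diff (f u) {i} \<in> D"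
  proof (cases "f u \<subseteq> f v")
    case True
    have "sym_diff (f u) (f v) \<noteq> {}" using Suc.prems(3) by (metis card.empty nat.distinct(1))
    then obtain i where "i \<in> f v - f u" using True by blast
    moreover from this have "sym_diff (f u) {i} \<subseteq> f v" using True by blast
    ultimately show ?thesis using down f_in Suc.prems(2) by blast
  next
    case False
    then obtain i where "i \<in> f u - f v" by blast
    moreover from this have "sym_diff (f u) {i} \<subseteq> f u" by blast
    ultimately show ?thesis using down f_in Suc.prems(1) by blast
  qed
  then obtain i where i: "i \<in> sym_diff (f u) (f v)" "sym_diff (f u) {i} \<in> D" by blast
  obtain y where y: "y \<in> verts H" "f y = sym_diff (f u) {i}" using f_surj i(2) by metis
  have "sym_diff (f y) (f v) = sym_diff (f u) (f v) - {i}" using y i by blast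
  then have "card (sym_diff (f y) (f v)) = n" using i Suc.prems finite_f by simp
  then obtain xs where xs: "walk H y xs v" "length xs = Suc n" using Suc.IH y Suc.prems by blast
  have "sym_diff (f u) (f y) = {i}" using y by blast
  then have "adj H u y" using adj_iff Suc.prems(1) y(1) by simp
  then have "walk H u (u # xs) v"
    using xs Suc.prems(1) by (cases xs) (auto simp: walk_def)
  then show ?case using xs(2) by fastforce
qed

lemma dist_eq:
  assumes "u \<in> verts H" "v \<in> verts H"
  shows "graph_dist H u v = card (sym_diff (f u) (f v))"
  unfolding graph_dist_def
  by (rule Least_equality) (use walk_exists assms walk_length in fastforce)+

definition edge_class :: "nat \<Rightarrow> 'a set set" where
  "edge_class i = {{u, v} | u v. u \<in> verts H \<and> v \<in> verts H \<and> sym_diff (f u) (f v) = {i}}"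

lemma edge_class_iff:
  "{u, v} \<in> edge_class i \<longleftrightarrow> u \<in> verts H \<and> v \<in> verts H \<and> sym_diff (f u) (f v) = {i}"
  using sym_diff_comm[of "f u" "f v"] by (auto simp: edge_class_def doubleton_eq_iff)

lemma edge_in_class:
  assumes "{u, v} \<in> edges H" obtains i where "{u, v} \<in> edge_class i"
proof -
  have "adj H u v" using assms by (simp add: adj_def)
  then show thesis
    using simple_graph_adjD(2,3)[OF simple] adj_iff that by (metis card_1_singletonE edge_class_iff)
qed

lemma edge_class_edges: "{u, v} \<in> edge_class i \<Longrightarrow> {u, v} \<in> edges H"
  using adj_iff[of u v] by (simp add: edge_class_iff adj_def)

lemma edge_class_coords:
  assumes "e \<in> edge_class i" shows "i \<in> coords D"
proof -
  obtain u v where uv: "u \<in> verts H" "v \<in> verts H" "sym_diff (f u) (f v) = {i}"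
    using assms by (auto simp: edge_class_def)
  then have "i \<in> f u \<or> i \<in> f v" by blast
  then show ?thesis using f_in uv coordsI by metis
qed

lemma edge_class_nonempty:
  assumes "i \<in> coords D" obtains e where "e \<in> edge_class i"
proof -
  obtain u v where "u \<in> verts H" "f u = {}" "v \<in> verts H" "f v = {i}"
    using f_surj empty assms by (metis coords_def mem_Collect_eq)
  then show thesis using that[of "{u, v}"] by (simp add: edge_class_iff)
qed

lemma edge_class_disjoint: "{u, v} \<in> edge_class i \<Longrightarrow> {u, v} \<in> edge_class j \<Longrightarrow> i = j"
  by (simp add: edge_class_iff)

text \<open>The distance is the Hamming distance, and the four distances between the ends of two edges
  are \<open>card S\<close> with none, one or both of the directions toggled.\<close>

lemma dist_sums:
  assumes "{u1, u2} \<in> edge_class i" "{v1, v2} \<in> edge_class j"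
  shows "graph_dist H u1 v1 + graph_dist H u2 v2 = graph_dist H u1 v2 + graph_dist H u2 v1 \<longleftrightarrow> i \<noteq> j"
proof -
  have V: "u1 \<in> verts H" "u2 \<in> verts H" "v1 \<in> verts H" "v2 \<in> verts H"
    and u: "f u2 = sym_diff (f u1) {i}" and v: "f v2 = sym_diff (f v1) {j}"
    using assms by (auto simp: edge_class_iff)
  define S where "S = sym_diff (f u1) (f v1)"
  have fin: "finite S" using V finite_f by (simp add: S_def)
  have "sym_diff (f u1) (f v2) = sym_diff S {j}" "sym_diff (f u2) (f v1) = sym_diff S {i}"
    "sym_diff (f u2) (f v2) = sym_diff (sym_diff S {i}) {j}"
    unfolding u v S_def by auto
  then have d: "graph_dist H u1 v1 = card S" "graph_dist H u1 v2 = card (sym_diff S {j})"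
    "graph_dist H u2 v1 = card (sym_diff S {i})"
    "graph_dist H u2 v2 = card (sym_diff (sym_diff S {i}) {j})"
    using V by (simp_all add: dist_eq S_def)
  have "int (graph_dist H u1 v1 + graph_dist H u2 v2) = int (graph_dist H u1 v2 + graph_dist H u2 v1)
      \<longleftrightarrow> i \<noteq> j"
    unfolding d using card_toggle[OF fin, of i] card_toggle[OF fin, of j]
      card_toggle[of "sym_diff S {i}" j] fin by auto
  then show ?thesis by (simp only: of_nat_eq_iff)
qed

lemma Theta_iff:
  assumes "e \<in> edge_class i" "e' \<in> edge_class j"
  shows "(e, e') \<in> Theta H \<longleftrightarrow> i = j"
proof
  assume "(e, e') \<in> Theta H"
  then obtain x1 x2 y1 y2 where "e = {x1, x2}" "e' = {y1, y2}"
    "graph_dist H x1 y1 + graph_dist H x2 y2 \<noteq> graph_dist H x1 y2 + graph_dist H x2 y1"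
    by (auto simp: Theta_def)
  then show "i = j" using dist_sums assms by blast
next
  assume "i = j"
  obtain x1 x2 y1 y2 where e: "e = {x1, x2}" "e' = {y1, y2}"
    using assms by (auto simp: edge_class_def)
  then have "{x1, x2} \<in> edges H" "{y1, y2} \<in> edges H" using assms edge_class_edges by auto
  then show "(e, e') \<in> Theta H" using dist_sums assms \<open>i = j\<close> e unfolding Theta_def by blast
qed

lemma Theta_class:
  assumes "e \<in> edge_class i" shows "Theta H `` {e} = edge_class i"
proof
  show "Theta H `` {e} \<subseteq> edge_class i"
  proof
    fix e' assume e': "e' \<in> Theta H `` {e}"
    then obtain u v where "e' = {u, v}" "{u, v} \<in> edges H" by (auto simp: Theta_def)
    then obtain j where "e' \<in> edge_class j" using edge_in_class by metis
    then show "e' \<in> edge_class i" using Theta_iff assms e' by auto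
  qed
  show "edge_class i \<subseteq> Theta H `` {e}" using Theta_iff assms by auto
qed

lemma Theta_classes: "edges H // Theta H = edge_class ` coords D"
proof
  show "edges H // Theta H \<subseteq> edge_class ` coords D"
  proof
    fix E assume "E \<in> edges H // Theta H"
    then obtain e where e: "e \<in> edges H" "E = Theta H `` {e}" by (rule quotientE)
    then obtain u v where "e = {u, v}" using simple_graph_edgeE[OF simple] by metis
    then obtain i where "e \<in> edge_class i" using e edge_in_class by metis
    then show "E \<in> edge_class ` coords D" using e Theta_class edge_class_coords by blast
  qed
  show "edge_class ` coords D \<subseteq> edges H // Theta H"
  proof
    fix E assume "E \<in> edge_class ` coords D"
    then obtain i where i: "i \<in> coords D" "E = edge_class i" by blast
    then obtain e where e: "e \<in> edge_class i" using edge_class_nonempty by blast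
    then obtain u v where "e = {u, v}" by (auto simp: edge_class_def)
    then have "e \<in> edges H" using e edge_class_edges by blast
    then show "E \<in> edges H // Theta H" using i e Theta_class by (auto simp: quotient_def)
  qed
qed

lemma inj_edge_class: "inj_on edge_class (coords D)"
proof (rule inj_onI)
  fix i j assume ij: "i \<in> coords D" "j \<in> coords D" "edge_class i = edge_class j"
  then obtain e where "e \<in> edge_class i" using edge_class_nonempty by blast
  moreover from this obtain u v where "e = {u, v}" by (auto simp: edge_class_def)
  ultimately show "i = j" using ij edge_class_disjoint by metis
qed

text \<open>A family closed under subsets contains the fourth vertex of the square unless this is the union
  of the two ends of the path; so the middle vertex must be the smallest.\<close>

lemma open_path_iff:
  assumes "i \<noteq> j"
  shows "(\<exists>u v w. {u, v} \<in> edge_class i \<and> {v, w} \<in> edge_class j \<and> \<not> adj H u w \<and>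
      {x \<in> verts H. adj H u x \<and> adj H w x} = {v}) \<longleftrightarrow> tau_adj D i j" (is "?L \<longleftrightarrow> _")
proof
  assume ?L
  then obtain u v w where uvw: "{u, v} \<in> edge_class i" "{v, w} \<in> edge_class j"
    "{x \<in> verts H. adj H u x \<and> adj H w x} = {v}" by blast
  have V: "u \<in> verts H" "v \<in> verts H" "w \<in> verts H"
    and s: "sym_diff (f u) (f v) = {i}" "sym_diff (f v) (f w) = {j}"
    using uvw by (auto simp: edge_class_iff)
  have u: "f u = sym_diff (f v) {i}" and w: "f w = sym_diff (f v) {j}" using s by blast+
  let ?X = "sym_diff (sym_diff (f v) {i}) {j}"
  have nX: "?X \<notin> D"
  proof
    assume "?X \<in> D"
    then obtain x where x: "x \<in> verts H" "f x = ?X" by (rule f_surj)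
    have "sym_diff (f u) (f x) = {j}" "sym_diff (f w) (f x) = {i}"
      using u w x(2) assms by auto
    then have "adj H u x" "adj H w x" using adj_iff V x(1) by simp_all
    then have "x = v" using uvw(3) x(1) by blast
    then show False using x(2) assms by auto
  qed
  have "i \<notin> f v"
  proof
    assume "i \<in> f v"
    then have "?X \<subseteq> f w" using w assms by auto
    then show False using nX down f_in V by blast
  qed
  moreover have "j \<notin> f v"
  proof
    assume "j \<in> f v"
    then have "?X \<subseteq> f u" using u assms by auto
    then show False using nX down f_in V by blast
  qed
  ultimately have "f u = insert i (f v)" "f w = insert j (f v)" "?X = insert i (insert j (f v))"
    using u w assms by auto
  then show "tau_adj D i j" using nX f_in V assms unfolding tau_adj_def by metis
next
  assume "tau_adj D i j"
  then obtain \<rho> where \<rho>: "insert i \<rho> \<in> D" "insert j \<rho> \<in> D" "insert i (insert j \<rho>) \<notin> D"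
    by (auto simp: tau_adj_def)
  have n: "i \<notin> \<rho>" "j \<notin> \<rho>" using tau_adj_notin \<rho> by blast+
  have "\<rho> \<in> D" using down \<rho>(1) by blast
  then obtain u v w where V: "u \<in> verts H" "v \<in> verts H" "w \<in> verts H"
    and f: "f u = insert i \<rho>" "f v = \<rho>" "f w = insert j \<rho>" using f_surj \<rho> by metis
  have s: "sym_diff (f u) (f v) = {i}" "sym_diff (f w) (f v) = {j}" "sym_diff (f u) (f w) = {i, j}"
    using f n assms by auto
  have "{x \<in> verts H. adj H u x \<and> adj H w x} = {v}"
  proof
    show "{x \<in> verts H. adj H u x \<and> adj H w x} \<subseteq> {v}"
    proof
      fix x assume "x \<in> {x \<in> verts H. adj H u x \<and> adj H w x}"
      then have x: "x \<in> verts H" "card (sym_diff (f u) (f x)) = 1" "card (sym_diff (f w) (f x)) = 1"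
        using adj_iff V by auto
      obtain k l where kl: "sym_diff (f u) (f x) = {k}" "sym_diff (f w) (f x) = {l}"
        using x(2,3) by (auto simp: card_1_singleton_iff)
      have fx: "f x = sym_diff (insert i \<rho>) {k}" "f x = sym_diff (insert j \<rho>) {l}"
        using kl f by blast+
      have "k = i \<or> k = j"
      proof (rule ccontr)
        assume k: "\<not> ?thesis"
        then have "i \<in> f x" "j \<notin> f x" using fx(1) n assms by auto
        then show False using fx(2) n assms by auto
      qed
      moreover have "k \<noteq> j"
      proof
        assume "k = j"
        then have "f x = insert i (insert j \<rho>)" using fx(1) n assms by auto
        then show False using \<rho>(3) f_in x(1) by metis
      qed
      ultimately have "f x = f v" using fx(1) n f by auto
      then show "x \<in> {v}" using f_eq x(1) V by simp
    qed
    show "{v} \<subseteq> {x \<in> verts H. adj H u x \<and> adj H w x}" using s adj_iff V by simp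
  qed
  moreover have "\<not> adj H u w" using adj_iff V s assms by simp
  moreover have "{u, v} \<in> edge_class i" "{v, w} \<in> edge_class j"
    using s V sym_diff_comm[of "f w" "f v"] by (simp_all add: edge_class_iff)
  ultimately show ?L by blast
qed

lemma tau_graph_iso: "coord_graph D \<simeq>\<^sub>g tau_graph H"
  unfolding graph_iso_def
proof (intro exI[of _ edge_class] conjI ballI)
  show "bij_betw edge_class (verts (coord_graph D)) (verts (tau_graph H))"
    using inj_edge_class Theta_classes by (simp add: bij_betw_def coord_graph_def tau_graph_def)
  fix i j assume ij: "i \<in> verts (coord_graph D)" "j \<in> verts (coord_graph D)"
  let ?P = "\<lambda>E F. \<exists>u v w. {u, v} \<in> E \<and> {v, w} \<in> F \<and> \<not> adj H u w \<and>
          {x \<in> verts H. adj H u x \<and> adj H w x} = {v}"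
  have co: "i \<in> coords D" "j \<in> coords D" using ij by (auto simp: coord_graph_def)
  have Psym: "?P F E" if EF: "?P E F" for E F
  proof -
    obtain u v w where uvw: "{u, v} \<in> E" "{v, w} \<in> F" "\<not> adj H u w"
      "{x \<in> verts H. adj H u x \<and> adj H w x} = {v}" using EF by blast
    have "{x \<in> verts H. adj H w x \<and> adj H u x} = {v}" using uvw(4) by blast
    moreover have "{w, v} \<in> F" "{v, u} \<in> E" using uvw(1,2) by (simp_all add: insert_commute)
    moreover have "\<not> adj H w u" using uvw(3) adj_commute by metis
    ultimately show ?thesis by blast
  qed
  have "adj (tau_graph H) (edge_class i) (edge_class j) \<longleftrightarrow>
      edge_class i \<noteq> edge_class j \<and> ?P (edge_class i) (edge_class j)"
  proof -
    have "edge_class i \<in> edges H // Theta H" "edge_class j \<in> edges H // Theta H"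
      using co Theta_classes by auto
    then show ?thesis
      unfolding adj_def[of "tau_graph H"]
      unfolding tau_graph_def sgraph.simps doubleton_in_Collect
      using Psym[of "edge_class i" "edge_class j"] Psym[of "edge_class j" "edge_class i"] by argo
  qed
  also have "\<dots> \<longleftrightarrow> adj (coord_graph D) i j"
  proof (cases "i = j")
    case True then show ?thesis by (simp add: adj_coord_graph tau_adj_def)
  next
    case False
    then have "edge_class i \<noteq> edge_class j" using inj_edge_class co by (auto simp: inj_on_def)
    then show ?thesis using open_path_iff[OF False] co by (simp only: adj_coord_graph simp_thms)
  qed
  finally show "adj (coord_graph D) i j \<longleftrightarrow> adj (tau_graph H) (edge_class i) (edge_class j)" by simp
qed

end

section \<open>Perfect matchings\<close>

definition matching_edge :: "'a set set \<Rightarrow> 'a \<Rightarrow> 'a set" where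
  "matching_edge M v = (THE e. e \<in> M \<and> v \<in> e)"

lemma matching_edge:
  assumes "perfect_matching G M" "v \<in> verts G"
  shows "matching_edge M v \<in> M" "v \<in> matching_edge M v"
proof -
  have "\<exists>!e. e \<in> M \<and> v \<in> e" using assms by (simp add: perfect_matching_def)
  then have "matching_edge M v \<in> M \<and> v \<in> matching_edge M v"
    unfolding matching_edge_def by (rule theI')
  then show "matching_edge M v \<in> M" "v \<in> matching_edge M v" by auto
qed

lemma matching_unique:
  assumes "perfect_matching G M" "v \<in> verts G" "e \<in> M" "v \<in> e" "e' \<in> M" "v \<in> e'"
  shows "e = e'"
  using assms by (auto simp: perfect_matching_def)

lemma matching_edge_eq:
  "perfect_matching G M \<Longrightarrow> v \<in> verts G \<Longrightarrow> e \<in> M \<Longrightarrow> v \<in> e \<Longrightarrow> matching_edge M v = e"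
  using matching_edge matching_unique by metis

lemma perfect_matching_subset: "perfect_matching G M \<Longrightarrow> M \<subseteq> edges G"
  by (simp add: perfect_matching_def)

lemma perfect_matchingI:
  assumes "M \<subseteq> edges G" "\<And>v. v \<in> verts G \<Longrightarrow> \<exists>N. perfect_matching G N \<and> {e \<in> M. v \<in> e} = {e \<in> N. v \<in> e}"
  shows "perfect_matching G M"
  unfolding perfect_matching_def
proof (intro conjI ballI)
  fix v assume v: "v \<in> verts G"
  obtain N where N: "perfect_matching G N" "{e \<in> M. v \<in> e} = {e \<in> N. v \<in> e}" using assms(2) v by blast
  have "e \<in> M \<and> v \<in> e \<longleftrightarrow> e \<in> N \<and> v \<in> e" for e using N(2) by blast
  then show "\<exists>!e. e \<in> M \<and> v \<in> e" using N(1) v by (simp add: perfect_matching_def)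
qed (rule assms(1))

lemma perfect_matching_eqI:
  assumes "simple_graph G" "perfect_matching G M" "perfect_matching G N" "M \<subseteq> N"
  shows "M = N"
proof
  show "N \<subseteq> M"
  proof
    fix e assume e: "e \<in> N"
    then have "e \<in> edges G" using assms(3) perfect_matching_subset by blast
    then obtain u v where uv: "e = {u, v}" "u \<in> verts G" by (metis simple_graph_edgeE assms(1))
    have "matching_edge M u \<in> N" "u \<in> matching_edge M u"
      using matching_edge[OF assms(2) uv(2)] assms(4) by auto
    then have "matching_edge M u = e" using matching_unique[OF assms(3) uv(2)] e uv(1) by blast
    then show "e \<in> M" using matching_edge[OF assms(2) uv(2)] by simp
  qed
qed (rule assms(4))

text \<open>At each vertex at most one of the flips changes anything.\<close>

lemma flip_disjoint:
  assumes G: "simple_graph G" and M: "perfect_matching G M"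
    and flip: "\<And>C. C \<in> \<C> \<Longrightarrow> C \<subseteq> edges G \<and> perfect_matching G (sym_diff M C)"
    and disj: "\<And>C C'. C \<in> \<C> \<Longrightarrow> C' \<in> \<C> \<Longrightarrow> C \<noteq> C' \<Longrightarrow> \<Union>C \<inter> \<Union>C' = {}"
  shows "perfect_matching G (sym_diff M (\<Union>\<C>))"
proof (rule perfect_matchingI)
  show "sym_diff M (\<Union>\<C>) \<subseteq> edges G" using perfect_matching_subset[OF M] flip by blast
  fix v assume "v \<in> verts G"
  show "\<exists>N. perfect_matching G N \<and> {e \<in> sym_diff M (\<Union>\<C>). v \<in> e} = {e \<in> N. v \<in> e}"
  proof (cases "\<exists>C\<in>\<C>. v \<in> \<Union>C")
    case True
    then obtain C where C: "C \<in> \<C>" "v \<in> \<Union>C" by blast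
    have "e \<in> \<Union>\<C> \<longleftrightarrow> e \<in> C" if "v \<in> e" for e using disj[OF C(1)] C that by blast
    then have "{e \<in> sym_diff M (\<Union>\<C>). v \<in> e} = {e \<in> sym_diff M C. v \<in> e}" by blast
    then show ?thesis using flip C by blast
  next
    case False
    then have "{e \<in> sym_diff M (\<Union>\<C>). v \<in> e} = {e \<in> M. v \<in> e}" by blast
    then show ?thesis using M by blast
  qed
qed

text \<open>At a vertex of \<open>C\<close>, the two matchings must use different edges, and both of these lie in \<open>C\<close>.\<close>

lemma alternating:
  assumes "perfect_matching G M" "perfect_matching G (sym_diff M C)" "v \<in> verts G" "v \<in> \<Union>C"
  shows "matching_edge M v \<in> C" "matching_edge (sym_diff M C) v \<in> C"
    "matching_edge (sym_diff M C) v \<notin> M"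
    "{e \<in> C. v \<in> e} = {matching_edge M v, matching_edge (sym_diff M C) v}"
proof -
  let ?a = "matching_edge M v" and ?b = "matching_edge (sym_diff M C) v"
  obtain e where e: "e \<in> C" "v \<in> e" using assms(4) by blast
  have a: "?a \<in> M" "v \<in> ?a" and b: "?b \<in> sym_diff M C" "v \<in> ?b"
    using matching_edge[OF assms(1,3)] matching_edge[OF assms(2,3)] by auto
  have uM: "f = ?a" if "f \<in> M" "v \<in> f" for f
    using matching_unique[OF assms(1,3) that a] .
  have uN: "f = ?b" if "f \<in> sym_diff M C" "v \<in> f" for f
    using matching_unique[OF assms(2,3) that b] .
  show aC: "?a \<in> C"
  proof (rule ccontr)
    assume n: "?a \<notin> C"
    then have "?a = ?b" using uN a by blast
    moreover have "e \<notin> M" using uM e n by blast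
    then have "e = ?b" using uN e by blast
    ultimately show False using e n by simp
  qed
  show bM: "?b \<notin> M"
  proof
    assume "?b \<in> M"
    then have "?b = ?a" using uM b(2) by simp
    then show False using b(1) a(1) aC by simp
  qed
  show bC: "?b \<in> C" using b(1) bM by blast
  show "{e \<in> C. v \<in> e} = {?a, ?b}" 
  proof
    show "{e \<in> C. v \<in> e} \<subseteq> {?a, ?b}"
    proof
      fix f assume f: "f \<in> {e \<in> C. v \<in> e}"
      show "f \<in> {?a, ?b}"
      proof (cases "f \<in> M")
        case True then show ?thesis using uM f by simp
      next
        case False
        then have "f \<in> sym_diff M C" using f by simp
        then show ?thesis using uN f by simp
      qed
    qed
    show "{?a, ?b} \<subseteq> {e \<in> C. v \<in> e}" using aC bC a(2) b(2) by simp
  qed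
qed

definition mate :: "'a set set \<Rightarrow> 'a \<Rightarrow> 'a" where
  "mate M v = (THE w. matching_edge M v = {v, w})"

lemma mate:
  assumes "simple_graph G" "perfect_matching G M" "v \<in> verts G"
  shows "matching_edge M v = {v, mate M v}" "mate M v \<noteq> v" "mate M v \<in> verts G"
    "mate M (mate M v) = v"
proof -
  have *: "matching_edge M w = {w, mate M w} \<and> mate M w \<noteq> w \<and> mate M w \<in> verts G"
    if w: "w \<in> verts G" for w
  proof -
    note m = matching_edge[OF assms(2) w]
    have "matching_edge M w \<in> edges G" using m(1) assms(2) perfect_matching_subset by blast
    then obtain a b where ab: "matching_edge M w = {a, b}" "a \<noteq> b" "a \<in> verts G" "b \<in> verts G"
      by (metis simple_graph_edgeE assms(1))
    then obtain z where z: "matching_edge M w = {w, z}" "z \<noteq> w" "z \<in> verts G"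
      using m(2) by fastforce
    then have "mate M w = z" unfolding mate_def by (intro the_equality) (auto simp: doubleton_eq_iff)
    then show ?thesis using z by simp
  qed
  show v: "matching_edge M v = {v, mate M v}" "mate M v \<noteq> v" "mate M v \<in> verts G"
    using *[OF assms(3)] by auto
  have "matching_edge M (mate M v) = matching_edge M v"
    using matching_edge_eq[OF assms(2) v(3)] matching_edge[OF assms(2,3)] v(1) by blast
  then have "{mate M v, mate M (mate M v)} = {v, mate M v}" using *[OF v(3)] v(1) by simp
  then show "mate M (mate M v) = v" using v(2) by (auto simp: doubleton_eq_iff)
qed

text \<open>A matching edge has one end in each colour class, so a set of vertices that is a union of
  matching edges is balanced.\<close>

lemma balanced:
  fixes A :: "'a set"
  assumes G: "simple_graph G" and M: "perfect_matching G M" and Y: "Y \<subseteq> verts G"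
    and closed: "\<And>y. y \<in> Y \<Longrightarrow> mate M y \<in> Y"
    and col: "\<And>u v. {u, v} \<in> edges G \<Longrightarrow> (u \<in> A) \<noteq> (v \<in> A)"
  shows "(\<Sum>y\<in>Y. if y \<in> A then 1 else -1 :: int) = 0"
proof -
  let ?s = "\<lambda>y. if y \<in> A then 1 else -1 :: int"
  have "(\<Sum>y\<in>Y. ?s y) = (\<Sum>y\<in>Y. - ?s y)"
  proof (rule sum.reindex_bij_witness[of Y "mate M" "mate M"])
    fix y assume y: "y \<in> Y"
    note m = mate[OF G M subsetD[OF Y y]]
    show "mate M (mate M y) = y" "mate M y \<in> Y" using m closed[OF y] by auto
    have "{y, mate M y} \<in> edges G"
      using m(1) matching_edge(1)[OF M subsetD[OF Y y]] perfect_matching_subset[OF M] by auto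
    then show "- ?s (mate M y) = ?s y" using col by auto
  qed (use closed mate(4)[OF G M] Y in auto)
  then show ?thesis by (simp add: sum_negf)
qed

section \<open>Even edge sets are cuts\<close>

lemma path_crossings:
  "distinct xs \<Longrightarrow> xs \<noteq> [] \<Longrightarrow>
     odd (card {e \<in> path_edges xs. crosses X e}) \<longleftrightarrow> (hd xs \<in> X) \<noteq> (last xs \<in> X)"
proof (induction xs rule: path_edges.induct)
  case (1 x y zs)
  let ?P = "{e \<in> path_edges (y # zs). crosses X e}"
  have fin: "finite ?P" by (simp add: path_edges_conv_nth)
  have notin: "{x, y} \<notin> ?P" using path_edges_subset[of "{x, y}" "y # zs"] 1(2) by auto
  have IH: "odd (card ?P) \<longleftrightarrow> (y \<in> X) \<noteq> (last (y # zs) \<in> X)" using 1 by simp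
  show ?case
  proof (cases "crosses X {x, y}")
    case True
    then have "{e \<in> path_edges (x # y # zs). crosses X e} = insert {x, y} ?P" by auto
    then have "card {e \<in> path_edges (x # y # zs). crosses X e} = Suc (card ?P)"
      using card_insert_disjoint[OF fin notin] by simp
    then show ?thesis using IH True by (auto simp: crosses_pair)
  next
    case False
    then have "{e \<in> path_edges (x # y # zs). crosses X e} = ?P" by auto
    then show ?thesis using IH False by (auto simp: crosses_pair)
  qed
qed auto

lemma reachable_distinct_path:
  assumes "(u, v) \<in> {(a, b). {a, b} \<in> E}\<^sup>*"
  shows "\<exists>zs. zs \<noteq> [] \<and> hd zs = u \<and> last zs = v \<and> distinct zs \<and> successively (\<lambda>a b. {a, b} \<in> E) zs"
  using assms
proof (induction rule: converse_rtrancl_induct)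
  case base
  show ?case by (rule exI[of _ "[v]"]) simp
next
  case (step x y)
  then obtain zs where zs: "zs \<noteq> []" "hd zs = y" "last zs = v" "distinct zs"
    "successively (\<lambda>a b. {a, b} \<in> E) zs" by blast
  show ?case
  proof (cases "x \<in> set zs")
    case True
    then obtain us ws where w: "zs = us @ x # ws" by (meson split_list)
    then show ?thesis using zs by (intro exI[of _ "x # ws"]) (auto simp: successively_append_iff)
  next
    case False
    then show ?thesis using zs step(1) by (intro exI[of _ "x # zs"]) (cases zs; simp)
  qed
qed

text \<open>Add the edges one at a time. A new edge either respects the cut found so far, or it joins two
  components, one of which can be switched to the other side, or it closes a cycle. In the last case
  the path in that cycle crosses the cut as often as it should, so parity makes the new edge right.\<close>

lemma even_set_is_cut:
  assumes "finite E" "\<And>e. e \<in> E \<Longrightarrow> e \<subseteq> V \<and> card e = 2"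
    and "\<And>xs. is_cycle \<lparr>verts = V, edges = E\<rparr> xs \<Longrightarrow> even (card (E0 \<inter> cycle_edges xs))"
  shows "\<exists>X. \<forall>e\<in>E. e \<in> E0 \<longleftrightarrow> crosses X e"
  using assms
proof (induction E)
  case empty
  then show ?case by simp
next
  case (insert e E)
  have "is_cycle \<lparr>verts = V, edges = insert e E\<rparr> xs" if "is_cycle \<lparr>verts = V, edges = E\<rparr> xs" for xs
    using that by (auto simp: is_cycle_def adj_def intro: successively_mono)
  then obtain X where X: "\<forall>e\<in>E. e \<in> E0 \<longleftrightarrow> crosses X e"
    using insert.IH insert.prems by (metis insertCI)
  obtain u v where uv: "e = {u, v}" "u \<noteq> v" "u \<in> V" "v \<in> V"
    using insert.prems(1)[of e] by (auto simp: card_2_iff)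
  show ?case
  proof (cases "e \<in> E0 \<longleftrightarrow> crosses X e")
    case True
    then show ?thesis using X by blast
  next
    case bad: False
    let ?R = "{(a, b). {a, b} \<in> E}"
    define K where "K = {w. (u, w) \<in> ?R\<^sup>*}"
    show ?thesis
    proof (cases "v \<in> K")
      case False
      have "u \<in> K" by (simp add: K_def)
      have "crosses (sym_diff X K) f \<longleftrightarrow> crosses X f" if f: "f \<in> E" for f
      proof -
        obtain a b where ab: "f = {a, b}" using insert.prems(1)[of f] f by (auto simp: card_2_iff)
        have "(a, b) \<in> ?R" "(b, a) \<in> ?R" using f ab by (auto simp: insert_commute)
        then have "a \<in> K \<longleftrightarrow> b \<in> K" unfolding K_def by (auto intro: rtrancl_into_rtrancl)
        then show ?thesis using ab by (auto simp: crosses_pair)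
      qed
      moreover have "crosses (sym_diff X K) e \<longleftrightarrow> \<not> crosses X e"
        using \<open>u \<in> K\<close> False uv by (auto simp: crosses_pair)
      ultimately show ?thesis using X bad by (intro exI[of _ "sym_diff X K"]) blast
    next
      case True
      then obtain zs where zs: "zs \<noteq> []" "hd zs = u" "last zs = v" "distinct zs"
        "successively (\<lambda>a b. {a, b} \<in> E) zs"
        using reachable_distinct_path[of u v E] by (auto simp: K_def)
      have pe: "path_edges zs \<subseteq> E"
        using path_edges_successively[of "\<lparr>verts = V, edges = E\<rparr>" zs] zs(5) by (simp add: adj_def[abs_def])
      have "length zs \<noteq> 1" using zs uv(2) by (cases zs) auto
      moreover have "length zs \<noteq> 2"
      proof
        assume "length zs = 2"
        then have "zs = [u, v]" using zs by (cases zs; cases "tl zs") auto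
        then show False using zs(5) uv(1) insert.hyps(2) by simp
      qed
      moreover have "length zs \<noteq> 0" using zs(1) by simp
      ultimately have "3 \<le> length zs" by linarith
      moreover have "set zs \<subseteq> V"
      proof
        fix z assume z: "z \<in> set zs"
        show "z \<in> V"
        proof (cases "z = u \<or> z = v")
          case False
          have "(u, z) \<in> ?R\<^sup>* \<Longrightarrow> z \<noteq> u \<Longrightarrow> z \<in> V"
            by (erule rtranclE) (use insert.prems(1) in auto)
          moreover have "z' \<in> V" if "z' \<in> set ws" "path_edges ws \<subseteq> E" "length ws \<ge> 2" for z' ws
          proof -
            have "z' \<in> \<Union>(path_edges ws)" using that(1,3)
            proof (induction ws rule: path_edges.induct)
              case (1 x y ws) then show ?case by (cases ws) auto
            qed auto
            then show ?thesis using that(2) insert.prems(1) by blast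
          qed
          ultimately show ?thesis using z pe \<open>3 \<le> length zs\<close> by auto
        qed (use uv in auto)
      qed
      ultimately have cyc: "is_cycle \<lparr>verts = V, edges = insert e E\<rparr> zs"
        using zs uv(1) by (auto simp: is_cycle_def adj_def insert_commute intro: successively_mono)
      have ce: "cycle_edges zs = insert e (path_edges zs)"
        using zs uv(1) by (simp add: cycle_edges_conv insert_commute)
      have "E0 \<inter> path_edges zs = {f \<in> path_edges zs. crosses X f}" using X pe by auto
      then have "odd (card (E0 \<inter> path_edges zs)) \<longleftrightarrow> crosses X e"
        using path_crossings[OF zs(4,1), of X] zs(2,3) uv(1) by (simp add: crosses_pair)
      moreover have "e \<notin> path_edges zs" "finite (path_edges zs)"
        using pe insert.hyps finite_subset by auto
      ultimately have "odd (card (E0 \<inter> cycle_edges zs))"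
        using bad unfolding ce by (cases "e \<in> E0") (auto simp: Int_insert_right)
      then show ?thesis using insert.prems(2) cyc by blast
    qed
  qed
qed

lemma cyclic_changes_even:
  fixes s :: "nat \<Rightarrow> bool"
  assumes "0 < k"
  shows "even (card {j. j < k \<and> s j \<noteq> s (Suc j mod k)})"
proof -
  have changes: "odd (card {j. j < n \<and> t j \<noteq> t (Suc j)}) \<longleftrightarrow> t 0 \<noteq> t n" for t :: "nat \<Rightarrow> bool" and n
  proof (induction n)
    case (Suc n)
    have "{j. j < Suc n \<and> t j \<noteq> t (Suc j)} =
        {j. j < n \<and> t j \<noteq> t (Suc j)} \<union> (if t n \<noteq> t (Suc n) then {n} else {})"
      by (auto simp: less_Suc_eq)
    then show ?case using Suc by auto
  qed auto
  define t where "t j = s (j mod k)" for j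
  have "{j. j < k \<and> s j \<noteq> s (Suc j mod k)} = {j. j < k \<and> t j \<noteq> t (Suc j)}"
    by (auto simp: t_def)
  then show ?thesis using changes[of k t] assms by (simp add: t_def)
qed

section \<open>Daisy cubes among resonance graphs\<close>

context plane begin

definition face_cycle :: "complex set set \<Rightarrow> bool" where
  "face_cycle C \<longleftrightarrow> (\<exists>xs. is_cycle G xs \<and> C = cycle_edges xs) \<and>
     (\<exists>F\<in>finite_faces G \<gamma>. periphery G \<gamma> F = C)"

lemma adj_resonance:
  "adj (resonance_graph G \<gamma>) M N \<longleftrightarrow>
     perfect_matching G M \<and> perfect_matching G N \<and> face_cycle (sym_diff M N)"
proof -
  let ?Q = "\<lambda>M N. perfect_matching G M \<and> perfect_matching G N \<and>
       (\<exists>xs. is_cycle G xs \<and> sym_diff M N = cycle_edges xs \<and>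
          (\<exists>F\<in>finite_faces G \<gamma>. periphery G \<gamma> F = cycle_edges xs))"
  have Q: "?Q M N \<longleftrightarrow> perfect_matching G M \<and> perfect_matching G N \<and> face_cycle (sym_diff M N)" for M N
    unfolding face_cycle_def by metis
  have "adj (resonance_graph G \<gamma>) M N \<longleftrightarrow> ?Q M N \<or> ?Q N M"
    unfolding adj_def resonance_graph_def sgraph.simps doubleton_in_Collect ..
  then have "adj (resonance_graph G \<gamma>) M N \<longleftrightarrow>
      (perfect_matching G M \<and> perfect_matching G N \<and> face_cycle (sym_diff M N)) \<or>
      (perfect_matching G N \<and> perfect_matching G M \<and> face_cycle (sym_diff N M))"
    by (simp only: Q)
  moreover have "face_cycle (sym_diff N M) \<longleftrightarrow> face_cycle (sym_diff M N)"
    by (simp only: sym_diff_comm[of N M])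
  ultimately show ?thesis by blast
qed

lemma face_cycle_subset: "face_cycle C \<Longrightarrow> C \<subseteq> edges G"
  using cycle_edges_subset by (auto simp: face_cycle_def)

lemma face_cycle_nonempty: "face_cycle C \<Longrightarrow> C \<noteq> {}"
  using cycle_edges_nonempty by (auto simp: face_cycle_def)

lemma face_cycles_independent:
  assumes "finite \<C>" "\<And>C. C \<in> \<C> \<Longrightarrow> face_cycle C"
    and ev: "\<And>e. e \<in> edges G \<Longrightarrow> even (card {C \<in> \<C>. e \<in> C})"
  shows "\<C> = {}"
proof -
  define F where "F C = (SOME F. F \<in> finite_faces G \<gamma> \<and> periphery G \<gamma> F = C)" for C
  have F: "F C \<in> finite_faces G \<gamma>" "periphery G \<gamma> (F C) = C" if "C \<in> \<C>" for C
  proof -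
    have "\<exists>F. F \<in> finite_faces G \<gamma> \<and> periphery G \<gamma> F = C"
      using assms(2)[OF that] by (auto simp: face_cycle_def)
    then have "F C \<in> finite_faces G \<gamma> \<and> periphery G \<gamma> (F C) = C" unfolding F_def by (rule someI_ex)
    then show "F C \<in> finite_faces G \<gamma>" "periphery G \<gamma> (F C) = C" by auto
  qed
  have inj: "inj_on F \<C>" by (metis F(2) inj_onI)
  have "F ` \<C> = {}"
  proof (rule peripheries_independent)
    show "F ` \<C> \<subseteq> finite_faces G \<gamma>" using F by blast
    show "\<exists>xs. is_cycle G xs \<and> periphery G \<gamma> F' = cycle_edges xs" if "F' \<in> F ` \<C>" for F'
      using that assms(2) F(2) by (auto simp: face_cycle_def)
    show "even (card {F' \<in> F ` \<C>. e \<in> periphery G \<gamma> F'})" if "e \<in> edges G" for e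
    proof -
      have "{F' \<in> F ` \<C>. e \<in> periphery G \<gamma> F'} = F ` {C \<in> \<C>. e \<in> C}" using F(2) by auto
      then show ?thesis using ev[OF that] card_image[OF inj_on_subset[OF inj]]
        by (metis (no_types, lifting) mem_Collect_eq subsetI)
    qed
  qed (use assms in simp)
  then show ?thesis by simp
qed

text \<open>This says that opposite edges of a square in the resonance graph rotate the same face; otherwise
  four different peripheries would cancel.\<close>

lemma square_labels:
  assumes fc: "face_cycle A" "face_cycle B" "face_cycle A'" "face_cycle B'"
    and eq: "sym_diff A B = sym_diff A' B'" and ne: "A \<noteq> B" "A \<noteq> B'"
  shows "A = A'"
proof (rule ccontr)
  assume AA': "A \<noteq> A'"
  have mem: "((e \<in> A) \<noteq> (e \<in> B)) \<longleftrightarrow> ((e \<in> A') \<noteq> (e \<in> B'))" for e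
    using eq by blast
  have "B \<noteq> B'"
  proof
    assume "B = B'"
    then have "e \<in> A \<longleftrightarrow> e \<in> A'" for e using mem[of e] by blast
    then show False using AA' by blast
  qed
  moreover have "A' \<noteq> B"
  proof
    assume "A' = B"
    then have "e \<in> A \<longleftrightarrow> e \<in> B'" for e using mem[of e] by blast
    then show False using ne(2) by blast
  qed
  moreover have "A' \<noteq> B'"
  proof
    assume "A' = B'"
    then have "e \<in> A \<longleftrightarrow> e \<in> B" for e using mem[of e] by blast
    then show False using ne(1) by blast
  qed
  moreover have "card {C \<in> {A, B, A', B'}. e \<in> C} = (\<Sum>C\<in>{A, B, A', B'}. if e \<in> C then 1 else 0)" for e
    by (simp add: sum.If_cases Int_def)
  ultimately have "even (card {C \<in> {A, B, A', B'}. e \<in> C})" for e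
    using AA' ne mem[of e] by auto
  then show False
    using face_cycles_independent[of "{A, B, A', B'}"] fc by blast
qed

end

locale resonant_daisy = plane G \<gamma> + simplicial_complex D for G \<gamma> D +
  fixes M :: "nat set \<Rightarrow> complex set set"
  assumes bip: "bipartite G"
    and M_bij: "bij_betw M D {N. perfect_matching G N}"
    and M_adj: "\<lbrakk>\<sigma> \<in> D; \<rho> \<in> D\<rbrakk> \<Longrightarrow> card (sym_diff \<sigma> \<rho>) = 1 \<longleftrightarrow> face_cycle (sym_diff (M \<sigma>) (M \<rho>))"
begin

lemma pm: "\<sigma> \<in> D \<Longrightarrow> perfect_matching G (M \<sigma>)"
  using M_bij by (auto simp: bij_betw_def)

lemma M_eq: "\<sigma> \<in> D \<Longrightarrow> \<rho> \<in> D \<Longrightarrow> M \<sigma> = M \<rho> \<longleftrightarrow> \<sigma> = \<rho>"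
  using M_bij by (auto simp: bij_betw_def inj_on_def)

lemma M_surj: assumes "perfect_matching G N" obtains \<sigma> where "\<sigma> \<in> D" "M \<sigma> = N"
proof -
  have "N \<in> M ` D" using M_bij assms by (simp add: bij_betw_def)
  then show thesis using that by blast
qed

lemma face_insert:
  assumes "insert i \<sigma> \<in> D" "i \<notin> \<sigma>"
  shows "face_cycle (sym_diff (M \<sigma>) (M (insert i \<sigma>)))"
proof -
  have "\<sigma> \<in> D" using assms(1) down by blast
  moreover have "sym_diff \<sigma> (insert i \<sigma>) = {i}" using assms(2) by blast
  ultimately show ?thesis using M_adj[of \<sigma> "insert i \<sigma>"] assms(1) by simp
qed

definition C :: "nat \<Rightarrow> complex set set" where
  "C i = sym_diff (M {}) (M {i})"

text \<open>Squares connect every edge of the cube in direction \<open>i\<close> with the one at the empty set.\<close>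

lemma label:
  assumes "insert i \<sigma> \<in> D" "i \<notin> \<sigma>"
  shows "sym_diff (M \<sigma>) (M (insert i \<sigma>)) = C i"
proof -
  have "\<sigma> \<in> D" using assms(1) down by blast
  then have "finite \<sigma>" by (rule finite_simplex)
  then show ?thesis using assms
  proof (induction \<sigma>)
    case empty then show ?case by (simp add: C_def)
  next
    case (insert j \<sigma>)
    let ?s = \<sigma> and ?si = "insert i \<sigma>" and ?sj = "insert j \<sigma>" and ?sij = "insert i (insert j \<sigma>)"
    have ij: "i \<noteq> j" "i \<notin> \<sigma>" using insert.prems(2) by auto
    have D: "?s \<in> D" "?si \<in> D" "?sj \<in> D" "?sij \<in> D" "insert j ?si \<in> D"
      using insert.prems(1) by (auto intro: down simp: insert_commute)
    have swap: "insert j ?si = ?sij" by (simp add: insert_commute)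
    let ?A = "sym_diff (M ?s) (M ?si)" and ?B = "sym_diff (M ?si) (M ?sij)"
    let ?A' = "sym_diff (M ?sj) (M ?sij)" and ?B' = "sym_diff (M ?s) (M ?sj)"
    have "?A = ?A'"
    proof (rule square_labels[of ?A ?B ?A' ?B'])
      show "face_cycle ?A" using face_insert D ij by blast
      show "face_cycle ?B" using face_insert[of j ?si] D ij insert.hyps swap by auto
      show "face_cycle ?A'" using face_insert[of i ?sj] D ij by auto
      show "face_cycle ?B'" using face_insert[of j ?s] D insert.hyps by blast
      show "sym_diff ?A ?B = sym_diff ?A' ?B'" by blast
      have "M ?s \<noteq> M ?sij" using M_eq[of ?s ?sij] D ij by auto
      then show "?A \<noteq> ?B" by blast
      have "M ?si \<noteq> M ?sj" using M_eq[of ?si ?sj] D ij by auto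
      then show "?A \<noteq> ?B'" by blast
    qed
    moreover have "?A = C i" using insert.IH D ij by blast
    ultimately show ?case by simp
  qed
qed

lemma M_insert:
  assumes "insert i \<sigma> \<in> D" "i \<notin> \<sigma>" shows "M (insert i \<sigma>) = sym_diff (M \<sigma>) (C i)"
  using label[OF assms] by blast

lemma face_C: "i \<in> coords D \<Longrightarrow> face_cycle (C i)"
  using face_insert[of i "{}"] by (simp add: C_def coords_def)

lemma pm_i: "i \<in> coords D \<Longrightarrow> perfect_matching G (M {i})"
  and pm_0: "perfect_matching G (M {})"
  using pm empty by (auto simp: coords_def)

lemma M_i: "i \<in> coords D \<Longrightarrow> M {i} = sym_diff (M {}) (C i)"
  using M_insert[of i "{}"] by (simp add: coords_def)

lemma C_verts: "i \<in> coords D \<Longrightarrow> v \<in> \<Union>(C i) \<Longrightarrow> v \<in> verts G"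
  using face_cycle_subset[OF face_C] simple by (fastforce simp: simple_graph_def)

lemma alt:
  assumes "i \<in> coords D" "v \<in> \<Union>(C i)"
  shows "matching_edge (M {}) v \<in> C i" "matching_edge (M {i}) v \<in> C i"
    "matching_edge (M {i}) v \<notin> M {}"
    "{e \<in> C i. v \<in> e} = {matching_edge (M {}) v, matching_edge (M {i}) v}"
  using alternating[OF pm_0, of "C i" v] pm_i[OF assms(1)] M_i[OF assms(1)] C_verts[OF assms] assms(2)
  by auto

lemma mem_M:
  assumes "\<sigma> \<in> D" shows "e \<in> M \<sigma> \<longleftrightarrow> (e \<in> M {}) \<noteq> odd (card {i \<in> \<sigma>. e \<in> C i})"
proof -
  have "finite \<sigma>" using finite_simplex assms .
  then show ?thesis using assms
  proof (induction \<sigma>)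
    case (insert i \<sigma>)
    have D: "\<sigma> \<in> D" using insert.prems down by blast
    have M: "M (insert i \<sigma>) = sym_diff (M \<sigma>) (C i)" using M_insert insert by blast
    have fin: "finite {j \<in> \<sigma>. e \<in> C j}" using insert.hyps by simp
    have "{j \<in> insert i \<sigma>. e \<in> C j} = (if e \<in> C i then insert i {j \<in> \<sigma>. e \<in> C j} else {j \<in> \<sigma>. e \<in> C j})"
      by auto
    then have "odd (card {j \<in> insert i \<sigma>. e \<in> C j}) \<longleftrightarrow> (e \<in> C i) \<noteq> odd (card {j \<in> \<sigma>. e \<in> C j})"
      using insert.hyps(2) fin by simp
    moreover have "e \<in> M (insert i \<sigma>) \<longleftrightarrow> (e \<in> M \<sigma>) \<noteq> (e \<in> C i)" unfolding M by blast
    ultimately show ?case using insert.IH[OF D] by argo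
  qed simp
qed

lemma C_inj: "i \<in> coords D \<Longrightarrow> j \<in> coords D \<Longrightarrow> C i = C j \<Longrightarrow> i = j"
  using M_i M_eq[of "{i}" "{j}"] by (auto simp: coords_def)

text \<open>If two faces can be rotated independently but share a vertex, then alternation carries every
  edge of one of the two cycles over to the other.\<close>

lemma independent_faces_disjoint:
  assumes D: "{i, j} \<in> D" and ij: "i \<noteq> j"
  shows "\<Union>(C i) \<inter> \<Union>(C j) = {}"
proof -
  have sub: "\<Union>(C i) \<subseteq> \<Union>(C j) \<and> C i \<subseteq> C j"
    if D: "{i, j} \<in> D" and ij: "i \<noteq> j" and ne: "\<Union>(C i) \<inter> \<Union>(C j) \<noteq> {}" for i j
  proof -
    have co: "i \<in> coords D" "j \<in> coords D" using coordsI[OF D] by auto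
    have pmj: "perfect_matching G (M {i, j})" using pm D by blast
    have Mij: "M {i, j} = sym_diff (M {i}) (C j)"
      using M_insert[of j "{i}"] D ij by (simp add: insert_commute)
    let ?Y = "\<Union>(C i) \<inter> \<Union>(C j)"
    have both: "e \<in> C j" if e: "e \<in> C i" "v \<in> e" and v: "v \<in> ?Y" for e v
    proof -
      have vi: "v \<in> \<Union>(C i)" and vj: "v \<in> \<Union>(C j)" using v by auto
      have "perfect_matching G (sym_diff (M {i}) (C j))" using pmj Mij by simp
      then have "matching_edge (M {i}) v \<in> C j"
        using alternating(1)[OF pm_i[OF co(1)]] C_verts[OF co(2) vj] vj by blast
      moreover have "matching_edge (M {}) v \<in> C j" using alt(1)[OF co(2) vj] .
      moreover have "e \<in> {matching_edge (M {}) v, matching_edge (M {i}) v}"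
        using alt(4)[OF co(1) vi] e by blast
      ultimately show ?thesis by blast
    qed
    obtain xs where xs: "is_cycle G xs" "C i = cycle_edges xs"
      using face_C[OF co(1)] by (auto simp: face_cycle_def)
    have "\<not> crosses ?Y e" if "e \<in> cycle_edges xs" for e
    proof
      assume "crosses ?Y e"
      then obtain v where "v \<in> e" "v \<in> ?Y" and "\<not> e \<subseteq> ?Y" by (auto simp: crosses_def)
      then show False using both[of e v] that xs(2) by blast
    qed
    then have "set xs \<subseteq> ?Y \<or> set xs \<inter> ?Y = {}" using cycle_connected[OF xs(1)] by blast
    then have sub: "\<Union>(C i) \<subseteq> ?Y" using Union_cycle_edges[OF xs(1)] ne xs(2) by auto
    have "C i \<subseteq> C j"
    proof
      fix e assume e: "e \<in> C i"
      then have "e \<in> edges G" using face_cycle_subset face_C co by blast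
      then obtain u v where "e = {u, v}" using simple_graph_edgeE[OF simple] by metis
      then show "e \<in> C j" using both[of e u] e sub by blast
    qed
    then show ?thesis using sub by blast
  qed
  show ?thesis
  proof (rule ccontr)
    assume ne: "\<Union>(C i) \<inter> \<Union>(C j) \<noteq> {}"
    have "C i = C j"
    proof
      show "C i \<subseteq> C j" using sub[OF D ij ne] by blast
      show "C j \<subseteq> C i" using sub[of j i] D ij ne by (simp add: insert_commute Int_commute)
    qed
    then show False using C_inj coordsI[OF D] ij by blast
  qed
qed

lemma common_neighbour:
  assumes "i \<noteq> j" "i \<notin> \<rho>" "j \<notin> \<rho>"
    and "card (sym_diff \<kappa> (insert i \<rho>)) = 1" "card (sym_diff \<kappa> (insert j \<rho>)) = 1"
  shows "\<kappa> = \<rho> \<or> \<kappa> = insert i (insert j \<rho>)"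
proof -
  obtain k l where kl: "sym_diff \<kappa> (insert i \<rho>) = {k}" "sym_diff \<kappa> (insert j \<rho>) = {l}"
    using assms(4,5) by (auto simp: card_1_singleton_iff)
  have fx: "\<kappa> = sym_diff (insert i \<rho>) {k}" "\<kappa> = sym_diff (insert j \<rho>) {l}"
    using kl by blast+
  have "k = i \<or> k = j"
  proof (rule ccontr)
    assume k: "\<not> ?thesis"
    then have "i \<in> \<kappa>" "j \<notin> \<kappa>" using fx(1) assms by auto
    then show False using fx(2) assms by auto
  qed
  then show ?thesis using fx(1) assms by auto
qed

text \<open>If the two cycles were vertex-disjoint, both faces could be rotated starting from \<open>M \<rho>\<close>, and the
  resulting matching would complete the path through \<open>\<rho>\<close> to a square.\<close>

lemma tau_adj_share:
  assumes t: "tau_adj D i j" and co: "i \<in> coords D" "j \<in> coords D"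
  shows "\<exists>e\<in>M {}. e \<in> C i \<and> e \<in> C j"
proof -
  obtain \<rho> where ij: "i \<noteq> j" and \<rho>: "insert i \<rho> \<in> D" "insert j \<rho> \<in> D" "insert i (insert j \<rho>) \<notin> D"
    using t by (auto simp: tau_adj_def)
  have n: "i \<notin> \<rho>" "j \<notin> \<rho>" using tau_adj_notin \<rho> by blast+
  have \<rho>D: "\<rho> \<in> D" using down \<rho>(1) by blast
  have "\<Union>(C i) \<inter> \<Union>(C j) \<noteq> {}"
  proof
    assume disj: "\<Union>(C i) \<inter> \<Union>(C j) = {}"
    have ne: "{} \<notin> C i" "{} \<notin> C j"
      using face_cycle_subset[OF face_C] co simple_graph_card_edge[OF simple, of "{}"] by auto
    have dC: "C i \<inter> C j = {}"
    proof (rule ccontr)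
      assume "C i \<inter> C j \<noteq> {}"
      then obtain e where "e \<in> C i" "e \<in> C j" by blast
      moreover from this have "e \<noteq> {}" using ne by blast
      ultimately show False using disj by blast
    qed
    let ?P = "sym_diff (M \<rho>) (\<Union>{C i, C j})"
    have "perfect_matching G ?P"
    proof (rule flip_disjoint[OF simple pm[OF \<rho>D]])
      fix B assume "B \<in> {C i, C j}"
      then show "B \<subseteq> edges G \<and> perfect_matching G (sym_diff (M \<rho>) B)"
        using face_cycle_subset[OF face_C] co M_insert[OF \<rho>(1) n(1)] M_insert[OF \<rho>(2) n(2)]
          pm[OF \<rho>(1)] pm[OF \<rho>(2)] by auto
    next
      fix B B' assume "B \<in> {C i, C j}" "B' \<in> {C i, C j}" "B \<noteq> B'"
      then show "\<Union>B \<inter> \<Union>B' = {}" using disj by (auto simp: Int_commute)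
    qed
    then obtain \<kappa> where \<kappa>: "\<kappa> \<in> D" "M \<kappa> = ?P" by (rule M_surj)
    have "sym_diff ?P (M (insert i \<rho>)) = C j" "sym_diff ?P (M (insert j \<rho>)) = C i"
      unfolding M_insert[OF \<rho>(1) n(1)] M_insert[OF \<rho>(2) n(2)] using dC by auto
    then have "card (sym_diff \<kappa> (insert i \<rho>)) = 1" "card (sym_diff \<kappa> (insert j \<rho>)) = 1"
      using M_adj[OF \<kappa>(1) \<rho>(1)] M_adj[OF \<kappa>(1) \<rho>(2)] \<kappa>(2) face_C co by auto
    then have "\<kappa> = \<rho>" using common_neighbour[OF ij n] \<rho>(3) \<kappa>(1) by blast
    then have "C i = {}" using \<kappa>(2) by auto
    then show False using face_cycle_nonempty face_C co by blast
  qed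
  then obtain v where v: "v \<in> \<Union>(C i)" "v \<in> \<Union>(C j)" by blast
  then show ?thesis
    using alt(1)[OF co(1) v(1)] alt(1)[OF co(2) v(2)] matching_edge(1)[OF pm_0 C_verts[OF co(1) v(1)]]
    by blast
qed

lemma not_tau_adj_disjoint:
  assumes "\<not> tau_adj D i j" "i \<noteq> j" "i \<in> coords D" "j \<in> coords D"
  shows "\<Union>(C i) \<inter> \<Union>(C j) = {}"
proof -
  have "insert i {} \<in> D" "insert j {} \<in> D" using assms(3,4) by (auto simp: coords_def)
  then have "insert i (insert j {}) \<in> D" using assms(1,2) unfolding tau_adj_def by blast
  then show ?thesis using independent_faces_disjoint assms(2) by blast
qed

definition the_face :: "nat \<Rightarrow> complex set" where
  "the_face i = (SOME F. F \<in> finite_faces G \<gamma> \<and> periphery G \<gamma> F = C i)"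

lemma the_face:
  assumes "i \<in> coords D" shows "the_face i \<in> faces G \<gamma>" "periphery G \<gamma> (the_face i) = C i"
proof -
  have "\<exists>F. F \<in> finite_faces G \<gamma> \<and> periphery G \<gamma> F = C i"
    using face_C[OF assms] by (auto simp: face_cycle_def)
  then have "the_face i \<in> finite_faces G \<gamma> \<and> periphery G \<gamma> (the_face i) = C i"
    unfolding the_face_def by (rule someI_ex)
  then show "the_face i \<in> faces G \<gamma>" "periphery G \<gamma> (the_face i) = C i" by (auto simp: finite_faces_def)
qed

lemma the_face_inj: "i \<in> coords D \<Longrightarrow> j \<in> coords D \<Longrightarrow> the_face i = the_face j \<Longrightarrow> i = j"
  using the_face(2) C_inj by metis

lemma edge_in_two_cycles:
  assumes "i \<in> coords D" "j \<in> coords D" "l \<in> coords D" "e \<in> C i" "e \<in> C j" "e \<in> C l"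
  shows "i = j \<or> i = l \<or> j = l"
proof -
  obtain xs where "is_cycle G xs" "C i = cycle_edges xs"
    using face_C[OF assms(1)] by (auto simp: face_cycle_def)
  then have "the_face i = the_face j \<or> the_face i = the_face l \<or> the_face j = the_face l"
    using three_faces[OF the_face(1)[OF assms(1)] the_face(1)[OF assms(2)] the_face(1)[OF assms(3)]]
      assms the_face(2) by metis
  then show ?thesis using the_face_inj assms(1-3) by blast
qed

lemma colour_classes:
  obtains A where "\<And>u v. {u, v} \<in> edges G \<Longrightarrow> (u \<in> A) \<noteq> (v \<in> A)"
proof -
  obtain A B where AB: "A \<inter> B = {}" "\<And>e. e \<in> edges G \<Longrightarrow> \<exists>a\<in>A. \<exists>b\<in>B. e = {a, b}"
    using bip by (auto simp: bipartite_def)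
  have "(u \<in> A) \<noteq> (v \<in> A)" if e: "{u, v} \<in> edges G" for u v
  proof -
    obtain a b where "a \<in> A" "b \<in> B" "{u, v} = {a, b}" using AB(2)[OF e] by blast
    then show ?thesis using AB(1) unfolding doubleton_eq_iff by blast
  qed
  then show thesis using that by blast
qed

end

text \<open>The situation to be refuted: a chordless cycle in the coordinate graph, where \<open>e j\<close> is an edge of
  \<open>M {}\<close> shared by the faces \<open>i j\<close> and \<open>i (j + 1)\<close>, the indices taken modulo \<open>k\<close>.\<close>

locale tau_cycle = resonant_daisy +
  fixes k :: nat and i :: "nat \<Rightarrow> nat" and e :: "nat \<Rightarrow> complex set"
  assumes k3: "3 \<le> k" and co: "j < k \<Longrightarrow> i j \<in> coords D" and inj: "inj_on i {..<k}"
    and e: "j < k \<Longrightarrow> e j \<in> M {} \<and> e j \<in> C (i j) \<and> e j \<in> C (i (Suc j mod k))"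
    and chordless: "a < b \<Longrightarrow> b < k \<Longrightarrow> tau_adj D (i a) (i b) \<Longrightarrow> b = Suc a \<or> a = 0 \<and> Suc b = k"
begin

abbreviation nx :: "nat \<Rightarrow> nat" where
  "nx j \<equiv> Suc j mod k"

lemma nx: "nx j < k" "j < k \<Longrightarrow> nx j \<noteq> j" "j < k \<Longrightarrow> nx (nx j) \<noteq> j"
  "a < k \<Longrightarrow> b < k \<Longrightarrow> nx a = nx b \<Longrightarrow> a = b"
proof -
  have *: "nx j = (if Suc j = k then 0 else Suc j)" if "j < k" for j using that by auto
  show "nx j < k" using k3 by simp
  show "j < k \<Longrightarrow> nx j \<noteq> j" using *[of j] k3 by (auto split: if_splits)
  show "j < k \<Longrightarrow> nx (nx j) \<noteq> j"
    using *[of j] *[of "nx j"] k3 by (auto split: if_splits)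
  show "a < k \<Longrightarrow> b < k \<Longrightarrow> nx a = nx b \<Longrightarrow> a = b"
    using *[of a] *[of b] by (auto split: if_splits)
qed

lemma nx_same_pair:
  assumes "a < k" "b < k" "b = a \<or> b = nx a" "nx b = a \<or> nx b = nx a"
  shows "a = b"
proof (rule ccontr)
  assume "a \<noteq> b"
  then have b: "b = nx a" using assms(3) by blast
  have "nx b \<noteq> nx a"
  proof
    assume "nx b = nx a"
    from nx(4)[OF assms(2,1) this] show False using \<open>a \<noteq> b\<close> by blast
  qed
  then have "nx b = a" using assms(4) by blast
  then show False using nx(3)[OF assms(1)] unfolding b by blast
qed

lemma i_eq: "a < k \<Longrightarrow> b < k \<Longrightarrow> i a = i b \<longleftrightarrow> a = b"
  using inj by (auto simp: inj_on_def)

lemma i_nx: "j < k \<Longrightarrow> i j \<noteq> i (nx j)"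
  using i_eq[OF _ nx(1)] nx(2) by metis

lemma e_cycles:
  assumes "j < k" "l \<in> coords D" "e j \<in> C l" shows "l = i j \<or> l = i (nx j)"
proof -
  have "i j \<noteq> i (nx j)" using i_nx assms(1) .
  then show ?thesis
    using edge_in_two_cycles[OF co[OF assms(1)] co[OF nx(1)] assms(2), of "e j" j] e[OF assms(1)] assms(3)
    by blast
qed

lemma e_cycle_index: "j < k \<Longrightarrow> a < k \<Longrightarrow> e j \<in> C (i a) \<Longrightarrow> a = j \<or> a = nx j"
  using e_cycles[of j "i a"] co i_eq nx(1) by metis

lemma e_inj:
  assumes "a < k" "b < k" "e a = e b" shows "a = b"
proof -
  have 1: "e a \<in> C (i b)" and 2: "e a \<in> C (i (nx b))" using e[OF assms(2)] assms(3) by simp_all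
  show ?thesis
    by (rule nx_same_pair[OF assms(1,2) e_cycle_index[OF assms(1,2) 1] e_cycle_index[OF assms(1) nx(1) 2]])
qed

text \<open>The edge \<open>e j\<close> lies on a cycle iff this cycle separates the faces \<open>i j\<close> and \<open>i (j + 1)\<close>, and on
  the way around the ring of faces the side changes an even number of times.\<close>

lemma e_meets_cycles_evenly:
  assumes "is_cycle G xs" shows "even (card (e ` {..<k} \<inter> cycle_edges xs))"
proof -
  define s where "s j \<longleftrightarrow> the_face (i j) \<subseteq> inside (curve \<gamma> (cycle_edges xs))" for j
  have s: "e j \<in> cycle_edges xs \<longleftrightarrow> s j \<noteq> s (nx j)" if j: "j < k" for j
  proof -
    have cj: "i j \<in> coords D" "i (nx j) \<in> coords D" using co[OF j] co[OF nx(1)] by simp_all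
    have "i j \<noteq> i (nx j)" using i_nx j .
    then have "the_face (i j) \<noteq> the_face (i (nx j))" using the_face_inj cj by blast
    then show ?thesis
      unfolding s_def using edge_changes_side[OF the_face(1) the_face(1) _ _ _ assms] the_face(2) cj e[OF j]
      by metis
  qed
  have "e ` {..<k} \<inter> cycle_edges xs = e ` {j. j < k \<and> s j \<noteq> s (nx j)}" using s by auto
  moreover have "inj_on e {j. j < k \<and> s j \<noteq> s (nx j)}" using e_inj by (auto simp: inj_on_def)
  ultimately show ?thesis using cyclic_changes_even[of k s] k3 by (simp add: card_image)
qed

lemma cut_exists:
  obtains X where "\<And>f. f \<in> edges G \<Longrightarrow> f \<in> e ` {..<k} \<longleftrightarrow> crosses X f"
proof -
  have "\<exists>X. \<forall>f\<in>edges G. f \<in> e ` {..<k} \<longleftrightarrow> crosses X f"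
  proof (rule even_set_is_cut[OF finite_edges[OF simple]])
    show "f \<subseteq> verts G \<and> card f = 2" if "f \<in> edges G" for f
      using that simple by (simp add: simple_graph_def)
    show "even (card (e ` {..<k} \<inter> cycle_edges xs))"
      if "is_cycle \<lparr>verts = verts G, edges = edges G\<rparr> xs" for xs
      using that by (intro e_meets_cycles_evenly) (simp add: is_cycle_def adj_def[abs_def])
  qed
  then show thesis using that by blast
qed

text \<open>Suppose that, inside \<open>X\<close>, rotating face \<open>j\<close> and rotating the next face match every vertex
  that they share in the same way. Starting from the shared edge \<open>e j\<close> and walking along
  cycle \<open>j\<close> inside \<open>X\<close>, one then stays on the next cycle as well, so the only edge through
  which that cycle leaves the shared part is \<open>e j\<close>. But a cycle crosses every vertex set evenly.\<close>

lemma cycles_separate_in_cut: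
  assumes X: "\<And>f. f \<in> edges G \<Longrightarrow> f \<in> e ` {..<k} \<longleftrightarrow> crosses X f" and j: "j < k"
    and agree: "\<And>y. y \<in> \<Union>(C (i j)) \<Longrightarrow> y \<in> \<Union>(C (i (nx j))) \<Longrightarrow> y \<in> X \<Longrightarrow>
      matching_edge (M {i j}) y = matching_edge (M {i (nx j)}) y"
  shows False
proof -
  let ?Y = "\<Union>(C (i j)) \<inter> \<Union>(C (i (nx j))) \<inter> X"
  have cj: "i j \<in> coords D" "i (nx j) \<in> coords D" using co[OF j] co[OF nx(1)] by simp_all
  have CG: "C (i j) \<subseteq> edges G" using face_cycle_subset face_C cj by blast
  obtain xs where xs: "is_cycle G xs" "C (i j) = cycle_edges xs"
    using face_C[OF cj(1)] by (auto simp: face_cycle_def)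
  have "{g \<in> C (i j). crosses ?Y g} = {e j}"
  proof
    show "{e j} \<subseteq> {g \<in> C (i j). crosses ?Y g}"
    proof -
      have eC: "e j \<in> C (i j)" "e j \<in> C (i (nx j))" using e[OF j] by auto
      then have "crosses X (e j)" using X j CG by auto
      then show ?thesis using eC by (auto simp: crosses_def)
    qed
    show "{g \<in> C (i j). crosses ?Y g} \<subseteq> {e j}"
    proof
      fix g assume "g \<in> {g \<in> C (i j). crosses ?Y g}"
      then have g: "g \<in> C (i j)" "crosses ?Y g" by auto
      then obtain y where y: "y \<in> g" "y \<in> ?Y" and n: "\<not> g \<subseteq> ?Y" by (auto simp: crosses_def)
      have yC: "y \<in> \<Union>(C (i j))" "y \<in> \<Union>(C (i (nx j)))" using y by auto
      have "g \<in> {matching_edge (M {}) y, matching_edge (M {i j}) y}"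
        using alt(4)[OF cj(1) yC(1)] g(1) y(1) by blast
      moreover have "matching_edge (M {i j}) y = matching_edge (M {i (nx j)}) y"
        using agree y(2) by blast
      ultimately have gC: "g \<in> C (i (nx j))"
        using alt(1)[OF cj(2) yC(2)] alt(2)[OF cj(2) yC(2)] by auto
      then have "\<not> g \<subseteq> X" using n g(1) by auto
      then have "crosses X g" using y by (auto simp: crosses_def)
      then have "g \<in> e ` {..<k}" using X[of g] g(1) CG by blast
      then obtain l where l: "l < k" "g = e l" by blast
      have 1: "e l \<in> C (i j)" and 2: "e l \<in> C (i (nx j))" using g(1) gC l(2) by simp_all
      have "l = j"
        by (rule nx_same_pair[OF l(1) j e_cycle_index[OF l(1) j 1] e_cycle_index[OF l(1) nx(1) 2]])
      then show "g \<in> {e j}" using l(2) by simp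
    qed
  qed
  then have "card {g \<in> cycle_edges xs. crosses ?Y g} = 1" using xs(2) by simp
  then show False using cycle_crosses_even[OF simple xs(1), of ?Y] by simp
qed

text \<open>The edges \<open>e j\<close> and \<open>e (nx j)\<close> are the only ones through which cycle \<open>nx j\<close> enters or
  leaves \<open>X\<close>. Its vertices in \<open>X\<close> are balanced, as the rotated matching shows, and after removing the
  ends of these two edges they are still balanced, as the unrotated matching shows.\<close>

lemma cut_ends_alternate:
  assumes X: "\<And>f. f \<in> edges G \<Longrightarrow> f \<in> e ` {..<k} \<longleftrightarrow> crosses X f" and j: "j < k"
    and A: "\<And>u v. {u, v} \<in> edges G \<Longrightarrow> (u \<in> A) \<noteq> (v \<in> A)"
    and x: "x \<in> e j" "x \<in> X" and x': "x' \<in> e (nx j)" "x' \<in> X"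
  shows "(x \<in> A) \<noteq> (x' \<in> A)"
proof -
  define l where "l = i (nx j)"
  have l: "l \<in> coords D" using co[OF nx(1)] by (simp add: l_def)
  have CG: "C l \<subseteq> edges G" using face_cycle_subset face_C l by blast
  have eC: "e j \<in> C l" "e (nx j) \<in> C l" using e[OF j] e[OF nx(1)] by (auto simp: l_def)
  have e0: "e j \<in> M {}" "e (nx j) \<in> M {}" using e[OF j] e[OF nx(1)] by auto
  have only: "f = e j \<or> f = e (nx j)" if f: "f \<in> C l" "crosses X f" for f
  proof -
    have "f \<in> e ` {..<k}" using X[of f] f CG by blast
    then obtain a where a: "a < k" "f = e a" by blast
    have "e a \<in> C (i (nx j))" using f(1) a(2) by (simp add: l_def)
    from e_cycle_index[OF a(1) nx(1) this] show ?thesis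
    proof
      assume "nx j = a" then show ?thesis using a(2) by simp
    next
      assume "nx j = nx a"
      then have "j = a" by (rule nx(4)[OF j a(1)])
      then show ?thesis using a(2) by simp
    qed
  qed
  let ?s = "\<lambda>y. if y \<in> A then 1 else -1 :: int"
  define Y where "Y = \<Union>(C l) \<inter> X"
  have Yv: "Y \<subseteq> verts G" using C_verts[OF l] by (auto simp: Y_def)
  have finY: "finite Y" using Yv finite_verts finite_subset by blast
  have end_in: "y = x" if "y \<in> e j" "y \<in> X" for y
  proof -
    have "crosses X (e j)" using X eC(1) CG j by auto
    moreover obtain u v where "e j = {u, v}" using eC(1) CG simple_graph_edgeE[OF simple] by (metis subsetD)
    ultimately show ?thesis using that x by (auto simp: crosses_pair)
  qed
  have end_in': "y = x'" if "y \<in> e (nx j)" "y \<in> X" for y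
  proof -
    have "crosses X (e (nx j))" using X eC(2) CG nx(1) by auto
    moreover obtain u v where "e (nx j) = {u, v}" using eC(2) CG simple_graph_edgeE[OF simple] by (metis subsetD)
    ultimately show ?thesis using that x' by (auto simp: crosses_pair)
  qed
  have xY: "x \<in> Y" "x' \<in> Y" using x x' eC by (auto simp: Y_def)
  have ne: "x \<noteq> x'"
  proof
    assume "x = x'"
    then have "e j = e (nx j)"
      using matching_unique[OF pm_0, of x] e0 x x' xY Yv by blast
    from e_inj[OF j nx(1) this] show False using nx(2)[OF j] by simp
  qed
  have "(\<Sum>y\<in>Y. ?s y) = 0"
  proof (rule balanced[OF simple pm_i[OF l] Yv _ A])
    fix y assume y: "y \<in> Y"
    then have yC: "y \<in> \<Union>(C l)" and yX: "y \<in> X" and yv: "y \<in> verts G" using Yv by (auto simp: Y_def)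
    let ?f = "matching_edge (M {l}) y"
    note m = mate[OF simple pm_i[OF l] yv]
    have f: "?f \<in> C l" "?f \<notin> M {}" using alt[OF l yC] by auto
    have "\<not> crosses X ?f"
    proof
      assume "crosses X ?f"
      from only[OF f(1) this] show False using f(2) e0 by metis
    qed
    then show "mate (M {l}) y \<in> Y"
      using f(1) m(1) yX by (auto simp: Y_def crosses_pair)
  qed
  moreover have "(\<Sum>y\<in>Y - {x, x'}. ?s y) = 0"
  proof (rule balanced[OF simple pm_0 _ _ A])
    show "Y - {x, x'} \<subseteq> verts G" using Yv by blast
    fix y assume y: "y \<in> Y - {x, x'}"
    then have yC: "y \<in> \<Union>(C l)" and yX: "y \<in> X" and yv: "y \<in> verts G" using Yv by (auto simp: Y_def)
    let ?f = "matching_edge (M {}) y"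
    note m = mate[OF simple pm_0 yv]
    have f: "?f \<in> C l" using alt[OF l yC] by auto
    have yf: "y \<in> ?f" "?f \<in> M {}" using matching_edge[OF pm_0 yv] by auto
    have "?f \<noteq> e j" "?f \<noteq> e (nx j)" using end_in[OF _ yX] end_in'[OF _ yX] y yf(1) by auto
    then have "\<not> crosses X ?f" using only[OF f] by metis
    then have mX: "mate (M {}) y \<in> Y" using f m(1) yX by (auto simp: Y_def crosses_pair)
    moreover have "mate (M {}) y \<noteq> x"
    proof
      assume "mate (M {}) y = x"
      then have "?f = e j"
        using matching_unique[OF pm_0, of x ?f "e j"] yf e0 m(1) x xY Yv by auto
      then show False using \<open>?f \<noteq> e j\<close> by blast
    qed
    moreover have "mate (M {}) y \<noteq> x'"
    proof
      assume "mate (M {}) y = x'"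
      then have "?f = e (nx j)"
        using matching_unique[OF pm_0, of x' ?f "e (nx j)"] yf e0 m(1) x' xY Yv by auto
      then show False using \<open>?f \<noteq> e (nx j)\<close> by blast
    qed
    ultimately show "mate (M {}) y \<in> Y - {x, x'}" by blast
  qed
  moreover have "(\<Sum>y\<in>Y. ?s y) = (\<Sum>y\<in>Y - {x, x'}. ?s y) + (\<Sum>y\<in>{x, x'}. ?s y)"
    by (rule sum.subset_diff) (use xY finY in auto)
  ultimately have "?s x + ?s x' = 0" using ne by simp
  then show ?thesis by (auto split: if_splits)
qed

text \<open>The faces of the cycle, taken alternately, can be rotated independently in two ways. Rotating
  one half outside the cut \<open>X\<close> and the other half inside \<open>X\<close> gives a perfect matching, which must be
  some \<open>M \<sigma>\<close>; but the edges \<open>e j\<close> force \<open>\<sigma>\<close> to contain one of the two halves entirely.\<close>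

theorem contradiction: False
proof -
  obtain X where X: "\<And>f. f \<in> edges G \<Longrightarrow> f \<in> e ` {..<k} \<longleftrightarrow> crosses X f"
    by (rule cut_exists) blast
  have Xc: "\<And>f. f \<in> edges G \<Longrightarrow> f \<in> e ` {..<k} \<longleftrightarrow> crosses (- X) f"
    using X by (auto simp: crosses_def)
  obtain A where A: "\<And>u v. {u, v} \<in> edges G \<Longrightarrow> (u \<in> A) \<noteq> (v \<in> A)"
    by (rule colour_classes) blast
  have eG: "e j \<in> edges G" if "j < k" for j using e[OF that] face_cycle_subset face_C co[OF that] by blast
  have "\<exists>x. x \<in> e j \<and> x \<in> X" if "j < k" for j
    using X[OF eG[OF that]] that by (auto simp: crosses_def)
  then obtain x where x: "\<And>j. j < k \<Longrightarrow> x j \<in> e j \<and> x j \<in> X" by metis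
  \<comment> \<open>The colour of the end of \<open>e j\<close> in \<open>X\<close> alternates along the ring; it serves as the colour of face \<open>i j\<close>.\<close>
  define c where "c j \<longleftrightarrow> x j \<in> A" for j
  have c: "c j \<noteq> c (nx j)" if "j < k" for j
    unfolding c_def using cut_ends_alternate[OF X that A] x[OF that] x[OF nx(1)] by blast
  define P where "P b = {i j | j. j < k \<and> c j = b}" for b
  have P_iff: "i j \<in> P b \<longleftrightarrow> c j = b" if "j < k" for j b
    using that i_eq by (auto simp: P_def)
  have Pco: "P b \<subseteq> coords D" for b using co by (auto simp: P_def)
  have disj: "\<Union>(C l) \<inter> \<Union>(C l') = {}" if l: "l \<in> P b" "l' \<in> P b" "l \<noteq> l'" for l l' b
  proof -
    obtain a a' where a: "l = i a" "l' = i a'" "a < k" "a' < k" "c a = c a'" using l by (auto simp: P_def)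
    have no: "\<not> tau_adj D (i p) (i q)" if pq: "p < q" "q < k" "c p = c q" for p q
    proof
      assume "tau_adj D (i p) (i q)"
      then consider "q = Suc p" | "p = 0" "Suc q = k" using chordless pq by blast
      then show False
      proof cases
        case 1 then show ?thesis using c[of p] pq by simp
      next
        case 2 then show ?thesis using c[of q] pq by simp
      qed
    qed
    have "\<not> tau_adj D l l'"
      using no[of a a'] no[of a' a] a l(3) tau_adj_sym[of D] by (metis linorder_neqE_nat)
    then show ?thesis using not_tau_adj_disjoint l Pco by blast
  qed
  define N where "N b = sym_diff (M {}) (\<Union>(C ` P b))" for b
  have N: "perfect_matching G (N b)" for b
    unfolding N_def
  proof (rule flip_disjoint[OF simple pm_0])
    fix B assume "B \<in> C ` P b"
    then obtain l where "l \<in> P b" "B = C l" by blast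
    then show "B \<subseteq> edges G \<and> perfect_matching G (sym_diff (M {}) B)"
      using face_cycle_subset face_C Pco M_i pm_i by (metis subsetD)
  next
    fix B B' assume "B \<in> C ` P b" "B' \<in> C ` P b" "B \<noteq> B'"
    then show "\<Union>B \<inter> \<Union>B' = {}" using disj by blast
  qed
  have eN: "e j \<notin> N b" if j: "j < k" for j b
  proof -
    have "i j \<in> P b \<or> i (nx j) \<in> P b" using P_iff[OF j] P_iff[OF nx(1)] c[OF j] by blast
    then show ?thesis using e[OF j] by (auto simp: N_def)
  qed
  have uncrossed: "\<not> crosses X f" if f: "f \<in> N b" for f b
  proof
    assume "crosses X f"
    moreover have "f \<in> edges G" using f N perfect_matching_subset by blast
    ultimately obtain j where "j < k" "f = e j" using X by auto
    then show False using eN f by blast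
  qed
  \<comment> \<open>No edge of \<open>N b\<close> crosses \<open>X\<close>, so the two matchings can be combined along the cut.\<close>
  define N' where "N' = {f \<in> N True. \<not> f \<subseteq> X} \<union> {f \<in> N False. f \<subseteq> X}"
  have at: "{f \<in> N'. v \<in> f} = {f \<in> N (v \<notin> X). v \<in> f}" for v
    using uncrossed unfolding N'_def crosses_def by (cases "v \<in> X") auto
  have N': "perfect_matching G N'"
  proof (rule perfect_matchingI)
    show "N' \<subseteq> edges G" using perfect_matching_subset[OF N] by (auto simp: N'_def)
  qed (use at N in blast)
  then obtain \<sigma> where \<sigma>: "\<sigma> \<in> D" "M \<sigma> = N'" by (rule M_surj)
  have \<sigma>co: "\<sigma> \<subseteq> coords D" using coordsI[OF \<sigma>(1)] by blast
  define s where "s j \<longleftrightarrow> i j \<in> \<sigma>" for j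
  \<comment> \<open>The edge \<open>e j\<close> has been rotated away, so exactly one of its two faces is in \<open>\<sigma>\<close>.\<close>
  have s: "s j \<noteq> s (nx j)" if j: "j < k" for j
  proof -
    have "e j \<notin> M \<sigma>" using eN[OF j] \<sigma>(2) by (auto simp: N'_def)
    then have "odd (card {l \<in> \<sigma>. e j \<in> C l})" using mem_M[OF \<sigma>(1)] e[OF j] by blast
    moreover have "{l \<in> \<sigma>. e j \<in> C l} = \<sigma> \<inter> {i j, i (nx j)}"
      using e_cycles[OF j] \<sigma>co e[OF j] by blast
    moreover have "i j \<noteq> i (nx j)" using i_nx j .
    ultimately have "odd (card (\<sigma> \<inter> {i j, i (nx j)}))" by simp
    then show ?thesis
      using \<open>i j \<noteq> i (nx j)\<close> unfolding s_def
      by (cases "i j \<in> \<sigma>"; cases "i (nx j) \<in> \<sigma>") (simp_all add: Int_insert_right)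
  qed
  have sc: "(s j \<longleftrightarrow> c j) \<longleftrightarrow> (s 0 \<longleftrightarrow> c 0)" if "j < k" for j
    using that
  proof (induction j)
    case (Suc j)
    then have "s j \<noteq> s (Suc j)" "c j \<noteq> c (Suc j)" using s[of j] c[of j] by simp_all
    then show ?case using Suc by auto
  qed simp
  define b where "b \<longleftrightarrow> (s 0 \<longleftrightarrow> c 0)"
  \<comment> \<open>The face \<open>i j\<close> is in \<open>\<sigma>\<close>, but on one side of the cut \<open>N'\<close> rotates its neighbour instead.\<close>
  obtain j where j: "j < k" "c j = b"
  proof -
    have "c 0 \<noteq> c (Suc 0)" "0 < k" "Suc 0 < k" using c[of 0] k3 by auto
    then show thesis using that[of 0] that[of "Suc 0"] by (cases "c 0 = b") auto
  qed
  have sj: "i j \<in> \<sigma>" using sc[OF j(1)] j(2) by (auto simp: b_def s_def)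
  have cj: "i j \<in> coords D" "i (nx j) \<in> coords D" using co[OF j(1)] co[OF nx(1)] by simp_all
  have cn: "i (nx j) \<in> P (\<not> b)" using P_iff[OF nx(1)] c[OF j(1)] j(2) by blast
  have agree: "matching_edge (M {i j}) y = matching_edge (M {i (nx j)}) y"
    if y: "y \<in> \<Union>(C (i j))" "y \<in> \<Union>(C (i (nx j)))" "y \<in> X \<longleftrightarrow> b" for y
  proof -
    have yv: "y \<in> verts G" using C_verts cj y by blast
    let ?f = "matching_edge (M {i j}) y" and ?g = "matching_edge (M {i (nx j)}) y"
    have f: "?f \<in> C (i j)" "?f \<notin> M {}" "y \<in> ?f"
      using alt[OF cj(1) y(1)] matching_edge(2)[OF pm_i[OF cj(1)] yv] by auto
    have g: "?g \<in> C (i (nx j))" "?g \<notin> M {}" "y \<in> ?g"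
      using alt[OF cj(2) y(2)] matching_edge(2)[OF pm_i[OF cj(2)] yv] by auto
    have "{l \<in> \<sigma>. ?f \<in> C l} = {i j}"
    proof -
      have "l = i j" if l: "l \<in> \<sigma>" "?f \<in> C l" for l
      proof (rule ccontr)
        assume "l \<noteq> i j"
        moreover have "{l, i j} \<in> D" using down[OF \<sigma>(1), of "{l, i j}"] l sj by simp
        ultimately show False using independent_faces_disjoint f l by blast
      qed
      then show ?thesis using sj f by blast
    qed
    then have "?f \<in> N'" using mem_M[OF \<sigma>(1), of ?f] f(2) \<sigma>(2) by simp
    moreover have "?g \<in> N (\<not> b)" using g cn by (auto simp: N_def)
    then have "?g \<in> N'" using at[of y] y(3) g(3) by blast
    ultimately show ?thesis using matching_unique[OF N' yv] f g by blast
  qed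
  show False
  proof (cases b)
    case True
    then show ?thesis using cycles_separate_in_cut[OF X j(1)] agree by blast
  next
    case False
    then show ?thesis using cycles_separate_in_cut[OF Xc j(1)] agree by blast
  qed
qed

end

text \<open>A shortest cycle has no chords.\<close>

lemma chordless_cycle:
  assumes "\<not> forest T"
  obtains xs where "is_cycle T xs"
    "\<And>a b. a < b \<Longrightarrow> b < length xs \<Longrightarrow> adj T (xs ! a) (xs ! b) \<Longrightarrow> b = Suc a \<or> a = 0 \<and> Suc b = length xs"
proof -
  let ?P = "\<lambda>n. \<exists>xs. is_cycle T xs \<and> length xs = n"
  have "\<exists>n. ?P n" using assms by (auto simp: forest_def)
  then have "?P (LEAST n. ?P n)" by (rule LeastI_ex)
  then obtain xs where xs: "is_cycle T xs" "length xs = (LEAST n. ?P n)" by blast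
  have "b = Suc a \<or> a = 0 \<and> Suc b = length xs"
    if ab: "a < b" "b < length xs" and chord: "adj T (xs ! a) (xs ! b)" for a b
  proof (rule ccontr)
    assume n: "\<not> ?thesis"
    define ys where "ys = drop a (take (Suc b) xs)"
    have len: "length ys = Suc b - a" using ab by (simp add: ys_def)
    have "xs = take a xs @ ys @ drop (Suc b) xs"
      unfolding ys_def using ab
      by (metis append_take_drop_id append.assoc drop_take le_add_diff_inverse less_imp_le_nat take_add less_SucI)
    then have "successively (adj T) ys" "distinct ys" "set ys \<subseteq> verts T"
      using xs(1) unfolding is_cycle_def
      by (metis successively_append_iff, metis distinct_append, metis le_sup_iff set_append)
    moreover have "last ys = xs ! b" "hd ys = xs ! a"
      using ab by (auto simp: ys_def last_drop take_Suc_conv_app_nth hd_drop_conv_nth nth_append)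
    ultimately have "is_cycle T ys"
      using len n ab chord adj_commute[of T] by (auto simp: is_cycle_def)
    moreover have "length ys < length xs" using len n ab by auto
    ultimately show False using not_less_Least[of "length ys" ?P] xs(2) by auto
  qed
  then show thesis using that xs(1) by blast
qed

context resonant_daisy begin

theorem coord_graph_forest: "forest (coord_graph D)"
proof (rule ccontr)
  assume "\<not> forest (coord_graph D)"
  then obtain xs where xs: "is_cycle (coord_graph D) xs"
    and ch: "\<And>a b. a < b \<Longrightarrow> b < length xs \<Longrightarrow> adj (coord_graph D) (xs ! a) (xs ! b) \<Longrightarrow>
      b = Suc a \<or> a = 0 \<and> Suc b = length xs"
    using chordless_cycle by blast
  let ?k = "length xs"
  have co: "xs ! j \<in> coords D" if "j < ?k" for j
    using xs that by (auto simp: is_cycle_def coord_graph_def)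
  have "adj (coord_graph D) (xs ! j) (xs ! (Suc j mod ?k))" if j: "j < ?k" for j
  proof -
    have "{xs ! j, xs ! (Suc j mod ?k)} \<in> edges (coord_graph D)"
      using cycle_edges_subset[OF xs] j by (auto simp: cycle_edges_def)
    then show ?thesis by (simp add: adj_def)
  qed
  then have "\<exists>e. e \<in> M {} \<and> e \<in> C (xs ! j) \<and> e \<in> C (xs ! (Suc j mod ?k))" if "j < ?k" for j
    using tau_adj_share that unfolding adj_coord_graph by blast
  then obtain e where "\<And>j. j < ?k \<Longrightarrow> e j \<in> M {} \<and> e j \<in> C (xs ! j) \<and> e j \<in> C (xs ! (Suc j mod ?k))"
    by metis
  then interpret tau_cycle G \<gamma> D M ?k "\<lambda>j. xs ! j" e
    using xs co ch adj_coord_graph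
    by unfold_locales (auto simp: is_cycle_def inj_on_def nth_eq_iff_index_eq)
  show False by (rule contradiction)
qed

text \<open>The allowed edges are those of \<open>M {}\<close> and of the cycles that can be rotated. A vertex set that
  is a union of cycles forming a component of the coordinate graph is not left by any of them.\<close>

theorem coord_graph_connected:
  assumes el: "elementary G" and nK2: "\<not> G \<simeq>\<^sub>g K2"
  shows "connected_graph (coord_graph D)"
proof -
  let ?A = "edge_induced_subgraph (allowed_edges G)"
  have conn: "connected_graph ?A" using el by (simp add: elementary_def)
  have allowed: "f \<in> M {} \<or> (\<exists>i\<in>coords D. f \<in> C i)" if f: "f \<in> allowed_edges G" for f
  proof -
    obtain N where "perfect_matching G N" "f \<in> N" using f by (auto simp: allowed_edges_def)
    then obtain \<sigma> where \<sigma>: "\<sigma> \<in> D" "f \<in> M \<sigma>" using M_surj by metis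
    show ?thesis
    proof (cases "f \<in> M {}")
      case False
      then have "{i \<in> \<sigma>. f \<in> C i} \<noteq> {}" using mem_M[OF \<sigma>(1), of f] \<sigma>(2) by (metis card.empty even_zero)
      then show ?thesis using coordsI[OF \<sigma>(1)] by blast
    qed simp
  qed
  have M_allowed: "M \<sigma> \<subseteq> allowed_edges G" if "\<sigma> \<in> D" for \<sigma>
    using pm[OF that] perfect_matching_subset by (auto simp: allowed_edges_def)
  have closed: "verts G \<subseteq> Y"
    if ne: "Y \<inter> verts G \<noteq> {}" and cl: "\<And>f. f \<in> allowed_edges G \<Longrightarrow> \<not> crosses Y f" for Y
  proof
    fix v assume v: "v \<in> verts G"
    obtain u where u: "u \<in> Y" "u \<in> verts G" using ne by blast
    have inA: "w \<in> verts ?A" if "w \<in> verts G" for w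
      using matching_edge[OF pm_0 that] M_allowed[OF empty] by (auto simp: edge_induced_subgraph_def)
    then obtain xs where xs: "walk ?A u xs v"
      using conn inA[OF u(2)] inA[OF v] unfolding connected_graph_def by blast
    have "set zs \<subseteq> Y" if "successively (adj ?A) zs" "zs \<noteq> []" "hd zs \<in> Y" for zs
      using that
    proof (induction zs rule: path_edges.induct)
      case (1 x y zs)
      then have "{x, y} \<in> allowed_edges G" by (simp add: adj_def edge_induced_subgraph_def)
      then have "y \<in> Y" using cl[of "{x, y}"] 1 by (auto simp: crosses_pair)
      then show ?case using 1 by simp
    qed auto
    then show "v \<in> Y" using xs u(1) last_in_set by (fastforce simp: walk_def)
  qed
  have "coords D \<noteq> {}"
  proof
    assume no: "coords D = {}"
    have "verts ?A \<noteq> {}" using conn by (simp add: connected_graph_def)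
    then obtain f where f: "f \<in> allowed_edges G" by (auto simp: edge_induced_subgraph_def)
    then have fM: "f \<in> M {}" using allowed no by blast
    have fG: "f \<in> edges G" using f by (simp add: allowed_edges_def)
    obtain u v where uv: "f = {u, v}" "u \<noteq> v" "u \<in> verts G" "v \<in> verts G"
      using simple_graph_edgeE[OF simple fG] .
    have "verts G \<subseteq> f"
    proof (rule closed)
      show "f \<inter> verts G \<noteq> {}" using uv by auto
      fix g assume "g \<in> allowed_edges G"
      then have gM: "g \<in> M {}" using allowed no by blast
      show "\<not> crosses f g"
      proof
        assume "crosses f g"
        then obtain w where "w \<in> f" "w \<in> g" "f \<noteq> g" by (auto simp: crosses_def)
        moreover have "w \<in> verts G" using \<open>w \<in> f\<close> uv by auto
        ultimately show False using matching_unique[OF pm_0] fM gM by blast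
      qed
    qed
    then have V: "verts G = {u, v}" using uv by auto
    have "edges G = {{u, v}}"
    proof
      show "edges G \<subseteq> {{u, v}}"
      proof
        fix g assume "g \<in> edges G"
        then obtain a b where "g = {a, b}" "a \<noteq> b" "a \<in> verts G" "b \<in> verts G"
          using simple_graph_edgeE[OF simple] by metis
        then show "g \<in> {{u, v}}" using V by auto
      qed
    qed (use fG uv in simp)
    then have "adj G p q \<longleftrightarrow> adj K2 (p = u) (q = u)" if "p \<in> verts G" "q \<in> verts G" for p q
      using that uv(2) unfolding V by (auto simp: adj_def K2_def doubleton_eq_iff)
    moreover have "bij_betw (\<lambda>p. p = u) (verts G) (verts K2)"
      unfolding V using uv(2) by (auto simp: bij_betw_def K2_def)
    ultimately show False using nK2 unfolding graph_iso_def by blast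
  qed
  then obtain i where i: "i \<in> coords D" by blast
  have reach: "(i, j) \<in> {(a, b). adj (coord_graph D) a b}\<^sup>*" if j: "j \<in> coords D" for j
  proof (rule ccontr)
    let ?R = "{(a, b). adj (coord_graph D) a b}"
    define S where "S = {l \<in> coords D. (i, l) \<in> ?R\<^sup>*}"
    assume nj: "(i, j) \<notin> ?R\<^sup>*"
    let ?Y = "\<Union>l\<in>S. \<Union>(C l)"
    have disj: "\<Union>(C l) \<inter> \<Union>(C m) = {}" if l: "l \<in> S" and m: "m \<in> coords D" "m \<notin> S" for l m
    proof -
      have "\<not> tau_adj D l m"
      proof
        assume "tau_adj D l m"
        then have "(l, m) \<in> ?R" using l m by (simp add: S_def adj_coord_graph)
        moreover have "(i, l) \<in> ?R\<^sup>*" using l by (simp add: S_def)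
        ultimately have "(i, m) \<in> ?R\<^sup>*" by (rule rtrancl_into_rtrancl[rotated])
        then show False using m by (simp add: S_def)
      qed
      then show ?thesis using not_tau_adj_disjoint[of l m] l m by (auto simp: S_def)
    qed
    have "verts G \<subseteq> ?Y"
    proof (rule closed)
      obtain f where f: "f \<in> C i" using face_cycle_nonempty face_C i by blast
      then have "f \<in> edges G" using face_cycle_subset face_C i by blast
      then obtain u v where uv: "f = {u, v}" "u \<in> verts G" using simple_graph_edgeE[OF simple] by metis
      have "i \<in> S" using i by (simp add: S_def)
      then show "?Y \<inter> verts G \<noteq> {}" using f uv by blast
    next
      fix f assume f: "f \<in> allowed_edges G"
      show "\<not> crosses ?Y f"
      proof
        assume "crosses ?Y f"
        then obtain w l where w: "w \<in> f" "l \<in> S" "w \<in> \<Union>(C l)" and n: "\<not> f \<subseteq> ?Y"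
          by (auto simp: crosses_def)
        have l: "l \<in> coords D" using w by (simp add: S_def)
        have wv: "w \<in> verts G" using C_verts l w by blast
        show False
        proof (cases "f \<in> M {}")
          case True
          then have "f = matching_edge (M {}) w" using matching_edge_eq[OF pm_0 wv] w by simp
          then have "f \<in> C l" using alt(1)[OF l w(3)] by simp
          then show False using n w(2) by blast
        next
          case False
          then obtain m where m: "m \<in> coords D" "f \<in> C m" using allowed f by blast
          then have "m \<in> S" using disj[OF w(2) m(1)] w by blast
          then show False using n m by blast
        qed
      qed
    qed
    moreover have "j \<notin> S" using nj by (simp add: S_def)
    moreover obtain f where f: "f \<in> C j" using face_cycle_nonempty face_C j by blast
    moreover from this have "f \<in> edges G" using face_cycle_subset face_C j by blast
    then obtain u v where uv: "f = {u, v}" "u \<in> verts G" using simple_graph_edgeE[OF simple] by metis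
    ultimately show False using disj j by blast
  qed
  have R: "{(a, b). adj (coord_graph D) a b} = {(a, b). {a, b} \<in> edges (coord_graph D)}"
    by (simp add: adj_def)
  have to_i: "(j, l) \<in> {(a, b). adj (coord_graph D) a b}\<^sup>*" if "j \<in> coords D" "l \<in> coords D" for j l
  proof -
    have "sym {(a, b). adj (coord_graph D) a b}"
      by (rule symI) (simp add: adj_commute[of "coord_graph D"])
    then have "(j, i) \<in> {(a, b). adj (coord_graph D) a b}\<^sup>*"
      by (rule symD[OF sym_rtrancl]) (rule reach[OF that(1)])
    then show ?thesis using reach[OF that(2)] by (rule rtrancl_trans)
  qed
  show ?thesis
    unfolding connected_graph_def
  proof (intro conjI ballI)
    show "verts (coord_graph D) \<noteq> {}" using i by (auto simp: coord_graph_def)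
    fix j l assume jl: "j \<in> verts (coord_graph D)" "l \<in> verts (coord_graph D)"
    then have c: "j \<in> coords D" "l \<in> coords D" by (auto simp: coord_graph_def)
    obtain zs where zs: "zs \<noteq> []" "hd zs = j" "last zs = l"
      "successively (\<lambda>a b. {a, b} \<in> edges (coord_graph D)) zs"
      using reachable_distinct_path[OF to_i[OF c, unfolded R]] by (elim exE conjE)
    have "set ws \<subseteq> coords D"
      if "successively (\<lambda>a b. {a, b} \<in> edges (coord_graph D)) ws" "ws \<noteq> []" "hd ws \<in> coords D" for ws
      using that
    proof (induction ws rule: path_edges.induct)
      case (1 x y ws)
      then have "adj (coord_graph D) x y" by (simp add: adj_def)
      then have "y \<in> coords D" by (simp add: adj_coord_graph)
      then show ?case using 1 by simp
    qed auto
    then have "set zs \<subseteq> coords D" using zs c(1) by blast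
    then show "\<exists>xs. walk (coord_graph D) j xs l"
      using zs by (intro exI[of _ zs]) (simp add: walk_def adj_def[abs_def] coord_graph_def)
  qed
qed

end

section \<open>Graphs from nested intervals\<close>

text \<open>Let \<open>N\<close> be a finite family of intervals with different end points, any two of which are disjoint
  or nested. The graph has the end points as its vertices. For each interval \<open>i\<close> that contains
  another one there is a face, whose vertices are the points visible from \<open>i\<close>, that is, not strictly
  inside a smaller interval within \<open>i\<close>; its cycle joins consecutive visible points and closes up with
  the chord from the left to the right end of \<open>i\<close>.\<close>

definition nested :: "('n \<Rightarrow> real) \<Rightarrow> ('n \<Rightarrow> real) \<Rightarrow> 'n \<Rightarrow> 'n \<Rightarrow> bool" where
  "nested l r n m \<longleftrightarrow> l m < l n \<and> r n < r m"

definition covers :: "'n set \<Rightarrow> ('n \<Rightarrow> real) \<Rightarrow> ('n \<Rightarrow> real) \<Rightarrow> 'n \<Rightarrow> 'n \<Rightarrow> bool" where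
  "covers N l r m n \<longleftrightarrow> nested l r n m \<and> \<not> (\<exists>k\<in>N. nested l r n k \<and> nested l r k m)"

definition consecutive :: "real set \<Rightarrow> real \<Rightarrow> real \<Rightarrow> bool" where
  "consecutive S s t \<longleftrightarrow> s \<in> S \<and> t \<in> S \<and> s < t \<and> (\<forall>p\<in>S. p \<le> s \<or> t \<le> p)"

abbreviation seg :: "real \<Rightarrow> real \<Rightarrow> complex set" where
  "seg s t \<equiv> {complex_of_real s, complex_of_real t}"

lemma seg_eq: "s < t \<Longrightarrow> s' < t' \<Longrightarrow> seg s t = seg s' t' \<longleftrightarrow> s = s' \<and> t = t'"
  by (auto simp: doubleton_eq_iff)

lemma consecutive_unique_right: "consecutive S s t \<Longrightarrow> consecutive S s t' \<Longrightarrow> t = t'"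
  unfolding consecutive_def by (meson linorder_not_less order_antisym)

lemma path_edges_sorted:
  "sorted_wrt (<) xs \<Longrightarrow>
     path_edges (map complex_of_real xs) = {seg s t | s t. consecutive (set xs) s t}"
proof (induction xs rule: path_edges.induct)
  case (1 x y zs)
  have so: "x < y" "\<forall>z\<in>set zs. y < z" "\<forall>z\<in>set zs. x < z" "sorted_wrt (<) (y # zs)" using 1(2) by auto
  have cons: "consecutive (set (x # y # zs)) s t \<longleftrightarrow> s = x \<and> t = y \<or> consecutive (set (y # zs)) s t" for s t
  proof
    assume c: "consecutive (set (x # y # zs)) s t"
    show "s = x \<and> t = y \<or> consecutive (set (y # zs)) s t"
    proof (cases "s = x")
      case True
      have "y \<le> x \<or> t \<le> y" "t \<in> set (x # y # zs)" "x < t"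
        using c True by (auto simp: consecutive_def)
      then have "t = y" using so by fastforce
      then show ?thesis using True by simp
    next
      case False
      then have "s \<in> set (y # zs)" using c by (auto simp: consecutive_def)
      then have "x < s" using so by auto
      then have "t \<noteq> x" using c by (auto simp: consecutive_def)
      then show ?thesis using c \<open>s \<in> set (y # zs)\<close> by (auto simp: consecutive_def)
    qed
  next
    assume "s = x \<and> t = y \<or> consecutive (set (y # zs)) s t"
    then show "consecutive (set (x # y # zs)) s t"
    proof
      assume "s = x \<and> t = y"
      then show ?thesis using so by (auto simp: consecutive_def less_imp_le)
    next
      assume c: "consecutive (set (y # zs)) s t"
      then have "s \<in> set (y # zs)" by (simp add: consecutive_def)
      then have "x < s" using so by auto
      then show ?thesis using c by (auto simp: consecutive_def)
    qed
  qed
  have "{seg s t | s t. consecutive (set (x # y # zs)) s t} =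
      insert (seg x y) {seg s t | s t. consecutive (set (y # zs)) s t}" unfolding cons by blast
  then show ?case using 1(1) so(4) by simp
qed (auto simp: consecutive_def)

lemma finite_sorted_predecessor:
  assumes "finite S" "a \<in> S" "b \<in> S" "a \<le> x" "x < (b::real)"
  obtains s t where "consecutive S s t" "s \<le> x" "x < t"
proof -
  let ?L = "{p \<in> S. p \<le> x}" and ?U = "{p \<in> S. x < p}"
  have fin: "finite ?L" "finite ?U" using assms(1) by auto
  have ne: "?L \<noteq> {}" "?U \<noteq> {}" using assms by auto
  have L: "Max ?L \<in> ?L" and U: "Min ?U \<in> ?U" using Max_in[OF fin(1) ne(1)] Min_in[OF fin(2) ne(2)] by auto
  have "p \<le> Max ?L \<or> Min ?U \<le> p" if "p \<in> S" for p
    using that Max_ge[OF fin(1), of p] Min_le[OF fin(2), of p] by (cases "p \<le> x") auto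
  then have "consecutive S (Max ?L) (Min ?U)" using L U by (auto simp: consecutive_def)
  then show thesis using that L U by blast
qed

locale laminar =
  fixes N :: "'n set" and l r :: "'n \<Rightarrow> real"
  assumes finN: "finite N" and lr: "n \<in> N \<Longrightarrow> l n < r n"
    and l_inj: "m \<in> N \<Longrightarrow> n \<in> N \<Longrightarrow> l m = l n \<Longrightarrow> m = n"
    and r_inj: "m \<in> N \<Longrightarrow> n \<in> N \<Longrightarrow> r m = r n \<Longrightarrow> m = n"
    and l_r: "m \<in> N \<Longrightarrow> n \<in> N \<Longrightarrow> l m \<noteq> r n"
    and noncross: "m \<in> N \<Longrightarrow> n \<in> N \<Longrightarrow> l m < l n \<Longrightarrow> l n < r m \<Longrightarrow> r n < r m \<or> m = n"
begin

definition points :: "real set" where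
  "points = l ` N \<union> r ` N"

definition inner :: "'n set" where
  "inner = {m \<in> N. \<exists>n\<in>N. nested l r n m}"

definition visible :: "'n \<Rightarrow> real set" where
  "visible i = {p \<in> points. l i \<le> p \<and> p \<le> r i \<and> (\<forall>k\<in>N. nested l r k i \<longrightarrow> p \<le> l k \<or> r k \<le> p)}"

lemma finite_points: "finite points"
  using finN by (simp add: points_def)

lemma finite_visible: "finite (visible i)"
  using finite_points by (simp add: visible_def)

lemma pointsI: "n \<in> N \<Longrightarrow> l n \<in> points" "n \<in> N \<Longrightarrow> r n \<in> points"
  by (auto simp: points_def)

lemma innerN: "i \<in> inner \<Longrightarrow> i \<in> N"
  by (simp add: inner_def)

lemma nested_if_left:
  assumes "n \<in> N" "i \<in> N" "l i < l n" "l n < r i" shows "nested l r n i"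
  using noncross[of i n] assms by (auto simp: nested_def)

lemma nested_if_right:
  assumes "n \<in> N" "i \<in> N" "l i < r n" "r n < r i" shows "nested l r n i"
proof -
  have "l n \<noteq> l i" using l_inj[of n i] assms by auto
  moreover have "\<not> l n < l i" using noncross[of n i] assms by auto
  ultimately show ?thesis using assms by (auto simp: nested_def)
qed

lemma nested_if_point:
  assumes "n \<in> N" "i \<in> N" "p = l n \<or> p = r n" "l i < p" "p < r i" shows "nested l r n i"
  using assms nested_if_left nested_if_right by blast

lemma visible_ends: "i \<in> N \<Longrightarrow> l i \<in> visible i" "i \<in> N \<Longrightarrow> r i \<in> visible i"
  using lr[of i] pointsI[of i] by (auto simp: visible_def nested_def)

lemma visible_pair:
  assumes n: "n \<in> N" "nested l r n i" and v: "l n \<in> visible i \<or> r n \<in> visible i"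
  shows "consecutive (visible i) (l n) (r n)"
proof -
  have lt: "l n < r n" and ni: "l i < l n" "r n < r i" using lr n by (auto simp: nested_def)
  have out: "l n \<le> l k \<or> r k \<le> l n" "r n \<le> l k \<or> r k \<le> r n" if k: "k \<in> N" "nested l r k i" for k
  proof -
    have "(l n \<le> l k \<or> r k \<le> l n) \<and> (r n \<le> l k \<or> r k \<le> r n)"
    proof (cases "nested l r n k")
      case True
      then have "l k < l n" "r n < r k" by (auto simp: nested_def)
      then show ?thesis using v k lt by (auto simp: visible_def)
    next
      case False
      then show ?thesis
        using nested_if_left[OF n(1) k(1)] nested_if_right[OF n(1) k(1)] by linarith
    qed
    then show "l n \<le> l k \<or> r k \<le> l n" "r n \<le> l k \<or> r k \<le> r n" by auto
  qed
  then have "l n \<in> visible i" "r n \<in> visible i"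
    using pointsI[OF n(1)] lt ni by (auto simp: visible_def)
  moreover have "p \<le> l n \<or> r n \<le> p" if "p \<in> visible i" for p
    using that n by (auto simp: visible_def)
  ultimately show ?thesis using lt by (auto simp: consecutive_def)
qed

text \<open>Between two consecutive visible points either there is nothing at all, or they are the two ends
  of one maximal nested interval.\<close>

lemma consecutive_visible_cases:
  assumes i: "i \<in> N" and c: "consecutive (visible i) s t"
  obtains n where "n \<in> N" "nested l r n i" "s = l n" "t = r n" | "consecutive points s t"
proof (cases "consecutive points s t")
  case False
  have st: "s \<in> visible i" "t \<in> visible i" "s < t" using c by (auto simp: consecutive_def)
  then obtain p where p: "p \<in> points" "s < p" "p < t"
    using False by (auto simp: consecutive_def visible_def not_le)
  have "p \<notin> visible i" using c p by (auto simp: consecutive_def)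
  define K where "K = {k \<in> N. nested l r k i \<and> l k < p \<and> p < r k}"
  have "K \<noteq> {}" using \<open>p \<notin> visible i\<close> p st by (force simp: K_def visible_def)
  moreover have "finite K" using finN by (simp add: K_def)
  ultimately have "Min (l ` K) \<in> l ` K" and least: "\<And>k. k \<in> K \<Longrightarrow> Min (l ` K) \<le> l k"
    by (auto intro: Min_in)
  then obtain k where "k \<in> K" "l k = Min (l ` K)" by auto
  then have k: "k \<in> K" "\<And>k'. k' \<in> K \<Longrightarrow> l k \<le> l k'" using least by auto
  then have kN: "k \<in> N" "nested l r k i" "l k < p" "p < r k" by (auto simp: K_def)
  have ki: "l i < l k" "r k < r i" "l k < r k" using kN lr by (auto simp: nested_def)
  have "l k \<le> l k' \<or> r k' \<le> l k" if k': "k' \<in> N" "nested l r k' i" for k'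
  proof (rule ccontr)
    assume n: "\<not> ?thesis"
    then have "nested l r k k'" using nested_if_left[OF kN(1) k'(1)] by auto
    then have "k' \<in> K" using k' kN by (auto simp: K_def nested_def)
    then show False using k(2) n by auto
  qed
  then have "l k \<in> visible i" using ki pointsI[OF kN(1)] by (auto simp: visible_def)
  then have ck: "consecutive (visible i) (l k) (r k)" using visible_pair kN by blast
  have "l k \<le> s" using c ck p kN by (auto simp: consecutive_def)
  moreover have "t \<le> r k" using c ck p kN by (auto simp: consecutive_def)
  moreover have "s \<le> l k \<or> r k \<le> s" "t \<le> l k \<or> r k \<le> t" using st kN by (auto simp: visible_def)
  ultimately have "s = l k" "t = r k" using p kN by auto
  then show thesis using that(1) kN by blast
qed (use that in blast)

definition face_edges :: "'n \<Rightarrow> complex set set" where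
  "face_edges i = insert (seg (l i) (r i)) {seg s t | s t. consecutive (visible i) s t}"

definition face_list :: "'n \<Rightarrow> complex list" where
  "face_list i = map complex_of_real (sorted_list_of_set (visible i))"

lemma face_edges_cycle: assumes "i \<in> N" shows "face_edges i = cycle_edges (face_list i)"
proof -
  let ?xs = "sorted_list_of_set (visible i)"
  have fin: "finite (visible i)" by (rule finite_visible)
  have ne: "visible i \<noteq> {}" using visible_ends assms by blast
  then have ne': "?xs \<noteq> []" using fin by simp
  have "Min (visible i) = l i"
    using fin visible_ends(1)[OF assms] by (intro Min_eqI) (auto simp: visible_def)
  then have "hd ?xs = l i" using fin ne by (simp add: sorted_list_of_set_nonempty)
  moreover have "last ?xs = r i"
  proof -
    have "sorted ?xs" "set ?xs = visible i" using fin by auto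
    moreover from this have "last ?xs \<in> visible i" using ne' last_in_set by blast
    moreover obtain j where "j < length ?xs" "?xs ! j = r i"
      using visible_ends(2)[OF assms] \<open>set ?xs = visible i\<close> by (metis in_set_conv_nth)
    ultimately have "r i \<le> last ?xs"
      using sorted_nth_mono[of ?xs j "length ?xs - 1"] ne' by (simp add: last_conv_nth)
    then show ?thesis using \<open>last ?xs \<in> visible i\<close> by (auto simp: visible_def)
  qed
  moreover have "path_edges (face_list i) = {seg s t | s t. consecutive (visible i) s t}"
    unfolding face_list_def using path_edges_sorted[of ?xs] fin by simp
  ultimately show ?thesis
    unfolding face_edges_def using ne'
    by (subst cycle_edges_conv) (auto simp: face_list_def last_map hd_map insert_commute)
qed

definition graph :: "complex sgraph" where
  "graph = \<lparr> verts = complex_of_real ` points, edges = (\<Union>i\<in>inner. face_edges i) \<rparr>"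

definition chords :: "complex set set" where
  "chords = {seg (l n) (r n) | n. n \<in> N}"

lemma chordsE:
  assumes "e \<in> chords" obtains n where "n \<in> N" "e = seg (l n) (r n)" "l n < r n"
  using assms lr by (auto simp: chords_def)

lemma face_edge_cases:
  assumes "i \<in> inner" "e \<in> face_edges i"
  obtains n where "n \<in> N" "e = seg (l n) (r n)" "n = i \<or> nested l r n i" "l n \<in> visible i" "r n \<in> visible i"
  | s t where "e = seg s t" "consecutive points s t" "consecutive (visible i) s t"
proof -
  have i: "i \<in> N" using innerN assms by blast
  consider "e = seg (l i) (r i)" | s t where "e = seg s t" "consecutive (visible i) s t"
    using assms(2) by (auto simp: face_edges_def)
  then show thesis
  proof cases
    case 1
    then show thesis using that(1)[of i] i visible_ends by blast
  next
    case (2 s t)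
    show thesis
      using consecutive_visible_cases[OF i 2(2)]
    proof cases
      case (1 n)
      then show thesis using that(1)[of n] 2 by (auto simp: consecutive_def)
    qed (use that(2) 2 in blast)
  qed
qed

lemma edge_cases:
  assumes "e \<in> edges graph"
  obtains n where "n \<in> N" "e = seg (l n) (r n)" | s t where "e = seg s t" "consecutive points s t"
proof -
  obtain i where "i \<in> inner" "e \<in> face_edges i" using assms by (auto simp: graph_def)
  then show thesis using that face_edge_cases by metis
qed

lemma edgeE:
  assumes "e \<in> edges graph"
  obtains s t where "e = seg s t" "s < t" "s \<in> points" "t \<in> points"
  using edge_cases[OF assms] lr pointsI that unfolding consecutive_def by metis

lemma simple_graph: "simple_graph graph"
  unfolding simple_graph_def
proof (intro conjI ballI)
  show "finite (verts graph)" using finite_points by (simp add: graph_def)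
  fix e assume "e \<in> edges graph"
  then obtain s t where "e = seg s t" "s < t" "s \<in> points" "t \<in> points" by (rule edgeE)
  then show "e \<subseteq> verts graph" "card e = 2" by (auto simp: graph_def)
qed

lemma inner_gap:
  assumes "i \<in> inner" shows "\<not> consecutive (visible i) (l i) (r i)"
proof
  assume c: "consecutive (visible i) (l i) (r i)"
  have i: "i \<in> N" using innerN assms by blast
  obtain n where n: "n \<in> N" "nested l r n i" using assms by (auto simp: inner_def)
  show False
    using consecutive_visible_cases[OF i c]
  proof cases
    case (1 m) then show ?thesis by (simp add: nested_def)
  next
    case 2
    then show ?thesis using n pointsI(1)[OF n(1)] lr[OF n(1)] by (auto simp: consecutive_def nested_def)
  qed
qed

lemma face_is_cycle:
  assumes "i \<in> inner" shows "is_cycle graph (face_list i)"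
proof -
  have i: "i \<in> N" using innerN assms by blast
  let ?xs = "sorted_list_of_set (visible i)"
  have set_list: "set (face_list i) = complex_of_real ` visible i"
    using finite_visible by (simp add: face_list_def)
  have ne: "face_list i \<noteq> []" using set_list visible_ends[OF i] by auto
  have sub: "cycle_edges (face_list i) \<subseteq> edges graph"
    using face_edges_cycle[OF i] assms by (auto simp: graph_def)
  have succ: "successively (adj graph) ys" if "path_edges ys \<subseteq> edges graph" for ys
    using that by (induction ys rule: path_edges.induct) (auto simp: adj_def)
  obtain p where p: "p \<in> visible i" "l i < p" "p < r i"
    using inner_gap[OF assms] visible_ends[OF i] lr[OF i] by (auto simp: consecutive_def not_le)
  have "{l i, p, r i} \<subseteq> visible i" using p visible_ends[OF i] by blast
  then have "card {l i, p, r i} \<le> card (visible i)" using finite_visible card_mono by blast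
  then have "3 \<le> length (face_list i)" using p by (simp add: face_list_def)
  moreover have "distinct (face_list i)"
    unfolding face_list_def by (simp add: distinct_map inj_on_def)
  moreover have "set (face_list i) \<subseteq> verts graph"
    using set_list by (auto simp: graph_def visible_def)
  moreover have "successively (adj graph) (face_list i)" "adj graph (last (face_list i)) (hd (face_list i))"
    using succ[of "face_list i"] sub cycle_edges_conv[OF ne] by (auto simp: adj_def)
  ultimately show ?thesis by (simp add: is_cycle_def)
qed

lemma face_edges_verts: "i \<in> inner \<Longrightarrow> \<Union>(face_edges i) = complex_of_real ` visible i"
  using Union_cycle_edges[OF face_is_cycle] face_edges_cycle[OF innerN] finite_visible
  by (simp add: face_list_def)

lemma face_chord:
  assumes i: "i \<in> inner" and n: "n \<in> N" "l n \<in> visible i \<or> r n \<in> visible i"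
  shows "seg (l n) (r n) \<in> face_edges i"
proof (cases "n = i")
  case False
  have iN: "i \<in> N" using innerN i by blast
  have "l n \<noteq> l i" "r n \<noteq> r i" using l_inj r_inj n iN False by blast+
  moreover have "l n \<noteq> r i" "r n \<noteq> l i" using l_r[OF n(1) iN] l_r[OF iN n(1)] by auto
  moreover have "l i \<le> l n \<and> l n \<le> r i \<or> l i \<le> r n \<and> r n \<le> r i" using n by (auto simp: visible_def)
  ultimately have "nested l r n i"
    using nested_if_left[OF n(1) iN] nested_if_right[OF n(1) iN] by linarith
  then show ?thesis using visible_pair n by (auto simp: face_edges_def)
qed (simp add: face_edges_def)

lemma points_share:
  assumes ij: "i \<in> N" "j \<in> N" "i \<noteq> j" and p: "p \<in> visible i" "p \<in> visible j"
  shows "nested l r j i \<and> (p = l j \<or> p = r j) \<or> nested l r i j \<and> (p = l i \<or> p = r i)"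
proof -
  have bounds: "l i \<le> p" "p \<le> r i" "l j \<le> p" "p \<le> r j" using p by (auto simp: visible_def)
  have ne: "l i \<noteq> l j" "l j \<noteq> r i" "l i \<noteq> r j" using l_inj l_r ij by blast+
  show ?thesis
  proof (cases "l i < l j")
    case True
    then have "nested l r j i" using nested_if_left[OF ij(2,1)] bounds ne by auto
    moreover from this have "p \<le> l j \<or> r j \<le> p" using p(1) ij by (auto simp: visible_def)
    ultimately show ?thesis using bounds by auto
  next
    case False
    then have "nested l r i j" using nested_if_left[OF ij(1,2)] bounds ne by auto
    moreover from this have "p \<le> l i \<or> r i \<le> p" using p(2) ij by (auto simp: visible_def)
    ultimately show ?thesis using bounds by auto
  qed
qed

lemma covers_visible:
  assumes ij: "i \<in> N" "j \<in> N" and c: "covers N l r i j"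
  shows "l j \<in> visible i"
proof -
  have "l j \<le> l k \<or> r k \<le> l j" if k: "k \<in> N" "nested l r k i" for k
  proof -
    have "\<not> nested l r j k" using k c by (auto simp: covers_def)
    then have "\<not> (l k < l j \<and> l j < r k)" using nested_if_left[OF ij(2) k(1)] by blast
    then show ?thesis by linarith
  qed
  then show ?thesis using pointsI[OF ij(2)] c lr[OF ij(2)] by (auto simp: visible_def covers_def nested_def)
qed

text \<open>The ends of \<open>j\<close> are visible from \<open>i\<close> iff no interval lies strictly between \<open>j\<close> and \<open>i\<close>.\<close>

lemma share_iff_covers:
  assumes ij: "i \<in> N" "j \<in> N" "i \<noteq> j"
  shows "visible i \<inter> visible j \<noteq> {} \<longleftrightarrow> covers N l r i j \<or> covers N l r j i"
proof -
  have cov: "covers N l r i j" if ij: "i \<in> N" "j \<in> N" and p: "p \<in> visible i" "nested l r j i" "p = l j \<or> p = r j" for i j p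
  proof -
    have "\<not> nested l r k i" if "k \<in> N" "nested l r j k" for k
    proof
      assume "nested l r k i"
      then have "p \<le> l k \<or> r k \<le> p" using p(1) that by (auto simp: visible_def)
      then show False using that lr[OF ij(2)] p(3) by (auto simp: nested_def)
    qed
    then show ?thesis using p(2) by (auto simp: covers_def)
  qed
  show ?thesis
  proof
    assume "visible i \<inter> visible j \<noteq> {}"
    then show "covers N l r i j \<or> covers N l r j i" using points_share[OF ij] cov ij by blast
  next
    assume "covers N l r i j \<or> covers N l r j i"
    then show "visible i \<inter> visible j \<noteq> {}" using covers_visible visible_ends ij by blast
  qed
qed

end

section \<open>Perfect matchings and independent sets\<close>

lemma alternating_flip:
  assumes G: "simple_graph G" and M: "perfect_matching G M" and cyc: "is_cycle G xs"
    and alt: "\<And>x. x \<in> set xs \<Longrightarrow> matching_edge M x \<in> cycle_edges xs"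
  shows "perfect_matching G (sym_diff M (cycle_edges xs))"
  unfolding perfect_matching_def
proof (intro conjI ballI)
  let ?C = "cycle_edges xs"
  show "sym_diff M ?C \<subseteq> edges G"
    using perfect_matching_subset[OF M] cycle_edges_subset[OF cyc] by blast
  fix v assume v: "v \<in> verts G"
  note m = matching_edge[OF M v]
  show "\<exists>!e. e \<in> sym_diff M ?C \<and> v \<in> e"
  proof (cases "v \<in> set xs")
    case False
    then have out: "v \<notin> e" if "e \<in> ?C" for e using Union_cycle_edges[OF cyc] that by auto
    have uniq: "e = matching_edge M v" if e: "e \<in> sym_diff M ?C \<and> v \<in> e" for e
    proof -
      have "e \<in> M" "v \<in> e" using e out[of e] by auto
      then show ?thesis using matching_edge_eq[OF M v] by simp
    qed
    show ?thesis
    proof (rule ex1I[of _ "matching_edge M v"])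
      show "matching_edge M v \<in> sym_diff M ?C \<and> v \<in> matching_edge M v"
        using m out[of "matching_edge M v"] by auto
    qed (rule uniq)
  next
    case True
    have "card {e \<in> ?C. v \<in> e} = 2" using cycle_degree[OF cyc True] .
    moreover have mC: "matching_edge M v \<in> {e \<in> ?C. v \<in> e}" using m alt[OF True] by blast
    ultimately have "card ({e \<in> ?C. v \<in> e} - {matching_edge M v}) = 1" by (simp add: card_Diff_singleton)
    then obtain f where "{e \<in> ?C. v \<in> e} - {matching_edge M v} = {f}" by (rule card_1_singletonE)
    then have f: "{e \<in> ?C. v \<in> e} = {matching_edge M v, f}" "f \<noteq> matching_edge M v"
      using mC by blast+
    have fC: "f \<in> ?C" "v \<in> f" using f(1) by auto
    have "f \<notin> M"
    proof
      assume "f \<in> M"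
      from matching_edge_eq[OF M v this fC(2)] show False using f(2) by simp
    qed
    have uniq: "e = f" if e: "e \<in> sym_diff M ?C \<and> v \<in> e" for e
    proof (cases "e \<in> M")
      case True
      then have "matching_edge M v = e" using matching_edge_eq[OF M v True] e by simp
      then show ?thesis using e alt[OF \<open>v \<in> set xs\<close>] True by simp
    next
      case False
      then have "e \<in> {e \<in> ?C. v \<in> e}" "e \<noteq> matching_edge M v" using e m by auto
      then show ?thesis using f(1) by simp
    qed
    show ?thesis
    proof (rule ex1I[of _ f])
      show "f \<in> sym_diff M ?C \<and> v \<in> f" using fC \<open>f \<notin> M\<close> by simp
    qed (rule uniq)
  qed
qed

lemma matchings_cross_parity:
  assumes G: "simple_graph G" and M: "perfect_matching G M" and N: "perfect_matching G N"
    and X: "X \<subseteq> verts G"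
  shows "even (card {e \<in> M. crosses X e}) \<longleftrightarrow> even (card {e \<in> N. crosses X e})"
proof -
  have finX: "finite X" using G X finite_subset by (auto simp: simple_graph_def)
  have "even (card {e \<in> M. crosses X e}) \<longleftrightarrow> even (card X)" if M: "perfect_matching G M" for M
  proof -
    have MG: "M \<subseteq> edges G" using perfect_matching_subset M .
    have "card {e \<in> M. y \<in> e} = 1" if "y \<in> X" for y
    proof -
      have "y \<in> verts G" using X that by blast
      then have "{e \<in> M. y \<in> e} = {matching_edge M y}"
        using matching_edge[OF M] matching_edge_eq[OF M] by blast
      then show ?thesis by simp
    qed
    then have "(\<Sum>y\<in>X. card {e \<in> M. y \<in> e}) = card X" by simp
    moreover have "finite M" using MG finite_edges[OF G] finite_subset by blast
    moreover have "card e = 2" if "e \<in> M" for e using simple_graph_card_edge[OF G] MG that by blast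
    ultimately show ?thesis using crossing_parity[of M X] finX by simp
  qed
  then show ?thesis using M N by blast
qed

text \<open>In the spanning case every chord is an edge of some face, so the chords form a perfect
  matching. It alternates with the remaining edges on the cycle of every face.\<close>

locale spanning_laminar = laminar N l r for N :: "'n set" and l r +
  assumes covered: "n \<in> N \<Longrightarrow> n \<in> inner \<or> (\<exists>m\<in>N. nested l r n m)"
begin

lemma point_on_face:
  assumes n: "n \<in> N"
  obtains i where "i \<in> inner" "l n \<in> visible i" "r n \<in> visible i"
proof (cases "n \<in> inner")
  case True
  then show thesis using that visible_ends n by blast
next
  case False
  define K where "K = {m \<in> N. nested l r n m}"
  have "K \<noteq> {}" "finite K" using covered[OF n] False finN by (auto simp: K_def)
  then have "Max (l ` K) \<in> l ` K" and greatest: "\<And>k. k \<in> K \<Longrightarrow> l k \<le> Max (l ` K)"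
    by (auto intro: Max_in)
  then obtain i where i: "i \<in> K" "l i = Max (l ` K)" by auto
  have iN: "i \<in> N" "nested l r n i" using i by (auto simp: K_def)
  have "\<not> nested l r k i" if k: "k \<in> N" "nested l r n k" for k
  proof
    assume "nested l r k i"
    moreover have "l k \<le> l i" using greatest[of k] k i by (simp add: K_def)
    ultimately show False by (simp add: nested_def)
  qed
  then have "covers N l r i n" using iN by (auto simp: covers_def)
  then have "consecutive (visible i) (l n) (r n)"
    using covers_visible[OF iN(1) n] visible_pair[OF n iN(2)] by blast
  moreover have "i \<in> inner" using iN n by (auto simp: inner_def)
  ultimately show thesis using that by (auto simp: consecutive_def)
qed

lemma pm_chords: "perfect_matching graph chords"
  unfolding perfect_matching_def
proof (intro conjI ballI)
  show "chords \<subseteq> edges graph"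
  proof
    fix e assume "e \<in> chords"
    then obtain n where n: "n \<in> N" "e = seg (l n) (r n)" by (rule chordsE)
    then obtain i where "i \<in> inner" "l n \<in> visible i" using point_on_face by metis
    then show "e \<in> edges graph" using face_chord n by (auto simp: graph_def)
  qed
  fix v assume "v \<in> verts graph"
  then obtain n where n: "n \<in> N" "v = complex_of_real (l n) \<or> v = complex_of_real (r n)"
    by (auto simp: graph_def points_def)
  show "\<exists>!e. e \<in> chords \<and> v \<in> e"
  proof (rule ex1I[of _ "seg (l n) (r n)"])
    show "seg (l n) (r n) \<in> chords \<and> v \<in> seg (l n) (r n)" using n by (auto simp: chords_def)
    fix e assume e: "e \<in> chords \<and> v \<in> e"
    then obtain m where m: "m \<in> N" "e = seg (l m) (r m)" using chordsE by metis
    have "l m = l n \<or> r m = r n"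
      using e m n l_r[OF m(1) n(1)] l_r[OF n(1) m(1)] by auto
    then have "m = n" using l_inj[OF m(1) n(1)] r_inj[OF m(1) n(1)] by blast
    then show "e = seg (l n) (r n)" using m by simp
  qed
qed

lemma chord_at:
  assumes i: "i \<in> inner" and p: "p \<in> visible i"
  shows "matching_edge chords (complex_of_real p) \<in> face_edges i"
proof -
  have "p \<in> points" using p by (simp add: visible_def)
  then obtain n where n: "n \<in> N" "p = l n \<or> p = r n" by (auto simp: points_def)
  have "complex_of_real p \<in> verts graph" using \<open>p \<in> points\<close> by (simp add: graph_def)
  moreover have "seg (l n) (r n) \<in> chords" "complex_of_real p \<in> seg (l n) (r n)"
    using n by (auto simp: chords_def)
  ultimately have "matching_edge chords (complex_of_real p) = seg (l n) (r n)"
    using matching_edge_eq[OF pm_chords] by blast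
  then show ?thesis using face_chord[OF i n(1)] n(2) p by auto
qed

lemma pm_flip:
  assumes "i \<in> inner" shows "perfect_matching graph (sym_diff chords (face_edges i))"
proof -
  have "perfect_matching graph (sym_diff chords (cycle_edges (face_list i)))"
  proof (rule alternating_flip[OF simple_graph pm_chords face_is_cycle[OF assms]])
    fix x assume "x \<in> set (face_list i)"
    then obtain p where "p \<in> visible i" "x = complex_of_real p"
      using finite_visible by (auto simp: face_list_def)
    then show "matching_edge chords x \<in> cycle_edges (face_list i)"
      using chord_at[OF assms] face_edges_cycle[OF innerN[OF assms]] by simp
  qed
  then show ?thesis using face_edges_cycle[OF innerN[OF assms]] by simp
qed

definition gaps :: "'n \<Rightarrow> complex set set" where
  "gaps i = face_edges i - chords"

lemma gapE:
  assumes "i \<in> inner" "g \<in> gaps i"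
  obtains s t where "g = seg s t" "consecutive points s t" "consecutive (visible i) s t"
proof -
  have "g \<in> face_edges i" "g \<notin> chords" using assms by (auto simp: gaps_def)
  then show thesis
    using face_edge_cases[OF assms(1) \<open>g \<in> face_edges i\<close>] that by (auto simp: chords_def)
qed

lemma gap_at:
  assumes i: "i \<in> inner" and p: "p \<in> visible i"
  obtains g where "g \<in> gaps i" "complex_of_real p \<in> g"
proof -
  let ?v = "complex_of_real p" and ?M = "sym_diff chords (face_edges i)"
  have v: "?v \<in> verts graph" using p by (auto simp: graph_def visible_def)
  have "?v \<in> \<Union>(face_edges i)" using face_edges_verts[OF i] p by blast
  then have "matching_edge ?M ?v \<in> face_edges i" "matching_edge ?M ?v \<notin> chords"
    using alternating(2,3)[OF pm_chords pm_flip[OF i] v] by blast+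
  moreover have "?v \<in> matching_edge ?M ?v" using matching_edge(2)[OF pm_flip[OF i] v] .
  ultimately show thesis using that by (simp add: gaps_def)
qed

text \<open>Two faces share at most the two ends of one interval, hence at most a chord.\<close>

lemma gaps_disjoint:
  assumes ij: "i \<in> inner" "j \<in> inner" "i \<noteq> j"
  shows "gaps i \<inter> gaps j = {}"
proof (rule ccontr)
  assume "gaps i \<inter> gaps j \<noteq> {}"
  then obtain g where g: "g \<in> gaps i" "g \<in> gaps j" by blast
  obtain s t where st: "g = seg s t" "consecutive (visible i) s t" "s < t"
    using gapE[OF ij(1) g(1)] unfolding consecutive_def by metis
  obtain s' t' where st': "g = seg s' t'" "consecutive (visible j) s' t'" "s' < t'"
    using gapE[OF ij(2) g(2)] unfolding consecutive_def by metis
  have "s = s'" "t = t'" using seg_eq[OF st(3) st'(3)] st(1) st'(1) by auto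
  then have v: "s \<in> visible i" "s \<in> visible j" "t \<in> visible i" "t \<in> visible j"
    using st st' by (auto simp: consecutive_def)
  have N: "i \<in> N" "j \<in> N" using ij innerN by auto
  have "(s = l j \<and> t = r j) \<or> (s = l i \<and> t = r i)"
    using points_share[OF N ij(3) v(1,2)] points_share[OF N ij(3) v(3,4)] st(3) lr[OF N(1)] lr[OF N(2)]
    unfolding nested_def by argo
  then have "g \<in> chords" using st(1) N by (auto simp: chords_def)
  then show False using g by (simp add: gaps_def)
qed

lemma consecutive_points_cut:
  assumes "consecutive points s t" "p \<in> points" "p < t" shows "p \<le> s"
  using assms by (auto simp: consecutive_def)

text \<open>Cutting off the points between the left end of \<open>i\<close> and a gap of \<open>i\<close> separates only this gap
  and the first gap of \<open>i\<close> from the rest. No chord is cut, so the number of points cut off is even, and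
  a perfect matching contains both gaps or none of them.\<close>

lemma gaps_all_or_none:
  assumes M: "perfect_matching graph M" and i: "i \<in> inner" and g: "g \<in> gaps i" "g' \<in> gaps i"
  shows "g \<in> M \<longleftrightarrow> g' \<in> M"
proof -
  have iN: "i \<in> N" using innerN i .
  obtain f where f: "f \<in> gaps i" "complex_of_real (l i) \<in> f"
    using gap_at[OF i visible_ends(1)[OF iN]] .
  obtain a u where au: "f = seg a u" "consecutive points a u" "consecutive (visible i) a u"
    using gapE[OF i f(1)] .
  have "u \<noteq> l i"
    using au(3) by (auto simp: consecutive_def visible_def)
  then have a: "a = l i" using f(2) au(1) by auto
  have "e \<in> M \<longleftrightarrow> f \<in> M" if e: "e \<in> gaps i" for e
  proof -
    obtain s t where st: "e = seg s t" "consecutive points s t" "consecutive (visible i) s t"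
      using gapE[OF i e] .
    have sv: "s \<in> visible i" "t \<in> visible i" "s < t" using st(3) by (auto simp: consecutive_def)
    have bounds: "l i \<le> s" "t \<le> r i" using sv by (auto simp: visible_def)
    show ?thesis
    proof (cases "s = l i")
      case True
      then have "t = u" using consecutive_unique_right st(2) au(2) a by blast
      then show ?thesis using True st(1) au(1) a by simp
    next
      case False
      then have ls: "l i < s" using bounds by simp
      let ?P = "{p \<in> points. l i < p \<and> p \<le> s}"
      let ?X = "complex_of_real ` ?P"
      have mem: "complex_of_real p \<in> ?X \<longleftrightarrow> p \<in> points \<and> l i < p \<and> p \<le> s" for p by auto
      have X: "?X \<subseteq> verts graph" by (auto simp: graph_def)
      have chord: "\<not> crosses ?X c" if c: "c \<in> chords" for c
      proof -
        obtain n where n: "n \<in> N" "c = seg (l n) (r n)" "l n < r n" using chordsE[OF c] .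
        have "l i < l n \<and> l n \<le> s \<longleftrightarrow> l i < r n \<and> r n \<le> s"
        proof (cases "n = i")
          case True
          then show ?thesis using bounds sv(3) by auto
        next
          case ni: False
          show ?thesis
          proof
            assume h: "l i < l n \<and> l n \<le> s"
            then have "nested l r n i" using nested_if_left[OF n(1) iN] bounds sv(3) by auto
            have "r n \<le> s"
            proof (rule ccontr)
              assume ns: "\<not> r n \<le> s"
              have "s \<le> l n \<or> r n \<le> s" using sv(1) n(1) \<open>nested l r n i\<close> by (auto simp: visible_def)
              then have "s = l n" using h ns by auto
              then have "consecutive (visible i) s (r n)"
                using visible_pair[OF n(1) \<open>nested l r n i\<close>] sv(1) by simp
              then have "t = r n" using consecutive_unique_right st(3) by blast
              then have "e \<in> chords" using \<open>s = l n\<close> st(1) n(1) by (auto simp: chords_def)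
              then show False using e by (simp add: gaps_def)
            qed
            then show "l i < r n \<and> r n \<le> s" using h n(3) by auto
          next
            assume h: "l i < r n \<and> r n \<le> s"
            then have "nested l r n i" using nested_if_right[OF n(1) iN] bounds sv(3) by auto
            then show "l i < l n \<and> l n \<le> s" using h n(3) by (auto simp: nested_def)
          qed
        qed
        then show ?thesis using pointsI[OF n(1)] unfolding n(2) crosses_pair mem by blast
      qed
      have only: "c = e \<or> c = f" if c: "c \<in> edges graph" "crosses ?X c" for c
      proof -
        have "c \<notin> chords" using chord c(2) by blast
        then obtain x y where xy: "c = seg x y" "consecutive points x y"
          using edge_cases[OF c(1)] by (metis (mono_tags, lifting) chords_def mem_Collect_eq)
        have pts: "x \<in> points" "y \<in> points" "x < y" using xy(2) by (auto simp: consecutive_def)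
        have "(l i < x \<and> x \<le> s) \<noteq> (l i < y \<and> y \<le> s)"
          using c(2) pts unfolding xy(1) crosses_pair mem by blast
        then consider "l i < x" "x \<le> s" "s < y" | "x \<le> l i" "l i < y" using pts(3) by linarith
        then show ?thesis
        proof cases
          case 1
          have "s \<in> points" using st(2) by (simp add: consecutive_def)
          then have "x = s" using consecutive_points_cut[OF xy(2) _ 1(3)] 1(2) by simp
          then show ?thesis using consecutive_unique_right[OF st(2)] xy st(1) by blast
        next
          case 2
          have "l i \<in> points" using pointsI iN by blast
          then have "x = a" using consecutive_points_cut[OF xy(2) _ 2(2)] 2(1) a by simp
          then show ?thesis using consecutive_unique_right[OF au(2)] xy au(1) by blast
        qed
      qed
      have su: "s \<in> points" "t \<in> points" "u \<in> points" "a < u" using st(2) au(2) by (auto simp: consecutive_def)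
      have "u \<le> s" using st(2) au(2) ls a by (auto simp: consecutive_def)
      then have cross: "crosses ?X e" "crosses ?X f"
        using su ls sv(3) a unfolding st(1) au(1) crosses_pair mem by auto
      have "e \<noteq> f" using seg_eq[OF sv(3) su(4)] st(1) au(1) a False by simp
      have "{c \<in> M. crosses ?X c} = M \<inter> {e, f}"
        using only cross perfect_matching_subset[OF M] by blast
      moreover have none: "{c \<in> chords. crosses ?X c} = {}" using chord by blast
      have "even (card {c \<in> M. crosses ?X c})"
        using matchings_cross_parity[OF simple_graph M pm_chords X] unfolding none by simp
      ultimately have "even (card (M \<inter> {e, f}))" by simp
      then show ?thesis using \<open>e \<noteq> f\<close>
        by (cases "e \<in> M"; cases "f \<in> M") (simp_all add: Int_insert_right)
    qed
  qed
  then show ?thesis using g by blast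
qed

definition independent :: "'n set \<Rightarrow> bool" where
  "independent \<sigma> \<longleftrightarrow> \<sigma> \<subseteq> inner \<and> (\<forall>i\<in>\<sigma>. \<forall>j\<in>\<sigma>. i \<noteq> j \<longrightarrow> visible i \<inter> visible j = {})"

definition rotation :: "'n set \<Rightarrow> complex set set" where
  "rotation \<sigma> = sym_diff chords (\<Union>(face_edges ` \<sigma>))"

lemma faces_disjoint:
  assumes "i \<in> inner" "j \<in> inner" "visible i \<inter> visible j = {}"
  shows "\<Union>(face_edges i) \<inter> \<Union>(face_edges j) = {}" "face_edges i \<inter> face_edges j = {}"
proof -
  show d: "\<Union>(face_edges i) \<inter> \<Union>(face_edges j) = {}"
    using assms face_edges_verts by auto
  have "e \<noteq> {}" if "e \<in> face_edges i" for e using that by (auto simp: face_edges_def)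
  then show "face_edges i \<inter> face_edges j = {}" using d by blast
qed

lemma pm_rotation:
  assumes "independent \<sigma>" shows "perfect_matching graph (rotation \<sigma>)"
  unfolding rotation_def
proof (rule flip_disjoint[OF simple_graph pm_chords])
  fix C assume "C \<in> face_edges ` \<sigma>"
  then obtain i where "i \<in> inner" "C = face_edges i" using assms by (auto simp: independent_def)
  then show "C \<subseteq> edges graph \<and> perfect_matching graph (sym_diff chords C)"
    using pm_flip by (auto simp: graph_def)
next
  fix C C' assume "C \<in> face_edges ` \<sigma>" "C' \<in> face_edges ` \<sigma>" "C \<noteq> C'"
  then obtain i j where ij: "i \<in> \<sigma>" "C = face_edges i" "j \<in> \<sigma>" "C' = face_edges j" "i \<noteq> j" by blast
  then have "i \<in> inner" "j \<in> inner" "visible i \<inter> visible j = {}"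
    using assms by (auto simp: independent_def)
  then show "\<Union>C \<inter> \<Union>C' = {}" using faces_disjoint(1) ij by simp
qed

lemma rotation_gaps:
  assumes "\<sigma> \<subseteq> inner" "i \<in> inner" "g \<in> gaps i"
  shows "g \<in> rotation \<sigma> \<longleftrightarrow> i \<in> \<sigma>"
proof -
  have g: "g \<notin> chords" "g \<in> face_edges i" using assms(3) by (auto simp: gaps_def)
  have "j = i" if "j \<in> \<sigma>" "g \<in> face_edges j" for j
    using gaps_disjoint[of i j] that g assms by (auto simp: gaps_def)
  then show ?thesis using g by (auto simp: rotation_def)
qed

lemma gaps_nonempty: assumes "i \<in> inner" obtains g where "g \<in> gaps i"
  using gap_at[OF assms visible_ends(1)[OF innerN[OF assms]]] .

lemma inj_rotation: "inj_on rotation {\<sigma>. \<sigma> \<subseteq> inner}"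
proof (rule inj_onI)
  fix \<sigma> \<rho> assume s: "\<sigma> \<in> {\<sigma>. \<sigma> \<subseteq> inner}" "\<rho> \<in> {\<sigma>. \<sigma> \<subseteq> inner}" "rotation \<sigma> = rotation \<rho>"
  have "i \<in> \<sigma> \<longleftrightarrow> i \<in> \<rho>" if i: "i \<in> inner" for i
  proof -
    obtain g where "g \<in> gaps i" using gaps_nonempty i .
    moreover have "\<sigma> \<subseteq> inner" "\<rho> \<subseteq> inner" using s(1,2) by auto
    ultimately show ?thesis
      using rotation_gaps[of \<sigma> i g] rotation_gaps[of \<rho> i g] i unfolding s(3) by blast
  qed
  then show "\<sigma> = \<rho>" using s(1,2) by blast
qed

text \<open>A perfect matching is determined by the set of nodes whose gaps it contains, and two such nodes
  cannot share a vertex, because there the matching would have two edges.\<close>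

lemma matching_is_rotation:
  assumes M: "perfect_matching graph M"
  obtains \<sigma> where "independent \<sigma>" "M = rotation \<sigma>"
proof -
  define \<sigma> where "\<sigma> = {i \<in> inner. gaps i \<inter> M \<noteq> {}}"
  have all: "gaps i \<subseteq> M" if "i \<in> \<sigma>" for i
    using that gaps_all_or_none[OF M, of i] by (auto simp: \<sigma>_def)
  have ind: "independent \<sigma>"
    unfolding independent_def
  proof (intro conjI ballI impI)
    show "\<sigma> \<subseteq> inner" by (auto simp: \<sigma>_def)
    fix i j assume ij: "i \<in> \<sigma>" "j \<in> \<sigma>" "i \<noteq> j"
    show "visible i \<inter> visible j = {}"
    proof (rule ccontr)
      assume "visible i \<inter> visible j \<noteq> {}"
      then obtain p where p: "p \<in> visible i" "p \<in> visible j" by blast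
      have inn: "i \<in> inner" "j \<in> inner" using ij by (auto simp: \<sigma>_def)
      obtain g where g: "g \<in> gaps i" "complex_of_real p \<in> g" using gap_at[OF inn(1) p(1)] .
      obtain h where h: "h \<in> gaps j" "complex_of_real p \<in> h" using gap_at[OF inn(2) p(2)] .
      have "complex_of_real p \<in> verts graph" using p by (auto simp: visible_def graph_def)
      then have "g = h" using matching_unique[OF M] all ij g h by blast
      then show False using gaps_disjoint[OF inn ij(3)] g h by blast
    qed
  qed
  have "M \<subseteq> rotation \<sigma>"
  proof
    fix e assume e: "e \<in> M"
    have eG: "e \<in> edges graph" using e perfect_matching_subset[OF M] by blast
    show "e \<in> rotation \<sigma>"
    proof (cases "e \<in> chords")
      case False
      obtain i where i: "i \<in> inner" "e \<in> face_edges i" using eG by (auto simp: graph_def)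
      then have "e \<in> gaps i" using False by (simp add: gaps_def)
      then have "i \<in> \<sigma>" using i e by (auto simp: \<sigma>_def)
      then show ?thesis using i False by (auto simp: rotation_def)
    next
      case True
      have "e \<notin> face_edges i" if i: "i \<in> \<sigma>" for i
      proof
        assume ei: "e \<in> face_edges i"
        have inn: "i \<in> inner" using i by (simp add: \<sigma>_def)
        obtain s t where "e = seg s t" using edgeE[OF eG] by metis
        then have "complex_of_real s \<in> \<Union>(face_edges i)" "complex_of_real s \<in> e" using ei by auto
        then obtain p where p: "p \<in> visible i" "complex_of_real p \<in> e"
          using face_edges_verts[OF inn] by auto
        obtain g where g: "g \<in> gaps i" "complex_of_real p \<in> g" using gap_at[OF inn p(1)] .
        have "complex_of_real p \<in> verts graph" using p by (auto simp: visible_def graph_def)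
        then have "g = e" using matching_unique[OF M] all[OF i] g e p by blast
        then show False using g True by (simp add: gaps_def)
      qed
      then show ?thesis using True by (auto simp: rotation_def)
    qed
  qed
  then have "M = rotation \<sigma>"
    using perfect_matching_eqI[OF simple_graph M pm_rotation[OF ind]] by blast
  then show thesis using that ind by blast
qed

text \<open>Colour a point by the parity of the number of points to its left. A gap joins neighbours in
  this order, and the points strictly inside an interval come in pairs.\<close>

lemma bipartite_graph: "bipartite graph"
proof -
  define f where "f p = card {q \<in> points. q < p}" for p
  have fin: "finite {q \<in> points. q < p}" for p using finite_points by simp
  have split: "f t = f s + card {q \<in> points. s \<le> q \<and> q < t}" if "s < t" for s t
  proof -
    have "{q \<in> points. q < t} = {q \<in> points. q < s} \<union> {q \<in> points. s \<le> q \<and> q < t}" using that by auto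
    moreover have "card ({q \<in> points. q < s} \<union> {q \<in> points. s \<le> q \<and> q < t}) =
        card {q \<in> points. q < s} + card {q \<in> points. s \<le> q \<and> q < t}"
      using finite_points by (intro card_Un_disjoint) auto
    ultimately show ?thesis by (simp add: f_def)
  qed
  have flip: "even (f s) \<noteq> even (f t)" if "seg s t \<in> edges graph" "s < t" for s t
    using edge_cases[OF that(1)]
  proof cases
    case (1 n)
    then have st: "s = l n" "t = r n" using seg_eq[OF that(2) lr[OF 1(1)]] by auto
    let ?B = "{m \<in> N. nested l r m n}"
    have "{q \<in> points. s \<le> q \<and> q < t} = insert (l n) (l ` ?B \<union> r ` ?B)" (is "?L = ?R")
    proof
      show "?L \<subseteq> ?R"
      proof
        fix q assume q: "q \<in> ?L"
        then obtain m where m: "m \<in> N" "q = l m \<or> q = r m" by (auto simp: points_def)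
        show "q \<in> ?R"
        proof (cases "q = l n")
          case False
          then have "l n < q" "q < r n" using q st by auto
          then have "nested l r m n" using nested_if_point[OF m(1) 1(1) m(2)] by blast
          then show ?thesis using m by auto
        qed simp
      qed
      show "?R \<subseteq> ?L"
        using lr pointsI 1(1) that(2) st by (fastforce simp: nested_def points_def)
    qed
    moreover have "card (l ` ?B \<union> r ` ?B) = card ?B + card ?B"
    proof -
      have "inj_on l ?B" "inj_on r ?B" using l_inj r_inj by (auto simp: inj_on_def)
      moreover have "l ` ?B \<inter> r ` ?B = {}" using l_r by fastforce
      ultimately show ?thesis using finN by (simp add: card_Un_disjoint card_image)
    qed
    moreover have "l n \<notin> l ` ?B \<union> r ` ?B" "finite (l ` ?B \<union> r ` ?B)"
      using finN lr 1(1) by (force simp: nested_def)+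
    ultimately have "odd (card {q \<in> points. s \<le> q \<and> q < t})" by simp
    then show ?thesis using split[OF that(2)] by simp
  next
    case (2 s' t')
    then have st: "consecutive points s t" using seg_eq[of s t s' t'] that(2) by (auto simp: consecutive_def)
    then have "{q \<in> points. s \<le> q \<and> q < t} = {s}" by (auto simp: consecutive_def)
    then show ?thesis using split[OF that(2)] by simp
  qed
  define A where "A = complex_of_real ` {p \<in> points. even (f p)}"
  define B where "B = complex_of_real ` {p \<in> points. odd (f p)}"
  have A: "complex_of_real p \<in> A \<longleftrightarrow> p \<in> points \<and> even (f p)"
    and B: "complex_of_real p \<in> B \<longleftrightarrow> p \<in> points \<and> odd (f p)" for p
    by (auto simp: A_def B_def)
  have "\<exists>a\<in>A. \<exists>b\<in>B. e = {a, b}" if e: "e \<in> edges graph" for e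
  proof -
    obtain s t where st: "e = seg s t" "s < t" "s \<in> points" "t \<in> points" using edgeE[OF e] .
    have ts: "e = {complex_of_real t, complex_of_real s}" using st(1) by (simp add: insert_commute)
    have ne: "even (f s) \<noteq> even (f t)" using flip e st by blast
    show ?thesis
    proof (cases "even (f s)")
      case True
      then have "complex_of_real s \<in> A" "complex_of_real t \<in> B" using A B st(3,4) ne by simp_all
      then show ?thesis using st(1) by blast
    next
      case False
      then have "complex_of_real t \<in> A" "complex_of_real s \<in> B" using A B st(3,4) ne by simp_all
      then show ?thesis using ts by blast
    qed
  qed
  moreover have "A \<inter> B = {}" "A \<union> B = verts graph" by (auto simp: graph_def A_def B_def)
  ultimately show ?thesis unfolding bipartite_def by blast
qed

end

section \<open>Drawing the graph\<close>

text \<open>The region is the image of an open rectangle under a continuous map of the closed rectangle, which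
  gives connectedness, boundedness and the closure.\<close>

lemma region_between_graphs:
  fixes h g :: "real \<Rightarrow> real"
  assumes ab: "a < b" and ch: "continuous_on {a..b} h" and cg: "continuous_on {a..b} g"
    and lt: "\<And>x. a < x \<Longrightarrow> x < b \<Longrightarrow> h x < g x" and ends: "h a = g a" "h b = g b"
  defines "R \<equiv> {w. a < Re w \<and> Re w < b \<and> h (Re w) < Im w \<and> Im w < g (Re w)}"
  shows "open R" "connected R" "R \<noteq> {}" "bounded R"
    "frontier R = {w. a \<le> Re w \<and> Re w \<le> b \<and> (Im w = h (Re w) \<or> Im w = g (Re w))}"
proof -
  let ?\<phi> = "\<lambda>p. Complex (fst p) (h (fst p) + snd p * (g (fst p) - h (fst p)))"
  let ?S = "{a<..<b} \<times> {0<..<1::real}" and ?T = "{a..b} \<times> {0..1::real}"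
  have le: "h x \<le> g x" if "a \<le> x" "x \<le> b" for x
    using that lt[of x] ends by (cases "x = a \<or> x = b") auto
  have cont: "continuous_on ?T ?\<phi>"
    by (intro continuous_intros continuous_on_compose2[OF ch] continuous_on_compose2[OF cg]) auto
  have R: "R = ?\<phi> ` ?S"
  proof
    show "R \<subseteq> ?\<phi> ` ?S"
    proof
      fix w assume w: "w \<in> R"
      let ?s = "(Im w - h (Re w)) / (g (Re w) - h (Re w))"
      have d: "g (Re w) - h (Re w) > 0" using w by (auto simp: R_def)
      then have "0 < ?s" "?s < 1" using w by (auto simp: R_def divide_simps)
      moreover have "?\<phi> (Re w, ?s) = w" using d by (simp add: complex_eq_iff)
      ultimately show "w \<in> ?\<phi> ` ?S" using w by (intro image_eqI[of _ _ "(Re w, ?s)"]) (auto simp: R_def)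
    qed
    show "?\<phi> ` ?S \<subseteq> R"
    proof
      fix w assume "w \<in> ?\<phi> ` ?S"
      then obtain x s where xs: "a < x" "x < b" "0 < s" "s < 1" "w = ?\<phi> (x, s)" by auto
      have "0 < s * (g x - h x)" "s * (g x - h x) < 1 * (g x - h x)"
        using lt[OF xs(1,2)] xs(3,4) by (auto intro!: mult_pos_pos mult_strict_right_mono)
      then show "w \<in> R" using xs by (auto simp: R_def)
    qed
  qed
  have K: "{w. a \<le> Re w \<and> Re w \<le> b \<and> h (Re w) \<le> Im w \<and> Im w \<le> g (Re w)} = ?\<phi> ` ?T" (is "?K = _")
  proof
    show "?K \<subseteq> ?\<phi> ` ?T"
    proof
      fix w assume w: "w \<in> ?K"
      let ?s = "if g (Re w) = h (Re w) then 0 else (Im w - h (Re w)) / (g (Re w) - h (Re w))"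
      have "0 \<le> ?s" "?s \<le> 1" using w by (auto simp: divide_simps)
      moreover have "?\<phi> (Re w, ?s) = w" using w by (auto simp: complex_eq_iff)
      ultimately show "w \<in> ?\<phi> ` ?T" using w by (intro image_eqI[of _ _ "(Re w, ?s)"]) auto
    qed
    show "?\<phi> ` ?T \<subseteq> ?K"
    proof
      fix w assume "w \<in> ?\<phi> ` ?T"
      then obtain x s where xs: "a \<le> x" "x \<le> b" "0 \<le> s" "s \<le> 1" "w = ?\<phi> (x, s)" by auto
      have "0 \<le> s * (g x - h x)" "s * (g x - h x) \<le> g x - h x"
        using le[OF xs(1,2)] xs(3,4) mult_left_le_one_le[of "g x - h x" s] by auto
      then show "w \<in> ?K" using xs by auto
    qed
  qed
  have clS: "closure ?S = ?T" using ab by (simp add: closure_Times)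
  have compK: "compact ?K" unfolding K using cont by (intro compact_continuous_image compact_Times) auto
  have "closure R = ?K"
  proof
    show "closure R \<subseteq> ?K"
      using compact_imp_closed[OF compK] le by (intro closure_minimal) (auto simp: R_def)
    show "?K \<subseteq> closure R"
      unfolding K R clS[symmetric]
    proof (rule image_closure_subset)
      show "continuous_on (closure ?S) ?\<phi>" using cont unfolding clS .
    qed (rule closed_closure closure_subset)+
  qed
  show "connected R"
    unfolding R by (intro connected_continuous_image continuous_on_subset[OF cont] connected_Times) auto
  show "R \<noteq> {}" unfolding R using ab by auto
  show "bounded R" by (rule bounded_subset[OF compact_imp_bounded[OF compK]]) (auto simp: R_def)
  show op: "open R"
  proof -
    let ?U = "{w. a < Re w} \<inter> {w. Re w < b}"
    have U: "open ?U" by (intro open_Int open_halfspace_Re_gt open_halfspace_Re_lt)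
    have "continuous_on ?U (\<lambda>w. Im w - h (Re w))" "continuous_on ?U (\<lambda>w. g (Re w) - Im w)"
      by (intro continuous_intros continuous_on_compose2[OF ch] continuous_on_compose2[OF cg]; auto)+
    then have "open (?U \<inter> (\<lambda>w. Im w - h (Re w)) -` {0<..})" "open (?U \<inter> (\<lambda>w. g (Re w) - Im w) -` {0<..})"
      using U by (auto intro: continuous_open_preimage)
    then have "open ((?U \<inter> (\<lambda>w. Im w - h (Re w)) -` {0<..}) \<inter> (?U \<inter> (\<lambda>w. g (Re w) - Im w) -` {0<..}))"
      by (rule open_Int)
    also have "\<dots> = R" by (auto simp: R_def)
    finally show ?thesis .
  qed
  show "frontier R = {w. a \<le> Re w \<and> Re w \<le> b \<and> (Im w = h (Re w) \<or> Im w = g (Re w))}"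
    unfolding frontier_def \<open>closure R = ?K\<close> interior_open[OF op]
  proof
    show "?K - R \<subseteq> {w. a \<le> Re w \<and> Re w \<le> b \<and> (Im w = h (Re w) \<or> Im w = g (Re w))}"
    proof
      fix w assume w: "w \<in> ?K - R"
      show "w \<in> {w. a \<le> Re w \<and> Re w \<le> b \<and> (Im w = h (Re w) \<or> Im w = g (Re w))}"
      proof (cases "Re w = a \<or> Re w = b")
        case True then show ?thesis using w ends by auto
      next
        case False then show ?thesis using w by (auto simp: R_def)
      qed
    qed
    show "{w. a \<le> Re w \<and> Re w \<le> b \<and> (Im w = h (Re w) \<or> Im w = g (Re w))} \<subseteq> ?K - R"
      using le by (auto simp: R_def)
  qed
qed

lemma component_if_frontier_subset:
  assumes "connected R" "R \<noteq> {}" "R \<inter> K = {}" "frontier R \<subseteq> K"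
  shows "R \<in> components (- K)"
  unfolding in_components_maximal
proof (intro conjI allI impI)
  show "R \<subseteq> - K" using assms(3) by blast
  fix S assume S: "S \<noteq> {} \<and> R \<subseteq> S \<and> S \<subseteq> - K \<and> connected S"
  show "S = R"
  proof (rule ccontr)
    assume "S \<noteq> R"
    then have "S - R \<noteq> {}" "S \<inter> R \<noteq> {}" using S assms(2) by auto
    then have "S \<inter> frontier R \<noteq> {}" using connected_Int_frontier[of S R] S by blast
    then show False using S assms(4) by blast
  qed
qed (use assms in auto)

text \<open>Vertices lie on the real line, and the edge between \<open>s < t\<close> is the parabola
  \<open>y = (x - s) (t - x)\<close>. A parabola over a subinterval lies below one over the whole interval,
  so edges over nested or disjoint intervals do not cross.\<close>

definition parabola :: "complex set \<Rightarrow> real \<Rightarrow> complex" where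
  "parabola e u = (let s = Min (Re ` e); t = Max (Re ` e)
     in Complex (s + u * (t - s)) (u * (1 - u) * (t - s)\<^sup>2))"

lemma parabola_seg:
  "s < t \<Longrightarrow> parabola (seg s t) u = Complex (s + u * (t - s)) (u * (1 - u) * (t - s)\<^sup>2)"
  by (simp add: parabola_def)

definition cap :: "real \<Rightarrow> real \<Rightarrow> complex set" where
  "cap s t = {w. s \<le> Re w \<and> Re w \<le> t \<and> Im w = (Re w - s) * (t - Re w)}"

lemma parabola_image:
  assumes "s < t" shows "path_image (parabola (seg s t)) = cap s t"
proof
  show "path_image (parabola (seg s t)) \<subseteq> cap s t"
  proof
    fix w assume "w \<in> path_image (parabola (seg s t))"
    then obtain u where u: "0 \<le> u" "u \<le> 1" "w = parabola (seg s t) u" by (auto simp: path_image_def)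
    have "0 \<le> u * (t - s)" "u * (t - s) \<le> t - s"
      using u assms mult_left_le_one_le[of "t - s" u] by auto
    moreover have "Re w = s + u * (t - s)" using u(3) assms by (simp add: parabola_seg)
    ultimately have "s \<le> Re w" "Re w \<le> t" by linarith+
    moreover have "Im w = (Re w - s) * (t - Re w)"
      using u(3) assms by (simp add: parabola_seg power2_eq_square algebra_simps)
    ultimately show "w \<in> cap s t" by (simp add: cap_def)
  qed
  show "cap s t \<subseteq> path_image (parabola (seg s t))"
  proof
    fix w assume w: "w \<in> cap s t"
    define u where "u = (Re w - s) / (t - s)"
    have "u * (t - s) = Re w - s" using assms by (simp add: u_def)
    then have x: "Re w = s + u * (t - s)" by simp
    have "0 \<le> u" "u \<le> 1" using w assms by (auto simp: u_def cap_def divide_simps)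
    moreover have "parabola (seg s t) u = w"
      using w assms x by (simp add: parabola_seg cap_def complex_eq_iff power2_eq_square algebra_simps)
    ultimately show "w \<in> path_image (parabola (seg s t))" by (auto simp: path_image_def)
  qed
qed

lemma parabola_arc:
  assumes "s < t"
  shows "arc (parabola (seg s t))" "pathstart (parabola (seg s t)) = complex_of_real s"
    "pathfinish (parabola (seg s t)) = complex_of_real t"
proof -
  have "parabola (seg s t) = (\<lambda>u. Complex (s + u * (t - s)) (u * (1 - u) * (t - s)\<^sup>2))"
    using parabola_seg[OF assms] by blast
  then have "path (parabola (seg s t))" unfolding path_def by (auto intro!: continuous_intros)
  moreover have "inj_on (parabola (seg s t)) {0..1}"
    using assms by (auto simp: inj_on_def parabola_seg)
  ultimately show "arc (parabola (seg s t))" by (simp add: arc_def)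
  show "pathstart (parabola (seg s t)) = complex_of_real s" "pathfinish (parabola (seg s t)) = complex_of_real t"
    using assms by (auto simp: pathstart_def pathfinish_def parabola_seg complex_eq_iff)
qed

lemma cap_real: "s < t \<Longrightarrow> complex_of_real p \<in> cap s t \<longleftrightarrow> p = s \<or> p = t"
  by (auto simp: cap_def)

lemma height_nested:
  fixes s t s' t' x :: real
  assumes "s \<le> s'" "s' \<le> x" "x \<le> t'" "t' \<le> t"
  shows "(x - s') * (t' - x) \<le> (x - s) * (t - x)"
  using assms by (intro mult_mono) auto

lemma height_nested_strict:
  fixes s t s' t' x :: real
  assumes "s \<le> s'" "s' < x" "x < t'" "t' \<le> t" "(s, t) \<noteq> (s', t')"
  shows "(x - s') * (t' - x) < (x - s) * (t - x)"
proof (cases "s = s'")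
  case True
  then have "t' - x < t - x" using assms by auto
  then show ?thesis using mult_strict_left_mono[of "t' - x" "t - x" "x - s'"] True assms by simp
next
  case False
  then have "(x - s') * (t' - x) < (x - s) * (t' - x)"
    using assms by (intro mult_strict_right_mono) auto
  also have "\<dots> \<le> (x - s) * (t - x)" using assms by (intro mult_left_mono) auto
  finally show ?thesis .
qed

lemma cap_Int_nested:
  assumes st: "s' < t'" "s \<le> s'" "t' \<le> t" "(s, t) \<noteq> (s', t')"
  shows "cap s t \<inter> cap s' t' \<subseteq> seg s t \<inter> seg s' t'"
proof
  fix w assume w: "w \<in> cap s t \<inter> cap s' t'"
  have eq: "(Re w - s) * (t - Re w) = (Re w - s') * (t' - Re w)" and x: "s' \<le> Re w" "Re w \<le> t'"
    using w by (auto simp: cap_def)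
  have "\<not> (s' < Re w \<and> Re w < t')" using height_nested_strict[OF st(2) _ _ st(3,4)] eq by force
  then have r: "Re w = s' \<or> Re w = t'" using x by auto
  then have "(Re w - s) * (t - Re w) = 0" using eq by auto
  then have "Re w = s \<or> Re w = t" by auto
  moreover have "Im w = 0" using w r by (auto simp: cap_def)
  ultimately show "w \<in> seg s t \<inter> seg s' t'" using r by (auto simp: complex_eq_iff)
qed

lemma cap_Int:
  assumes "s < t" "s' < t'" "(s, t) \<noteq> (s', t')"
    and "t \<le> s' \<or> t' \<le> s \<or> s \<le> s' \<and> t' \<le> t \<or> s' \<le> s \<and> t \<le> t'"
  shows "cap s t \<inter> cap s' t' = seg s t \<inter> seg s' t'"
proof
  have disj: "cap s t \<inter> cap s' t' \<subseteq> seg s t \<inter> seg s' t'" if "t \<le> s'" for s t s' t'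
  proof
    fix w assume "w \<in> cap s t \<inter> cap s' t'"
    then have "Re w = t" "Re w = s'" "Im w = 0" using that by (auto simp: cap_def)
    then show "w \<in> seg s t \<inter> seg s' t'" by (auto simp: complex_eq_iff)
  qed
  show "cap s t \<inter> cap s' t' \<subseteq> seg s t \<inter> seg s' t'"
    using assms(4) disj[of t s' s t'] disj[of t' s s' t] cap_Int_nested[OF assms(2), of s t]
      cap_Int_nested[OF assms(1), of s' t'] assms(3) by blast
  show "seg s t \<inter> seg s' t' \<subseteq> cap s t \<inter> cap s' t'"
    using assms by (auto simp: cap_real)
qed

context spanning_laminar begin

definition is_seg :: "real \<Rightarrow> real \<Rightarrow> bool" where
  "is_seg s t \<longleftrightarrow> (\<exists>n\<in>N. s = l n \<and> t = r n) \<or> consecutive points s t"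

lemma is_seg_points: "is_seg s t \<Longrightarrow> s < t \<and> s \<in> points \<and> t \<in> points"
  using lr pointsI by (auto simp: is_seg_def consecutive_def)

lemma edge_is_seg:
  assumes "e \<in> edges graph" obtains s t where "e = seg s t" "is_seg s t"
  using edge_cases[OF assms] that unfolding is_seg_def by metis

lemma segs_noncrossing:
  assumes "is_seg s t" "is_seg s' t'"
  shows "t \<le> s' \<or> t' \<le> s \<or> s \<le> s' \<and> t' \<le> t \<or> s' \<le> s \<and> t \<le> t'"
proof -
  have gap: "t \<le> s' \<or> t' \<le> s \<or> s' \<le> s \<and> t \<le> t'" if "consecutive points s t" "is_seg s' t'" for s t s' t'
    using that is_seg_points[OF that(2)] unfolding consecutive_def by fastforce
  consider "consecutive points s t" | "consecutive points s' t'"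
    | m n where "m \<in> N" "s = l m" "t = r m" "n \<in> N" "s' = l n" "t' = r n"
    using assms by (auto simp: is_seg_def)
  then show ?thesis
  proof cases
    case 1 then show ?thesis using gap assms by blast
  next
    case 2 then show ?thesis using gap[OF 2 assms(1)] by blast
  next
    case (3 m n)
    show ?thesis
      using noncross[OF 3(1,4)] noncross[OF 3(4,1)] l_inj[OF 3(1,4)] 3 by fastforce
  qed
qed

lemma plane_drawing: "plane_graph graph parabola"
  unfolding plane_graph_def
proof (intro conjI ballI impI simple_graph)
  fix e assume "e \<in> edges graph"
  then obtain s t where st: "e = seg s t" "is_seg s t" by (rule edge_is_seg)
  have lt: "s < t" "s \<in> points" "t \<in> points" using is_seg_points[OF st(2)] by auto
  show "arc (parabola e)" "{pathstart (parabola e), pathfinish (parabola e)} = e"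
    using parabola_arc[OF lt(1)] st(1) by auto
  show "path_image (parabola e) \<inter> verts graph = e"
    using lt cap_real[OF lt(1)] unfolding st(1) parabola_image[OF lt(1)] by (auto simp: graph_def)
next
  fix e f assume e: "e \<in> edges graph" and f: "f \<in> edges graph" and ne: "e \<noteq> f"
  obtain s t where st: "e = seg s t" "is_seg s t" using edge_is_seg[OF e] .
  obtain s' t' where st': "f = seg s' t'" "is_seg s' t'" using edge_is_seg[OF f] .
  have lt: "s < t" "s' < t'" using is_seg_points st(2) st'(2) by auto
  have "(s, t) \<noteq> (s', t')" using ne st st' by auto
  then show "path_image (parabola e) \<inter> path_image (parabola f) = e \<inter> f"
    unfolding st(1) st'(1) parabola_image[OF lt(1)] parabola_image[OF lt(2)]
    using cap_Int[OF lt] segs_noncrossing[OF st(2) st'(2)] by blast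
qed

sublocale plane graph parabola
  by unfold_locales (rule plane_drawing)

text \<open>The bounded face of an inner node \<open>i\<close> is the region between the parabola over \<open>i\<close> and the
  parabolas over the consecutive visible points; outside its interval a parabola is
  negative, so the lower boundary is just the maximum of all of them.\<close>

theorem face_edges_face:
  assumes i: "i \<in> inner" shows "face_cycle (face_edges i)"
proof -
  have iN: "i \<in> N" using innerN i .
  let ?a = "l i" and ?b = "r i"
  have ab: "?a < ?b" using lr iN .
  define Q where "Q = {(s, t). consecutive (visible i) s t}"
  have "Q \<subseteq> visible i \<times> visible i" by (auto simp: Q_def consecutive_def)
  then have finQ: "finite Q" using finite_visible finite_subset by blast
  have Qb: "?a \<le> s" "s < t" "t \<le> ?b" if "(s, t) \<in> Q" for s t
    using that by (auto simp: Q_def consecutive_def visible_def)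
  have Qne: "(s, t) \<noteq> (?a, ?b)" if "(s, t) \<in> Q" for s t
    using that inner_gap[OF i] by (auto simp: Q_def)
  have pair: "\<exists>s t. (s, t) \<in> Q \<and> s \<le> x \<and> x < t" if x: "?a \<le> x" "x < ?b" for x
  proof -
    obtain s t where "consecutive (visible i) s t" "s \<le> x" "x < t"
      using finite_sorted_predecessor[OF finite_visible visible_ends[OF iN] x] .
    then show ?thesis by (auto simp: Q_def)
  qed
  have pair': "\<exists>s t. (s, t) \<in> Q \<and> s \<le> x \<and> x \<le> t" if x: "?a \<le> x" "x \<le> ?b" for x
  proof (cases "x < ?b")
    case True then show ?thesis using pair[OF x(1)] by (meson less_imp_le)
  next
    case False
    then have "x = ?b" using x by simp
    define y where "y = Max (insert ?a {p \<in> visible i. p < ?b})"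
    have fin: "finite (insert ?a {p \<in> visible i. p < ?b})" using finite_visible by simp
    have y: "y \<in> insert ?a {p \<in> visible i. p < ?b}" using Max_in[OF fin] by (auto simp: y_def)
    then have "?a \<le> y" "y < ?b" using ab by (auto simp: visible_def)
    then obtain s t where st: "(s, t) \<in> Q" "s \<le> y" "y < t" using pair by blast
    have "\<not> t < ?b"
    proof
      assume "t < ?b"
      moreover have "t \<in> visible i" using st(1) by (simp add: Q_def consecutive_def)
      ultimately have "t \<le> y" using Max_ge[OF fin, of t] by (simp add: y_def)
      then show False using st by simp
    qed
    then show ?thesis using st Qb[OF st(1)] \<open>x = ?b\<close> by (intro exI[of _ s] exI[of _ t]) auto
  qed
  have Qne0: "Q \<noteq> {}" using pair[of ?a] ab by auto
  let ?v = "\<lambda>x (s, t). (x - s) * (t - x) :: real"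
  define h where "h x = Max (?v x ` Q)" for x
  define g where "g x = (x - ?a) * (?b - x)" for x
  have finv: "finite (?v x ` Q)" and nev: "?v x ` Q \<noteq> {}" for x using finQ Qne0 by auto
  have h_ge: "(x - s) * (t - x) \<le> h x" if "(s, t) \<in> Q" for x s t
    unfolding h_def using Max_ge[OF finv, of "?v x (s, t)"] that by force
  have h_eq: "h x = (x - s) * (t - x)" if st: "(s, t) \<in> Q" "s \<le> x" "x \<le> t" for x s t
  proof (rule antisym)
    show "h x \<le> (x - s) * (t - x)"
      unfolding h_def
    proof (rule Max.boundedI[OF finv nev])
      fix v assume "v \<in> ?v x ` Q"
      then obtain s' t' where st': "(s', t') \<in> Q" "v = (x - s') * (t' - x)" by auto
      show "v \<le> (x - s) * (t - x)"
      proof (cases "s' < x \<and> x < t'")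
        case True
        have "t' \<le> s \<or> t \<le> s' \<or> s = s' \<and> t = t'"
          using st(1) st'(1) unfolding Q_def consecutive_def by fastforce
        then show ?thesis using True st st' by auto
      next
        case False
        then have "(x - s') * (t' - x) \<le> 0"
          using Qb[OF st'(1)] by (auto simp: mult_le_0_iff)
        also have "0 \<le> (x - s) * (t - x)" using st by simp
        finally show ?thesis using st' by simp
      qed
    qed
  qed (rule h_ge[OF st(1)])
  have cont_max: "continuous_on {?a..?b} (\<lambda>x. Max (?v x ` P))" if "finite P" "P \<noteq> {}" for P
    using that
  proof (induction P rule: finite_ne_induct)
    case (singleton p)
    then show ?case by (cases p) (auto intro!: continuous_intros)
  next
    case (insert p P)
    have "Max (?v x ` insert p P) = max (?v x p) (Max (?v x ` P))" for x
      using insert.hyps by simp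
    then show ?case using insert.IH by (cases p) (auto intro!: continuous_intros)
  qed
  have ch: "continuous_on {?a..?b} h" unfolding h_def by (rule cont_max[OF finQ Qne0])
  have cg: "continuous_on {?a..?b} g" unfolding g_def by (intro continuous_intros)
  have h_nonneg: "0 \<le> h x" if x: "?a \<le> x" "x \<le> ?b" for x
  proof -
    obtain s t where "(s, t) \<in> Q" "s \<le> x" "x \<le> t" using pair'[OF x] by blast
    then show ?thesis using h_eq by simp
  qed
  have hg: "h x < g x" if x: "?a < x" "x < ?b" for x
  proof -
    obtain s t where st: "(s, t) \<in> Q" "s \<le> x" "x \<le> t" using pair'[of x] x by auto
    note b = Qb[OF st(1)]
    show ?thesis
    proof (cases "s < x \<and> x < t")
      case True
      then show ?thesis
        using height_nested_strict[of ?a s x t ?b] b Qne[OF st(1)] h_eq[OF st] by (auto simp: g_def)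
    next
      case False
      then have "h x = 0" using h_eq[OF st] st by auto
      then show ?thesis using x by (simp add: g_def)
    qed
  qed
  have ends: "h ?a = g ?a" "h ?b = g ?b"
  proof -
    obtain s t where st: "(s, t) \<in> Q" "s \<le> ?a" "?a \<le> t" using pair'[of ?a] ab by auto
    then show "h ?a = g ?a" using h_eq[OF st] Qb[OF st(1)] by (simp add: g_def)
    obtain s' t' where st': "(s', t') \<in> Q" "s' \<le> ?b" "?b \<le> t'" using pair'[of ?b] ab by auto
    then show "h ?b = g ?b" using h_eq[OF st'] Qb[OF st'(1)] by (simp add: g_def)
  qed
  define R where "R = {w. ?a < Re w \<and> Re w < ?b \<and> h (Re w) < Im w \<and> Im w < g (Re w)}"
  note region = region_between_graphs[OF ab ch cg hg ends, folded R_def]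
  have curve_eq: "curve parabola (face_edges i) = cap ?a ?b \<union> (\<Union>(s, t)\<in>Q. cap s t)"
  proof -
    have "face_edges i = insert (seg ?a ?b) ((\<lambda>(s, t). seg s t) ` Q)"
      by (auto simp: face_edges_def Q_def)
    then have "curve parabola (face_edges i) = path_image (parabola (seg ?a ?b)) \<union>
        (\<Union>(s, t)\<in>Q. path_image (parabola (seg s t)))" by (auto simp: curve_def)
    also have "\<dots> = cap ?a ?b \<union> (\<Union>(s, t)\<in>Q. cap s t)"
      using Qb(2) parabola_image parabola_image[OF ab] by fastforce
    finally show ?thesis .
  qed
  define B where "B = {w. ?a \<le> Re w \<and> Re w \<le> ?b \<and> (Im w = h (Re w) \<or> Im w = g (Re w))}"
  have "B \<subseteq> cap ?a ?b \<union> (\<Union>(s, t)\<in>Q. cap s t)"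
  proof
    fix w assume w: "w \<in> B"
    then consider "Im w = g (Re w)" | "Im w = h (Re w)" by (auto simp: B_def)
    then show "w \<in> cap ?a ?b \<union> (\<Union>(s, t)\<in>Q. cap s t)"
    proof cases
      case 1 then show ?thesis using w by (simp add: cap_def g_def B_def)
    next
      case 2
      obtain s t where st: "(s, t) \<in> Q" "s \<le> Re w" "Re w \<le> t"
        using pair'[of "Re w"] w by (auto simp: B_def)
      then have "w \<in> cap s t" using 2 h_eq[OF st] by (simp add: cap_def)
      then show ?thesis using st(1) by blast
    qed
  qed
  moreover have "cap ?a ?b \<subseteq> B" by (auto simp: cap_def g_def B_def)
  moreover have "cap s t \<subseteq> B" if st: "(s, t) \<in> Q" for s t
    using Qb[OF st] h_eq[OF st] by (auto simp: cap_def B_def)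
  ultimately have "B = curve parabola (face_edges i)" unfolding curve_eq by blast
  moreover have "frontier R = B" using region(5) by (simp add: B_def)
  ultimately have fr: "frontier R = curve parabola (face_edges i)" by simp
  have sub: "face_edges i \<subseteq> edges graph" using i by (auto simp: graph_def)
  have fr_sub: "frontier R \<subseteq> drawing graph parabola"
    unfolding fr using sub by (auto simp: curve_def drawing_def)
  have cap_out: "w \<notin> R" if e: "is_seg s t" and w: "w \<in> cap s t" for s t w
  proof
    assume "w \<in> R"
    let ?x = "Re w"
    have x: "?a < ?x" "?x < ?b" "h ?x < Im w" "Im w < g ?x" using \<open>w \<in> R\<close> by (auto simp: R_def)
    have wx: "s \<le> ?x" "?x \<le> t" "Im w = (?x - s) * (t - ?x)" using w by (auto simp: cap_def)
    have st: "s < t" "s \<in> points" "t \<in> points" using is_seg_points[OF e] by auto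
    have "is_seg ?a ?b" using iN by (auto simp: is_seg_def)
    then consider "s \<le> ?a" "?b \<le> t" | "?a \<le> s" "t \<le> ?b" "(s, t) \<noteq> (?a, ?b)"
      using segs_noncrossing[OF e] x wx by fastforce
    then show False
    proof cases
      case 1
      then have "g ?x \<le> Im w" using height_nested[of s ?a ?x ?b t] x wx by (simp add: g_def)
      then show False using x by simp
    next
      case 2
      have "s < ?b" using 2 st by simp
      then obtain s0 t0 where st0: "(s0, t0) \<in> Q" "s0 \<le> s" "s < t0" using pair[OF 2(1)] by blast
      have "t \<le> t0"
      proof (rule ccontr)
        assume n: "\<not> t \<le> t0"
        have t0: "t0 \<in> visible i" "t0 \<in> points" using st0(1) by (auto simp: Q_def consecutive_def visible_def)
        then have "\<not> consecutive points s t" using n st0(3) unfolding consecutive_def by force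
        then obtain n' where n': "n' \<in> N" "s = l n'" "t = r n'" using e by (auto simp: is_seg_def)
        have "n' \<noteq> i" using 2(3) n' by auto
        then have "l n' \<noteq> ?a" "r n' \<noteq> ?b" using l_inj[OF n'(1) iN] r_inj[OF n'(1) iN] by auto
        then have "nested l r n' i" using 2 n' by (auto simp: nested_def)
        then have "t0 \<le> l n' \<or> r n' \<le> t0" using t0(1) n'(1) by (auto simp: visible_def)
        then show False using n st0(3) n' by simp
      qed
      then have "Im w \<le> (?x - s0) * (t0 - ?x)" using height_nested[of s0 s ?x t t0] st0 wx by simp
      then show False using h_ge[OF st0(1), of ?x] x by simp
    qed
  qed
  have "R \<inter> drawing graph parabola = {}"
  proof (rule ccontr)
    assume "R \<inter> drawing graph parabola \<noteq> {}"
    then obtain w where w: "w \<in> R" "w \<in> drawing graph parabola" by blast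
    consider "w \<in> verts graph" | e where "e \<in> edges graph" "w \<in> path_image (parabola e)"
      using w(2) by (auto simp: drawing_def)
    then show False
    proof cases
      case 1
      then have "Im w = 0" by (auto simp: graph_def)
      moreover have "0 \<le> h (Re w)" using h_nonneg w(1) by (auto simp: R_def)
      ultimately show False using w(1) by (auto simp: R_def)
    next
      case (2 e)
      obtain s t where st: "e = seg s t" "is_seg s t" using edge_is_seg[OF 2(1)] .
      then have "s < t" using is_seg_points by blast
      then have "w \<in> cap s t" using 2(2) st(1) parabola_image by simp
      then show False using cap_out[OF st(2)] w(1) by blast
    qed
  qed
  then have "R \<in> faces graph parabola"
    unfolding faces_def using component_if_frontier_subset region(2,3) fr_sub by blast
  then have "R \<in> finite_faces graph parabola" using region(4) by (simp add: finite_faces_def)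
  moreover have "periphery graph parabola R = face_edges i"
  proof
    show "face_edges i \<subseteq> periphery graph parabola R"
      using sub by (auto simp: periphery_def fr curve_def)
    show "periphery graph parabola R \<subseteq> face_edges i"
    proof
      fix e assume "e \<in> periphery graph parabola R"
      then have e: "e \<in> edges graph" "path_image (parabola e) \<subseteq> curve parabola (face_edges i)"
        by (auto simp: periphery_def fr)
      obtain p where p: "p \<in> open_edge parabola e" using open_edge_nonempty[OF e(1)] .
      then have "p \<in> curve parabola (face_edges i)" using e(2) by (auto simp: open_edge_def)
      then obtain f where f: "f \<in> face_edges i" "p \<in> path_image (parabola f)" by (auto simp: curve_def)
      have "e = f"
      proof (rule ccontr)
        assume "e \<noteq> f"
        then have "p \<in> e" using edges_meet[OF e(1), of f] f sub p by (auto simp: open_edge_def)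
        then show False using p by (simp add: open_edge_def)
      qed
      then show "e \<in> face_edges i" using f by simp
    qed
  qed
  ultimately show ?thesis
    unfolding face_cycle_def using face_is_cycle[OF i] face_edges_cycle[OF iN] by blast
qed

end

section \<open>The resonance graph of a nested interval graph\<close>

lemma card_Collect_Un_disjoint:
  assumes "finite A" "finite B" "A \<inter> B = {}"
  shows "card {i \<in> A \<union> B. P i} = card {i \<in> A. P i} + card {i \<in> B. P i}"
proof -
  have "{i \<in> A \<union> B. P i} = {i \<in> A. P i} \<union> {i \<in> B. P i}" by blast
  moreover have "{i \<in> A. P i} \<inter> {i \<in> B. P i} = {}" using assms(3) by blast
  ultimately show ?thesis using assms by (simp add: card_Un_disjoint)
qed

lemma (in plane) face_cycle_sum:
  assumes fc: "face_cycle B" and finD: "finite \<D>" and fD: "\<And>X. X \<in> \<D> \<Longrightarrow> face_cycle X"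
    and par: "\<And>e. odd (card {X \<in> \<D>. e \<in> X}) \<longleftrightarrow> e \<in> B"
  shows "\<D> = {B}"
proof -
  have "B \<in> \<D>"
  proof (rule ccontr)
    assume nB: "B \<notin> \<D>"
    have "insert B \<D> = {}"
    proof (rule face_cycles_independent)
      fix e
      have eq: "{X \<in> insert B \<D>. e \<in> X} = (if e \<in> B then insert B {X \<in> \<D>. e \<in> X} else {X \<in> \<D>. e \<in> X})"
        by auto
      have "finite {X \<in> \<D>. e \<in> X}" "B \<notin> {X \<in> \<D>. e \<in> X}" using nB finD by auto
      then show "even (card {X \<in> insert B \<D>. e \<in> X})"
        unfolding eq using par[of e] card_insert_disjoint[of "{X \<in> \<D>. e \<in> X}" B] by (cases "e \<in> B") simp_all
    qed (use fD fc finD in auto)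
    then show False by blast
  qed
  have "\<D> - {B} = {}"
  proof (rule face_cycles_independent)
    fix e
    show "even (card {X \<in> \<D> - {B}. e \<in> X})"
    proof (cases "e \<in> B")
      case True
      have "{X \<in> \<D>. e \<in> X} = insert B {X \<in> \<D> - {B}. e \<in> X}" using \<open>B \<in> \<D>\<close> True by blast
      moreover have "B \<notin> {X \<in> \<D> - {B}. e \<in> X}" "finite {X \<in> \<D> - {B}. e \<in> X}" using finD by auto
      ultimately have card: "card {X \<in> \<D>. e \<in> X} = Suc (card {X \<in> \<D> - {B}. e \<in> X})" by simp
      have "odd (card {X \<in> \<D>. e \<in> X})" using par True by blast
      then show ?thesis unfolding card by (simp only: even_Suc) simp
    next
      case False
      then have "{X \<in> \<D> - {B}. e \<in> X} = {X \<in> \<D>. e \<in> X}" by blast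
      then show ?thesis using par[of e] False by simp
    qed
  qed (use fD finD in auto)
  then show ?thesis using \<open>B \<in> \<D>\<close> by blast
qed

context spanning_laminar begin

lemma finite_inner: "finite inner"
  using finN by (simp add: inner_def)

lemma inj_face_edges: "inj_on face_edges inner"
proof (rule inj_onI)
  fix i j assume ij: "i \<in> inner" "j \<in> inner" "face_edges i = face_edges j"
  obtain g where g: "g \<in> gaps i" using gaps_nonempty ij(1) .
  then have "g \<in> gaps j" using ij(3) by (simp add: gaps_def)
  then show "i = j" using gaps_disjoint[OF ij(1,2)] g by blast
qed

lemma union_parity:
  assumes "independent \<sigma>"
  shows "e \<in> \<Union>(face_edges ` \<sigma>) \<longleftrightarrow> odd (card {i \<in> \<sigma>. e \<in> face_edges i})"
proof (cases "e \<in> \<Union>(face_edges ` \<sigma>)")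
  case True
  then obtain i where i: "i \<in> \<sigma>" "e \<in> face_edges i" by blast
  have "j = i" if j: "j \<in> \<sigma>" "e \<in> face_edges j" for j
  proof (rule ccontr)
    assume "j \<noteq> i"
    then have "face_edges j \<inter> face_edges i = {}"
      using assms i j by (intro faces_disjoint(2)) (auto simp: independent_def)
    then show False using i j by blast
  qed
  then have "{i \<in> \<sigma>. e \<in> face_edges i} = {i}" using i by blast
  then show ?thesis using True by simp
next
  case False
  then have none: "{i \<in> \<sigma>. e \<in> face_edges i} = {}" by blast
  show ?thesis using False unfolding none by simp
qed

lemma rotation_insert:
  assumes "independent (insert i \<sigma>)" "i \<notin> \<sigma>"
  shows "sym_diff (rotation \<sigma>) (rotation (insert i \<sigma>)) = face_edges i"
proof -
  have "face_edges i \<inter> face_edges j = {}" if "j \<in> \<sigma>" for j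
    using assms that by (intro faces_disjoint(2)) (auto simp: independent_def)
  then have disj: "face_edges i \<inter> \<Union>(face_edges ` \<sigma>) = {}" by blast
  have ins: "\<Union>(face_edges ` insert i \<sigma>) = face_edges i \<union> \<Union>(face_edges ` \<sigma>)" by simp
  show ?thesis unfolding rotation_def ins using disj by blast
qed

text \<open>Rotating a single face gives an adjacent matching. Conversely, if two rotations differ by the
  periphery of a single bounded face, then linear independence of the peripheries shows that this is
  the only face in which they differ.\<close>

lemma adj_rotation:
  assumes s: "independent \<sigma>" and r: "independent \<rho>"
  shows "adj (resonance_graph graph parabola) (rotation \<sigma>) (rotation \<rho>) \<longleftrightarrow> card (sym_diff \<sigma> \<rho>) = 1"
proof -
  have inn: "\<sigma> \<subseteq> inner" "\<rho> \<subseteq> inner" using s r by (auto simp: independent_def)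
  then have fin: "finite \<sigma>" "finite \<rho>" using finite_inner finite_subset by blast+
  let ?B = "sym_diff (rotation \<sigma>) (rotation \<rho>)"
  have "face_cycle ?B \<longleftrightarrow> card (sym_diff \<sigma> \<rho>) = 1"
  proof
    assume fc: "face_cycle ?B"
    define \<D> where "\<D> = face_edges ` sym_diff \<sigma> \<rho>"
    have sdi: "sym_diff \<sigma> \<rho> \<subseteq> inner" using inn by blast
    have finD: "finite \<D>" using fin by (simp add: \<D>_def)
    have fD: "face_cycle X" if "X \<in> \<D>" for X
      using that face_edges_face sdi by (auto simp: \<D>_def)
    have par: "odd (card {X \<in> \<D>. e \<in> X}) \<longleftrightarrow> e \<in> ?B" for e
    proof -
      let ?n = "\<lambda>A. card {i \<in> A. e \<in> face_edges i}"
      have "{X \<in> \<D>. e \<in> X} = face_edges ` {i \<in> sym_diff \<sigma> \<rho>. e \<in> face_edges i}"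
        by (auto simp: \<D>_def)
      moreover have "inj_on face_edges {i \<in> sym_diff \<sigma> \<rho>. e \<in> face_edges i}"
        by (rule inj_on_subset[OF inj_face_edges]) (use sdi in blast)
      ultimately have "card {X \<in> \<D>. e \<in> X} = ?n (sym_diff \<sigma> \<rho>)" by (simp add: card_image)
      also have "\<dots> = ?n (\<sigma> - \<rho>) + ?n (\<rho> - \<sigma>)"
        using fin by (intro card_Collect_Un_disjoint) auto
      finally have 1: "card {X \<in> \<D>. e \<in> X} = ?n (\<sigma> - \<rho>) + ?n (\<rho> - \<sigma>)" .
      have 2: "?n (\<sigma> - \<rho> \<union> \<sigma> \<inter> \<rho>) = ?n (\<sigma> - \<rho>) + ?n (\<sigma> \<inter> \<rho>)"
        "?n (\<rho> - \<sigma> \<union> \<sigma> \<inter> \<rho>) = ?n (\<rho> - \<sigma>) + ?n (\<sigma> \<inter> \<rho>)"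
        by (rule card_Collect_Un_disjoint; use fin in blast)+
      have eq: "\<sigma> - \<rho> \<union> \<sigma> \<inter> \<rho> = \<sigma>" "\<rho> - \<sigma> \<union> \<sigma> \<inter> \<rho> = \<rho>" by blast+
      have "e \<in> ?B \<longleftrightarrow> (e \<in> \<Union>(face_edges ` \<sigma>)) \<noteq> (e \<in> \<Union>(face_edges ` \<rho>))"
        unfolding rotation_def by blast
      also have "\<dots> \<longleftrightarrow> odd (?n \<sigma>) \<noteq> odd (?n \<rho>)"
        unfolding union_parity[OF s] union_parity[OF r] ..
      finally have 3: "e \<in> ?B \<longleftrightarrow> odd (?n \<sigma>) \<noteq> odd (?n \<rho>)" .
      show ?thesis unfolding 1 3 2[unfolded eq] even_add by blast
    qed
    have "\<D> = {?B}" by (rule face_cycle_sum[OF fc finD fD]) (simp_all only: par)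
    then have "card \<D> = 1" by simp
    then show "card (sym_diff \<sigma> \<rho>) = 1"
      using card_image[OF inj_on_subset[OF inj_face_edges sdi]] by (simp add: \<D>_def)
  next
    assume "card (sym_diff \<sigma> \<rho>) = 1"
    then obtain i where i: "sym_diff \<sigma> \<rho> = {i}" by (rule card_1_singletonE)
    then have inner: "i \<in> inner" using inn by blast
    have diff: "((x \<in> \<sigma>) \<noteq> (x \<in> \<rho>)) \<longleftrightarrow> x = i" for x
    proof -
      have "x \<in> sym_diff \<sigma> \<rho> \<longleftrightarrow> x = i" unfolding i by simp
      then show ?thesis by auto
    qed
    show "face_cycle ?B"
    proof (cases "i \<in> \<sigma>")
      case True
      then have ins: "insert i \<rho> = \<sigma>" and "i \<notin> \<rho>" using diff by auto
      then have "sym_diff (rotation \<rho>) (rotation (insert i \<rho>)) = face_edges i"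
        using s by (intro rotation_insert) (simp_all only: ins not_False_eq_True)
      then have "sym_diff (rotation \<rho>) (rotation \<sigma>) = face_edges i" unfolding ins .
      then have eq: "?B = face_edges i" by (rule trans[OF sym_diff_comm[of "rotation \<sigma>" "rotation \<rho>"]])
      show ?thesis unfolding eq by (rule face_edges_face[OF inner])
    next
      case False
      have ins: "insert i \<sigma> = \<rho>"
      proof (rule set_eqI)
        fix x show "x \<in> insert i \<sigma> \<longleftrightarrow> x \<in> \<rho>"
          using diff[of x] False by (cases "x = i") simp_all
      qed
      have "independent (insert i \<sigma>)" unfolding ins by (rule r)
      then have "sym_diff (rotation \<sigma>) (rotation (insert i \<sigma>)) = face_edges i"
        using False by (rule rotation_insert)
      then have eq: "?B = face_edges i" unfolding ins .
      show ?thesis unfolding eq by (rule face_edges_face[OF inner])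
    qed
  qed
  then show ?thesis using adj_resonance pm_rotation s r by blast
qed

lemma resonance_iso:
  assumes h: "inj h" "h ` V = inner"
    and D: "\<And>\<sigma>. \<sigma> \<in> D \<longleftrightarrow> \<sigma> \<subseteq> V \<and> (\<forall>i\<in>\<sigma>. \<forall>j\<in>\<sigma>. i \<noteq> j \<longrightarrow> visible (h i) \<inter> visible (h j) = {})"
  shows "complex_graph D \<simeq>\<^sub>g resonance_graph graph parabola"
proof -
  have ind: "independent (h ` \<sigma>) \<longleftrightarrow> \<sigma> \<in> D" for \<sigma>
  proof -
    have "h ` \<sigma> \<subseteq> inner \<longleftrightarrow> \<sigma> \<subseteq> V" using h(2) inj_image_subset_iff[OF h(1)] by metis
    moreover have "h i \<noteq> h j \<longleftrightarrow> i \<noteq> j" for i j using h(1) by (simp add: inj_eq)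
    ultimately show ?thesis unfolding independent_def D by simp
  qed
  let ?f = "\<lambda>\<sigma>. rotation (h ` \<sigma>)"
  have "bij_betw ?f D {M. perfect_matching graph M}"
    unfolding bij_betw_def
  proof
    show "inj_on ?f D"
    proof (rule inj_onI)
      fix \<sigma> \<rho> assume sr: "\<sigma> \<in> D" "\<rho> \<in> D" "rotation (h ` \<sigma>) = rotation (h ` \<rho>)"
      then have "h ` \<sigma> \<subseteq> inner" "h ` \<rho> \<subseteq> inner" using ind by (auto simp: independent_def)
      then have "h ` \<sigma> = h ` \<rho>" using inj_onD[OF inj_rotation sr(3)] by simp
      then show "\<sigma> = \<rho>" using inj_image_eq_iff[OF h(1)] by simp
    qed
    show "?f ` D = {M. perfect_matching graph M}"
    proof
      show "?f ` D \<subseteq> {M. perfect_matching graph M}" using pm_rotation ind by auto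
      show "{M. perfect_matching graph M} \<subseteq> ?f ` D"
      proof
        fix M assume "M \<in> {M. perfect_matching graph M}"
        then obtain \<tau> where \<tau>: "independent \<tau>" "M = rotation \<tau>" using matching_is_rotation by blast
        then have "\<tau> \<subseteq> h ` V" using h(2) by (simp add: independent_def)
        then obtain \<sigma> where "\<tau> = h ` \<sigma>" by (auto simp: subset_image_iff)
        then show "M \<in> ?f ` D" using \<tau> ind by auto
      qed
    qed
  qed
  moreover have "adj (complex_graph D) \<sigma> \<rho> \<longleftrightarrow> adj (resonance_graph graph parabola) (?f \<sigma>) (?f \<rho>)"
    if sr: "\<sigma> \<in> D" "\<rho> \<in> D" for \<sigma> \<rho>
  proof -
    have "sym_diff (h ` \<sigma>) (h ` \<rho>) = h ` sym_diff \<sigma> \<rho>"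
      using h(1) by (simp add: image_Un image_set_diff)
    then have "card (sym_diff (h ` \<sigma>) (h ` \<rho>)) = card (sym_diff \<sigma> \<rho>)"
      using card_image[OF inj_on_subset[OF h(1)]] by simp
    then show ?thesis using adj_rotation ind sr by (simp add: adj_complex_graph)
  qed
  moreover have "verts (complex_graph D) = D" "verts (resonance_graph graph parabola) = {M. perfect_matching graph M}"
    by (simp_all add: complex_graph_def resonance_graph_def)
  ultimately show ?thesis unfolding graph_iso_def by (intro exI[of _ ?f]) simp
qed

lemma all_edges_allowed: "allowed_edges graph = edges graph"
proof
  show "edges graph \<subseteq> allowed_edges graph"
  proof
    fix e assume e: "e \<in> edges graph"
    then obtain i where i: "i \<in> inner" "e \<in> face_edges i" by (auto simp: graph_def)
    show "e \<in> allowed_edges graph"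
    proof (cases "e \<in> chords")
      case True
      then show ?thesis using e pm_chords by (auto simp: allowed_edges_def)
    next
      case False
      then have "e \<in> rotation {i}" using i by (simp add: rotation_def)
      moreover have "independent {i}" using i by (simp add: independent_def)
      ultimately show ?thesis using e pm_rotation by (auto simp: allowed_edges_def)
    qed
  qed
qed (auto simp: allowed_edges_def)

text \<open>A vertex set closed under allowed edges contains the cycle of a face entirely or not at all, and
  faces with a common vertex behave alike.\<close>

lemma graph_elementary:
  assumes ne: "inner \<noteq> {}"
    and conn: "\<And>S. S \<subseteq> inner \<Longrightarrow> S \<noteq> {} \<Longrightarrow>
      (\<And>i j. i \<in> S \<Longrightarrow> j \<in> inner \<Longrightarrow> visible i \<inter> visible j \<noteq> {} \<Longrightarrow> j \<in> S) \<Longrightarrow> S = inner"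
  shows "elementary graph"
proof -
  let ?A = "edge_induced_subgraph (allowed_edges graph)"
  have A: "verts ?A = verts graph" "edges ?A = edges graph"
  proof -
    have "complex_of_real p \<in> \<Union>(edges graph)" if p: "p \<in> points" for p
    proof -
      obtain n where n: "n \<in> N" "p = l n \<or> p = r n" using p by (auto simp: points_def)
      obtain i where i: "i \<in> inner" "l n \<in> visible i" using point_on_face[OF n(1)] by metis
      then have "seg (l n) (r n) \<in> edges graph" using face_chord[OF i(1) n(1)] by (auto simp: graph_def)
      then show ?thesis using n(2) by blast
    qed
    then have "verts graph \<subseteq> \<Union>(edges graph)" by (simp add: graph_def image_subset_iff)
    moreover have "\<Union>(edges graph) \<subseteq> verts graph" using simple_graph by (auto simp: simple_graph_def)
    ultimately have "\<Union>(edges graph) = verts graph" by blast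
    then show "verts ?A = verts graph" "edges ?A = edges graph"
      by (simp_all add: edge_induced_subgraph_def all_edges_allowed)
  qed
  have "\<exists>xs. walk ?A u xs v" if u: "u \<in> verts graph" and v: "v \<in> verts graph" for u v
  proof -
    define Y where "Y = {w. \<exists>xs. walk ?A u xs w}"
    have "walk ?A u [u] u" using u by (simp add: walk_def A)
    then have uY: "u \<in> Y" by (auto simp: Y_def)
    have step: "y \<in> Y" if x: "x \<in> Y" and e: "{x, y} \<in> edges graph" for x y
    proof -
      obtain xs where xs: "walk ?A u xs x" using x by (auto simp: Y_def)
      have "y \<in> verts graph" using e simple_graph by (auto simp: simple_graph_def)
      then have "walk ?A u (xs @ [y]) y"
        using xs e by (auto simp: walk_def A successively_append_iff adj_def)
      then show ?thesis by (auto simp: Y_def)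
    qed
    have uncrossed: "\<not> crosses Y e" if "e \<in> edges graph" for e
    proof -
      obtain a b where ab: "e = {a, b}" using edgeE[OF \<open>e \<in> edges graph\<close>] by metis
      then have "{a, b} \<in> edges graph" "{b, a} \<in> edges graph"
        using \<open>e \<in> edges graph\<close> by (auto simp: insert_commute)
      then show ?thesis using step[of a b] step[of b a] ab by (auto simp: crosses_pair)
    qed
    have dich: "complex_of_real ` visible i \<subseteq> Y \<or> complex_of_real ` visible i \<inter> Y = {}" if i: "i \<in> inner" for i
    proof -
      have "\<not> crosses Y e" if "e \<in> cycle_edges (face_list i)" for e
        using uncrossed cycle_edges_subset[OF face_is_cycle[OF i]] that by blast
      then show ?thesis
        using cycle_connected[OF face_is_cycle[OF i], of Y] finite_visible by (simp add: face_list_def)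
    qed
    define S where "S = {i \<in> inner. complex_of_real ` visible i \<subseteq> Y}"
    have cover: "\<exists>i\<in>inner. \<exists>p\<in>visible i. w = complex_of_real p" if "w \<in> verts graph" for w
    proof -
      obtain n where n: "n \<in> N" "w = complex_of_real (l n) \<or> w = complex_of_real (r n)"
        using \<open>w \<in> verts graph\<close> by (auto simp: graph_def points_def)
      obtain i where "i \<in> inner" "l n \<in> visible i" "r n \<in> visible i" using point_on_face[OF n(1)] .
      then show ?thesis using n(2) by blast
    qed
    have "S = inner"
    proof (rule conn)
      show "S \<noteq> {}"
      proof -
        obtain i p where "i \<in> inner" "p \<in> visible i" "u = complex_of_real p" using cover[OF u] by blast
        then have "i \<in> S" using dich[of i] uY by (auto simp: S_def)
        then show ?thesis by blast
      qed
      fix i j assume ij: "i \<in> S" "j \<in> inner" "visible i \<inter> visible j \<noteq> {}"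
      then obtain p where "p \<in> visible i" "p \<in> visible j" by blast
      moreover from this have "complex_of_real p \<in> Y" using ij(1) by (auto simp: S_def)
      ultimately show "j \<in> S" using dich[OF ij(2)] ij(2) by (auto simp: S_def)
    qed (auto simp: S_def)
    then have "v \<in> Y" using cover[OF v] by (auto simp: S_def)
    then show ?thesis by (auto simp: Y_def)
  qed
  moreover have "verts graph \<noteq> {}" using ne innerN pointsI by (fastforce simp: graph_def)
  ultimately have "connected_graph ?A" by (simp add: connected_graph_def A)
  then show ?thesis unfolding elementary_def using pm_chords by blast
qed

lemma graph_not_K2: assumes "i \<in> inner" shows "\<not> graph \<simeq>\<^sub>g K2"
proof
  assume "graph \<simeq>\<^sub>g K2"
  then obtain f where "bij_betw f (verts graph) (verts K2)" by (auto simp: graph_iso_def)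
  then have "card (verts graph) = card (verts K2)" by (rule bij_betw_same_card)
  then have "card (verts graph) = 2" by (simp add: K2_def)
  moreover have "set (face_list i) \<subseteq> verts graph" "distinct (face_list i)" "3 \<le> length (face_list i)"
    using face_is_cycle[OF assms] by (auto simp: is_cycle_def)
  then have "3 \<le> card (verts graph)"
    using card_mono[OF finite_verts, of "set (face_list i)"] by (simp add: distinct_card)
  ultimately show False by simp
qed

end

section \<open>Forests as nested intervals\<close>

text \<open>The first vertex of a longest path has all its neighbours on the path, and a neighbour other than
  the second vertex would close a cycle.\<close>

lemma forest_leaf:
  assumes T: "simple_graph T" "forest T" "verts T \<noteq> {}"
  obtains v j where "v \<in> verts T" "\<And>w. adj T v w \<Longrightarrow> w = j"
proof -
  let ?P = "\<lambda>xs. xs \<noteq> [] \<and> distinct xs \<and> set xs \<subseteq> verts T \<and> successively (adj T) xs"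
  obtain v0 where v0: "v0 \<in> verts T" using T(3) by blast
  have fin: "finite (verts T)" using T(1) by (simp add: simple_graph_def)
  have "\<exists>xs. ?P xs \<and> (\<forall>ys. ?P ys \<longrightarrow> length ys \<le> length xs)"
  proof (rule ex_has_greatest_nat[of ?P "[v0]" length "Suc (card (verts T))"])
    show "?P [v0]" using v0 by simp
    show "\<forall>ys. ?P ys \<longrightarrow> length ys < Suc (card (verts T))"
    proof (intro allI impI)
      fix ys assume ys: "?P ys"
      then have "card (set ys) \<le> card (verts T)" using card_mono[OF fin] by blast
      then show "length ys < Suc (card (verts T))" using ys distinct_card[of ys] by simp
    qed
  qed
  then obtain xs where xs: "?P xs" and longest: "\<And>ys. ?P ys \<Longrightarrow> length ys \<le> length xs" by blast
  then obtain x ys where x: "xs = x # ys" by (cases xs) auto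
  have in_path: "w \<in> set ys" if w: "adj T x w" for w
  proof (rule ccontr)
    assume "w \<notin> set ys"
    then have "w \<notin> set xs" using simple_graph_adjD(1)[OF T(1) w] x by auto
    moreover have "w \<in> verts T" "adj T w x" using simple_graph_adjD[OF T(1) w] w adj_commute[of T] by auto
    ultimately have "?P (w # xs)" using xs x by auto
    then show False using longest[of "w # xs"] by simp
  qed
  have "w = hd ys" if w: "adj T x w" for w
  proof (rule ccontr)
    assume n: "w \<noteq> hd ys"
    obtain y zs where y: "ys = y # zs" using in_path[OF w] by (cases ys) auto
    then have "w \<in> set zs" using in_path[OF w] n by auto
    then obtain us vs where zs: "zs = us @ w # vs" by (meson split_list)
    have "xs = (x # y # us @ [w]) @ vs" using x y zs by simp
    then have "successively (adj T) (x # y # us @ [w])" "distinct (x # y # us @ [w])"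
      "set (x # y # us @ [w]) \<subseteq> verts T"
      using xs by (metis successively_append_iff, metis distinct_append, auto)
    moreover have "adj T w x" using w adj_commute[of T] by simp
    ultimately have "is_cycle T (x # y # us @ [w])" by (simp add: is_cycle_def)
    then show False using T(2) by (auto simp: forest_def)
  qed
  then show thesis using that[of x "hd ys"] xs x by auto
qed

lemma finite_min_gap:
  assumes "finite (S :: real set)"
  obtains d where "0 < d" "\<And>p q. p \<in> S \<Longrightarrow> q \<in> S \<Longrightarrow> p < q \<Longrightarrow> p + d \<le> q"
proof -
  let ?D = "insert 1 ((\<lambda>(p, q). q - p) ` {(p, q) \<in> S \<times> S. p < q})"
  have "finite {(p, q) \<in> S \<times> S. p < q}" by (rule finite_subset[of _ "S \<times> S"]) (use assms in auto)
  then have fin: "finite ?D" by simp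
  have "Min ?D \<in> ?D" using Min_in[OF fin] by blast
  then have "0 < Min ?D" by auto
  moreover have "p + Min ?D \<le> q" if "p \<in> S" "q \<in> S" "p < q" for p q
  proof -
    have "q - p \<in> ?D" using that by (intro insertI2 image_eqI[of _ _ "(p, q)"]) auto
    then have "Min ?D \<le> q - p" by (rule Min_le[OF fin])
    then show ?thesis by simp
  qed
  ultimately show thesis using that by blast
qed

text \<open>A new interval that contains no end point of the others is a leaf below whatever contains it.\<close>

lemma laminar_insert:
  assumes L: "laminar V a b" and v: "v \<notin> V" and xy: "x < y"
    and all_free: "\<forall>i\<in>V. (a i < x \<or> y < a i) \<and> (b i < x \<or> y < b i)"
  defines "a' \<equiv> a(v := x)" and "b' \<equiv> b(v := y)"
  shows "laminar (insert v V) a' b'"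
    "\<And>i. i \<in> V \<Longrightarrow> nested a' b' v i \<longleftrightarrow> a i < x \<and> y < b i"
    "\<And>i. i \<in> insert v V \<Longrightarrow> \<not> nested a' b' i v"
    "\<And>i j. i \<in> V \<Longrightarrow> j \<in> V \<Longrightarrow> covers (insert v V) a' b' i j \<longleftrightarrow> covers V a b i j"
proof -
  interpret laminar V a b by (rule L)
  have free: "(a i < x \<or> y < a i) \<and> (b i < x \<or> y < b i)" if "i \<in> V" for i using all_free that by blast
  have old: "a' i = a i" "b' i = b i" if "i \<in> V" for i using that v by (auto simp: a'_def b'_def)
  have new: "a' v = x" "b' v = y" by (auto simp: a'_def b'_def)
  show "laminar (insert v V) a' b'"
  proof
    show "finite (insert v V)" using finN by simp
    show "a' n < b' n" if "n \<in> insert v V" for n using that lr old new xy by auto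
    show "m = n" if "m \<in> insert v V" "n \<in> insert v V" "a' m = a' n" for m n
      using that old new l_inj[of m n] free[of m] free[of n] xy by auto
    show "m = n" if "m \<in> insert v V" "n \<in> insert v V" "b' m = b' n" for m n
      using that old new r_inj[of m n] free[of m] free[of n] xy by auto
    show "a' m \<noteq> b' n" if "m \<in> insert v V" "n \<in> insert v V" for m n
      using that old new l_r[of m n] free[of m] free[of n] xy by auto
    show "b' n < b' m \<or> m = n" if "m \<in> insert v V" "n \<in> insert v V" "a' m < a' n" "a' n < b' m" for m n
      using that old new noncross[of m n] free[of m] free[of n] xy by auto
  qed
  show nv: "nested a' b' v i \<longleftrightarrow> a i < x \<and> y < b i" if "i \<in> V" for i
    using that old new by (auto simp: nested_def)
  show nn: "\<not> nested a' b' i v" if "i \<in> insert v V" for i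
    using that old new free[of i] lr[of i] xy by (auto simp: nested_def)
  show "covers (insert v V) a' b' i j \<longleftrightarrow> covers V a b i j" if ij: "i \<in> V" "j \<in> V" for i j
  proof -
    have eq: "nested a' b' p q \<longleftrightarrow> nested a b p q" if "p \<in> V" "q \<in> V" for p q
      using that old by (simp add: nested_def)
    have "\<not> nested a' b' j v" using nn ij by blast
    then show ?thesis using ij eq by (auto simp: covers_def)
  qed
qed

text \<open>Remove a leaf and represent the rest. The leaf receives a small interval just to the right of the
  left end of its neighbour, or, without a neighbour, far to the right of everything else.\<close>

lemma forest_intervals:
  fixes T :: "nat sgraph"
  assumes "simple_graph T" "forest T"
  shows "\<exists>a b. laminar (verts T) a b \<and> (\<forall>i\<in>verts T. \<forall>j\<in>verts T. i \<noteq> j \<longrightarrow>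
      (adj T i j \<longleftrightarrow> covers (verts T) a b i j \<or> covers (verts T) a b j i))"
  using assms
proof (induction "card (verts T)" arbitrary: T)
  case 0
  then have "verts T = {}" by (simp add: simple_graph_def)
  moreover have "laminar {} (\<lambda>_. 0) (\<lambda>_. 0)" by unfold_locales auto
  ultimately show ?case by auto
next
  case (Suc n)
  have fin: "finite (verts T)" using Suc.prems(1) by (simp add: simple_graph_def)
  have "verts T \<noteq> {}" using Suc.hyps(2) by auto
  then obtain v j where v: "v \<in> verts T" and leaf: "\<And>w. adj T v w \<Longrightarrow> w = j"
    using forest_leaf[OF Suc.prems] by metis
  let ?V = "verts T - {v}"
  define T' where "T' = induced_subgraph T ?V"
  have T': "verts T' = ?V" "adj T' p q \<longleftrightarrow> adj T p q \<and> p \<in> ?V \<and> q \<in> ?V" for p q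
    by (auto simp: T'_def induced_subgraph_def adj_def)
  have "simple_graph T'"
    using Suc.prems(1) by (auto simp: simple_graph_def T'_def induced_subgraph_def)
  moreover have "forest T'"
    unfolding forest_def
  proof
    assume "\<exists>xs. is_cycle T' xs"
    then obtain xs where "is_cycle T' xs" by blast
    then have "is_cycle T xs" using T' by (auto simp: is_cycle_def intro: successively_mono)
    then show False using Suc.prems(2) by (auto simp: forest_def)
  qed
  moreover have "n = card (verts T')" using Suc.hyps(2) v T'(1) fin by simp
  ultimately obtain a b where L: "laminar ?V a b"
    and cov: "\<And>p q. p \<in> ?V \<Longrightarrow> q \<in> ?V \<Longrightarrow> p \<noteq> q \<Longrightarrow> adj T p q \<longleftrightarrow> covers ?V a b p q \<or> covers ?V a b q p"
    using Suc.hyps(1)[of T'] T' by auto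
  interpret laminar ?V a b by (rule L)
  have ins: "insert v ?V = verts T" using v by blast
  have finish: ?case
    if xy: "x < y" and free: "\<forall>i\<in>?V. (a i < x \<or> y < a i) \<and> (b i < x \<or> y < b i)"
      and cv: "\<And>i. i \<in> ?V \<Longrightarrow> adj T v i \<longleftrightarrow>
        a i < x \<and> y < b i \<and> \<not> (\<exists>k\<in>?V. a k < x \<and> y < b k \<and> nested a b k i)" for x y
  proof -
    let ?a = "a(v := x)" and ?b = "b(v := y)"
    have nv: "v \<notin> ?V" by simp
    note li = laminar_insert[OF L nv xy free, unfolded ins]
    have cvi: "covers (verts T) ?a ?b i v \<longleftrightarrow> adj T v i" if i: "i \<in> ?V" for i
    proof -
      have "(\<exists>k\<in>verts T. nested ?a ?b v k \<and> nested ?a ?b k i) \<longleftrightarrow>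
          (\<exists>k\<in>?V. a k < x \<and> y < b k \<and> nested a b k i)"
      proof
        assume "\<exists>k\<in>verts T. nested ?a ?b v k \<and> nested ?a ?b k i"
        then obtain k where k: "k \<in> verts T" "nested ?a ?b v k" "nested ?a ?b k i" by blast
        have "k \<noteq> v" using k(2) by (auto simp: nested_def)
        then have "k \<in> ?V" "a k < x \<and> y < b k" "nested a b k i"
          using k li(2)[of k] i by (auto simp: nested_def)
        then show "\<exists>k\<in>?V. a k < x \<and> y < b k \<and> nested a b k i" by blast
      next
        assume "\<exists>k\<in>?V. a k < x \<and> y < b k \<and> nested a b k i"
        then obtain k where k: "k \<in> ?V" "a k < x \<and> y < b k" "nested a b k i" by blast
        then have "nested ?a ?b v k" "nested ?a ?b k i" using li(2)[of k] i by (auto simp: nested_def)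
        then show "\<exists>k\<in>verts T. nested ?a ?b v k \<and> nested ?a ?b k i" using k(1) by blast
      qed
      then show ?thesis using cv[OF i] li(2)[OF i] by (simp add: covers_def)
    qed
    have cvv: "\<not> covers (verts T) ?a ?b v i" if "i \<in> verts T" for i
      using li(3)[OF that] by (simp add: covers_def)
    have "adj T p q \<longleftrightarrow> covers (verts T) ?a ?b p q \<or> covers (verts T) ?a ?b q p"
      if pq: "p \<in> verts T" "q \<in> verts T" "p \<noteq> q" for p q
    proof -
      consider "p \<in> ?V" "q \<in> ?V" | "p = v" "q \<in> ?V" | "q = v" "p \<in> ?V" using pq by blast
      then show ?thesis
      proof cases
        case 1 then show ?thesis using cov[OF 1 pq(3)] li(4)[OF 1] li(4)[OF 1(2,1)] by simp
      next
        case 2 then show ?thesis using cvi[OF 2(2)] cvv[OF pq(2)] by simp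
      next
        case 3 then show ?thesis using cvi[OF 3(2)] cvv[OF pq(1)] adj_commute[of T p q] by simp
      qed
    qed
    then show ?thesis using li(1) by blast
  qed
  obtain m where m: "\<And>i. i \<in> ?V \<Longrightarrow> a i < m \<and> b i < m"
  proof -
    have "p < Max (insert 0 points) + 1" if "p \<in> points" for p
    proof -
      have "p \<le> Max (insert 0 points)" using finite_points that by (intro Max_ge) auto
      then show ?thesis by linarith
    qed
    then show thesis using that[of "Max (insert 0 points) + 1"] pointsI by blast
  qed
  show ?case
  proof (cases "\<exists>w. adj T v w")
    case False
    show ?thesis
    proof (rule finish[of m "m + 1"])
      show "\<forall>i\<in>?V. (a i < m \<or> m + 1 < a i) \<and> (b i < m \<or> m + 1 < b i)" using m by blast
      fix i assume "i \<in> ?V"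
      then have "a i < m \<and> b i < m" by (rule m)
      then show "adj T v i \<longleftrightarrow> a i < m \<and> m + 1 < b i \<and> \<not> (\<exists>k\<in>?V. a k < m \<and> m + 1 < b k \<and> nested a b k i)"
        using False by auto
    qed simp
  next
    case True
    then have vj: "adj T v j" using leaf by blast
    then have j: "j \<in> ?V" using simple_graph_adjD[OF Suc.prems(1) vj] by auto
    have only: "adj T v i \<longleftrightarrow> i = j" for i using leaf vj by blast
    obtain d where d: "0 < d" "\<And>p q. p \<in> points \<Longrightarrow> q \<in> points \<Longrightarrow> p < q \<Longrightarrow> p + d \<le> q"
      using finite_min_gap[OF finite_points] by blast
    have gap: "p \<le> a j \<or> a j + d \<le> p" if "p \<in> points" for p
      using d(2)[OF pointsI(1)[OF j] that] by linarith
    show ?thesis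
    proof (rule finish[of "a j + d / 3" "a j + 2 * d / 3"])
      show "a j + d / 3 < a j + 2 * d / 3" using d(1) by simp
      have far: "p < a j + d / 3 \<or> a j + 2 * d / 3 < p" if "p \<in> points" for p
        using gap[OF that] d(1) by linarith
      show "\<forall>i\<in>?V. (a i < a j + d / 3 \<or> a j + 2 * d / 3 < a i) \<and> (b i < a j + d / 3 \<or> a j + 2 * d / 3 < b i)"
        using far pointsI by blast
      fix i assume i: "i \<in> ?V"
      note gi = gap[OF pointsI(1)[OF i]] gap[OF pointsI(2)[OF i]]
      show "adj T v i \<longleftrightarrow> a i < a j + d / 3 \<and> a j + 2 * d / 3 < b i \<and>
          \<not> (\<exists>k\<in>?V. a k < a j + d / 3 \<and> a j + 2 * d / 3 < b k \<and> nested a b k i)"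
      proof (cases "i = j")
        case True
        have "a j + d \<le> b j" using gap[OF pointsI(2)[OF j]] lr[OF j] by linarith
        moreover have "\<not> a k < a j + d / 3" if "k \<in> ?V" "nested a b k j" for k
          using gap[OF pointsI(1)[OF that(1)]] that(2) d(1) by (auto simp: nested_def)
        ultimately show ?thesis using True only d(1) by auto
      next
        case False
        have "\<exists>k\<in>?V. a k < a j + d / 3 \<and> a j + 2 * d / 3 < b k \<and> nested a b k i"
          if h: "a i < a j + d / 3" "a j + 2 * d / 3 < b i"
        proof -
          have "a i \<noteq> a j" using l_inj[OF i j] False by blast
          then have "a i < a j" "a j < b i" using h gi d(1) by linarith+
          then have "nested a b j i" using nested_if_left[OF j i] by blast
          moreover have "a j + d \<le> b j" using gap[OF pointsI(2)[OF j]] lr[OF j] by linarith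
          ultimately show ?thesis using j d(1) by (intro bexI[of _ j]) auto
        qed
        then show ?thesis using False only by blast
      qed
    qed
  qed
qed

text \<open>A face needs at least one free chord besides those it shares, so every node is given a small
  additional leaf just to the right of its left end.\<close>

lemma add_leaves:
  assumes L: "laminar V a b"
  obtains l r where "spanning_laminar (V \<times> UNIV) l r"
    "laminar.inner (V \<times> UNIV) l r = V \<times> {True}"
    "\<And>i j. i \<in> V \<Longrightarrow> j \<in> V \<Longrightarrow>
      covers (V \<times> UNIV) l r (i, True) (j, True) \<longleftrightarrow> covers V a b i j"
proof -
  interpret laminar V a b by (rule L)
  obtain d where d: "0 < d" "\<And>p q. p \<in> points \<Longrightarrow> q \<in> points \<Longrightarrow> p < q \<Longrightarrow> p + d \<le> q"
    using finite_min_gap[OF finite_points] by blast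
  define l r where "l n = a (fst n) + (if snd n then 0 else d / 3)"
    and "r n = (if snd n then b (fst n) else a (fst n) + 2 * d / 3)" for n :: "'a \<times> bool"
  have l: "l (i, True) = a i" "l (i, False) = a i + d / 3"
    and r: "r (i, True) = b i" "r (i, False) = a i + 2 * d / 3" for i by (auto simp: l_def r_def)
  have tri: "p = q \<or> p + d \<le> q \<or> q + d \<le> p" if "p \<in> points" "q \<in> points" for p q
    using d(2)[OF that] d(2)[OF that(2,1)] by linarith
  have lam: "laminar (V \<times> UNIV) l r"
  proof
    show "finite (V \<times> (UNIV :: bool set))" using finN by simp
    show "l n < r n" if "n \<in> V \<times> UNIV" for n
      using that lr[of "fst n"] d(1) by (auto simp: l_def r_def)
    fix m n assume mn: "m \<in> V \<times> (UNIV :: bool set)" "n \<in> V \<times> (UNIV :: bool set)"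
    obtain i s where m: "m = (i, s)" "i \<in> V" using mn(1) by auto
    obtain j t where n: "n = (j, t)" "j \<in> V" using mn(2) by auto
    note t = tri[OF pointsI(1)[OF m(2)] pointsI(1)[OF n(2)]] tri[OF pointsI(1)[OF m(2)] pointsI(2)[OF n(2)]]
      tri[OF pointsI(2)[OF m(2)] pointsI(1)[OF n(2)]] tri[OF pointsI(2)[OF m(2)] pointsI(2)[OF n(2)]]
      tri[OF pointsI(1)[OF m(2)] pointsI(2)[OF m(2)]] tri[OF pointsI(1)[OF n(2)] pointsI(2)[OF n(2)]]
    have aa: "i = j \<or> a i + d \<le> a j \<or> a j + d \<le> a i" and bb: "i = j \<or> b i + d \<le> b j \<or> b j + d \<le> b i"
      using t(1,4) l_inj[OF m(2) n(2)] r_inj[OF m(2) n(2)] by blast+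
    have ab: "a i + d \<le> b j \<or> b j + d \<le> a i" and ba: "b i + d \<le> a j \<or> a j + d \<le> b i"
      using t(2,3) l_r[OF m(2) n(2)] l_r[OF n(2) m(2)] by auto
    have own: "a i + d \<le> b i" "a j + d \<le> b j"
      using t(5,6) lr[OF m(2)] lr[OF n(2)] d(1) by linarith+
    have nc: "\<not> a i < a j \<or> \<not> a j < b i \<or> b j < b i \<or> i = j"
      using noncross[OF m(2) n(2)] by blast
    have lm: "l m = a i + (if s then 0 else d / 3)" and ln: "l n = a j + (if t then 0 else d / 3)"
      and rm: "r m = (if s then b i else a i + 2 * d / 3)" and rn: "r n = (if t then b j else a j + 2 * d / 3)"
      by (simp_all add: l_def r_def m(1) n(1))
    have same: "m = n" if "i = j \<and> s = t" using that m(1) n(1) by simp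
    show "m = n" if e: "l m = l n"
    proof (rule same)
      show "i = j \<and> s = t" using e aa d(1) unfolding lm ln by (cases s; cases t) auto
    qed
    show "m = n" if e: "r m = r n"
    proof (rule same)
      show "i = j \<and> s = t" using e aa bb ab ba own d(1) unfolding rm rn by (cases s; cases t) auto
    qed
    show "l m \<noteq> r n" using aa ab own d(1) unfolding lm rn by (cases s; cases t) auto
    show "r n < r m \<or> m = n" if lt: "l m < l n" "l n < r m"
    proof -
      have "r n < r m \<or> i = j \<and> s = t"
        using lt aa bb ab ba own nc d(1) unfolding lm ln rm rn by (cases s; cases t) auto
      then show ?thesis using same by blast
    qed
  qed
  have nTT: "nested l r (i, True) (j, True) \<longleftrightarrow> nested a b i j" for i j
    by (simp add: nested_def l r)
  have nF: "\<not> nested l r m (i, False)" if "m \<in> V \<times> UNIV" "i \<in> V" for m i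
  proof
    assume n: "nested l r m (i, False)"
    obtain j t where m: "m = (j, t)" "j \<in> V" using \<open>m \<in> V \<times> UNIV\<close> by auto
    have "a i + d / 3 < l m" "r m < a i + 2 * d / 3" using n by (auto simp: nested_def l r)
    then show False
      using tri[OF pointsI(1)[OF that(2)] pointsI(1)[OF m(2)]] tri[OF pointsI(1)[OF that(2)] pointsI(2)[OF m(2)]]
        lr[OF m(2)] d(1) by (cases t) (auto simp: m(1) l r)
  qed
  have nFT: "nested l r (i, False) (i, True)" if "i \<in> V" for i
    using tri[OF pointsI(1)[OF that] pointsI(2)[OF that]] lr[OF that] d(1) by (auto simp: nested_def l r)
  have inn: "laminar.inner (V \<times> UNIV) l r = V \<times> {True}"
    unfolding laminar.inner_def[OF lam]
  proof
    show "{m \<in> V \<times> UNIV. \<exists>n\<in>V \<times> UNIV. nested l r n m} \<subseteq> V \<times> {True}"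
    proof
      fix m assume m: "m \<in> {m \<in> V \<times> UNIV. \<exists>n\<in>V \<times> UNIV. nested l r n m}"
      obtain i s where i: "m = (i, s)" "i \<in> V" using m by auto
      then show "m \<in> V \<times> {True}" using m nF by (cases s) auto
    qed
    show "V \<times> {True} \<subseteq> {m \<in> V \<times> UNIV. \<exists>n\<in>V \<times> UNIV. nested l r n m}"
      using nFT by blast
  qed
  have spanning: "spanning_laminar (V \<times> UNIV) l r"
    unfolding spanning_laminar_def spanning_laminar_axioms_def
  proof (intro conjI lam allI impI)
    fix n :: "'a \<times> bool" assume n: "n \<in> V \<times> UNIV"
    then obtain i s where i: "n = (i, s)" "i \<in> V" by auto
    then show "n \<in> laminar.inner (V \<times> UNIV) l r \<or> (\<exists>m\<in>V \<times> UNIV. nested l r n m)"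
      using inn nFT[OF i(2)] by (cases s) auto
  qed
  have cov: "covers (V \<times> UNIV) l r (i, True) (j, True) \<longleftrightarrow> covers V a b i j"
    if ij: "i \<in> V" "j \<in> V" for i j
  proof -
    have "(\<exists>k\<in>V \<times> UNIV. nested l r (j, True) k \<and> nested l r k (i, True)) \<longleftrightarrow>
        (\<exists>k\<in>V. nested a b j k \<and> nested a b k i)"
    proof
      assume "\<exists>k\<in>V \<times> UNIV. nested l r (j, True) k \<and> nested l r k (i, True)"
      then obtain k t where k: "k \<in> V" "nested l r (j, True) (k, t)" "nested l r (k, t) (i, True)" by auto
      then have "t" using nF[of "(j, True)" k] ij by (cases t) auto
      then show "\<exists>k\<in>V. nested a b j k \<and> nested a b k i" using k nTT by auto
    next
      assume "\<exists>k\<in>V. nested a b j k \<and> nested a b k i"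
      then show "\<exists>k\<in>V \<times> UNIV. nested l r (j, True) k \<and> nested l r k (i, True)"
        using nTT by (metis SigmaI UNIV_I)
    qed
    then show ?thesis by (simp add: covers_def nTT)
  qed
  show thesis by (rule that[OF spanning inn cov])
qed

section \<open>The characterization\<close>

context simplicial_complex begin

text \<open>All pairs in a minimal non-face are joined in the coordinate graph (removing the pair from it
  gives the middle of the open path). If that graph is a forest, a minimal non-face has therefore only two
  elements.\<close>

lemma minimal_nonface:
  assumes "finite S" "S \<notin> D"
  obtains T where "T \<subseteq> S" "T \<notin> D" "\<And>i j. i \<in> T \<Longrightarrow> j \<in> T \<Longrightarrow> i \<noteq> j \<Longrightarrow> tau_adj D i j"
proof -
  define K where "K = {T. T \<subseteq> S \<and> T \<notin> D}"
  have "finite K" by (rule finite_subset[of _ "Pow S"]) (use assms in \<open>auto simp: K_def\<close>)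
  moreover have "K \<noteq> {}" using assms(2) by (auto simp: K_def)
  ultimately obtain T where TK: "T \<in> K" and min: "\<forall>T'\<in>K. T' \<subseteq> T \<longrightarrow> T = T'"
    using finite_has_minimal[of K] by blast
  have T: "T \<subseteq> S" "T \<notin> D" using TK by (auto simp: K_def)
  have proper: "T' \<in> D" if "T' \<subseteq> T" "T' \<noteq> T" for T'
  proof (rule ccontr)
    assume "T' \<notin> D"
    then have "T' \<in> K" using that T by (auto simp: K_def)
    then show False using min that by blast
  qed
  have "tau_adj D i j" if ij: "i \<in> T" "j \<in> T" "i \<noteq> j" for i j
  proof -
    have "insert i (T - {i, j}) \<in> D" "insert j (T - {i, j}) \<in> D" using ij by (auto intro!: proper)
    moreover have "insert i (insert j (T - {i, j})) = T" using ij by blast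
    then have "insert i (insert j (T - {i, j})) \<notin> D" using T(2) by simp
    ultimately show ?thesis using ij(3) unfolding tau_adj_def by blast
  qed
  then show thesis using that[OF T] by blast
qed

lemma nonface_pair:
  assumes F: "forest (coord_graph D)" and S: "finite S" "S \<subseteq> coords D" "S \<notin> D"
  obtains i j where "i \<in> S" "j \<in> S" "i \<noteq> j" "{i, j} \<notin> D" "tau_adj D i j"
proof -
  obtain T where T: "T \<subseteq> S" "T \<notin> D" and adj: "\<And>i j. i \<in> T \<Longrightarrow> j \<in> T \<Longrightarrow> i \<noteq> j \<Longrightarrow> tau_adj D i j"
    using minimal_nonface[OF S(1,3)] by blast
  obtain i where i: "i \<in> T" using T(2) empty by (metis all_not_in_conv)
  have "T \<noteq> {i}" using T S(2) i by (auto simp: coords_def)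
  then obtain j where j: "j \<in> T" "j \<noteq> i" using i by blast
  have "T = {i, j}"
  proof (rule ccontr)
    assume "T \<noteq> {i, j}"
    then obtain k where k: "k \<in> T" "k \<noteq> i" "k \<noteq> j" using i j by blast
    have "{i, j, k} \<subseteq> coords D" using i j k T(1) S(2) by blast
    then have "is_cycle (coord_graph D) [i, j, k]"
      using adj i j k by (simp add: is_cycle_def adj_coord_graph) (simp add: coord_graph_def)
    then show False using F by (auto simp: forest_def)
  qed
  then show thesis using that[of i j] i j T adj by auto
qed

lemma complex_eq_independent_sets:
  assumes F: "forest (coord_graph D)"
  shows "\<sigma> \<in> D \<longleftrightarrow> \<sigma> \<subseteq> coords D \<and> (\<forall>i\<in>\<sigma>. \<forall>j\<in>\<sigma>. i \<noteq> j \<longrightarrow> \<not> tau_adj D i j)"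
proof
  assume \<sigma>: "\<sigma> \<in> D"
  have "\<not> tau_adj D i j" if ij: "i \<in> \<sigma>" "j \<in> \<sigma>" for i j
  proof
    assume "tau_adj D i j"
    then obtain \<rho> where \<rho>: "insert i \<rho> \<in> D" "insert j \<rho> \<in> D" "insert i (insert j \<rho>) \<notin> D"
      by (auto simp: tau_adj_def)
    let ?S = "insert i (insert j \<rho>)"
    have "finite ?S" using finite_simplex[OF \<rho>(1)] by simp
    moreover have "?S \<subseteq> coords D" using coordsI[OF \<rho>(1)] coordsI[OF \<rho>(2)] by blast
    ultimately obtain p q where pq: "p \<in> ?S" "q \<in> ?S" "{p, q} \<notin> D"
      using nonface_pair[OF F _ _ \<rho>(3)] by metis
    have "\<not> {p, q} \<subseteq> insert i \<rho>" "\<not> {p, q} \<subseteq> insert j \<rho>" using pq(3) down \<rho> by blast+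
    then have "{p, q} = {i, j}" using pq(1,2) by auto
    then show False using pq(3) down[OF \<sigma>, of "{i, j}"] ij by auto
  qed
  then show "\<sigma> \<subseteq> coords D \<and> (\<forall>i\<in>\<sigma>. \<forall>j\<in>\<sigma>. i \<noteq> j \<longrightarrow> \<not> tau_adj D i j)"
    using coordsI[OF \<sigma>] by blast
next
  assume \<sigma>: "\<sigma> \<subseteq> coords D \<and> (\<forall>i\<in>\<sigma>. \<forall>j\<in>\<sigma>. i \<noteq> j \<longrightarrow> \<not> tau_adj D i j)"
  then have fin: "finite \<sigma>" using finite_coords finite_subset by blast
  show "\<sigma> \<in> D"
  proof (rule ccontr)
    assume "\<sigma> \<notin> D"
    then obtain i j where "i \<in> \<sigma>" "j \<in> \<sigma>" "i \<noteq> j" "tau_adj D i j"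
      using nonface_pair[OF F fin] \<sigma> by metis
    then show False using \<sigma> by blast
  qed
qed

lemma simple_coord_graph: "simple_graph (coord_graph D)"
  using finite_coords by (auto simp: simple_graph_def coord_graph_def tau_adj_def)

theorem resonance_graph_exists:
  assumes F: "forest (coord_graph D)"
  obtains G \<gamma> where "plane_bipartite_graph G \<gamma>" "complex_graph D \<simeq>\<^sub>g resonance_graph G \<gamma>"
    "connected_graph (coord_graph D) \<Longrightarrow> elementary G \<and> \<not> G \<simeq>\<^sub>g K2"
proof -
  have V: "verts (coord_graph D) = coords D" by (simp add: coord_graph_def)
  obtain a b where L: "laminar (coords D) a b"
    and cov: "\<And>i j. i \<in> coords D \<Longrightarrow> j \<in> coords D \<Longrightarrow> i \<noteq> j \<Longrightarrow>
      adj (coord_graph D) i j \<longleftrightarrow> covers (coords D) a b i j \<or> covers (coords D) a b j i"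
    using forest_intervals[OF simple_coord_graph F] unfolding V by blast
  obtain l r where sp: "spanning_laminar (coords D \<times> (UNIV :: bool set)) l r"
    and inn: "laminar.inner (coords D \<times> UNIV) l r = coords D \<times> {True}"
    and cov': "\<And>i j. i \<in> coords D \<Longrightarrow> j \<in> coords D \<Longrightarrow>
      covers (coords D \<times> UNIV) l r (i, True) (j, True) \<longleftrightarrow> covers (coords D) a b i j"
    using add_leaves[OF L] by blast
  interpret spanning_laminar "coords D \<times> (UNIV :: bool set)" l r by (rule sp)
  have share: "visible (i, True) \<inter> visible (j, True) \<noteq> {} \<longleftrightarrow> tau_adj D i j"
    if ij: "i \<in> coords D" "j \<in> coords D" "i \<noteq> j" for i j
    using share_iff_covers[of "(i, True)" "(j, True)"] cov[OF ij] cov'[OF ij(1,2)] cov'[OF ij(2,1)] ij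
    by (simp add: adj_coord_graph)
  have "plane_bipartite_graph graph parabola"
    by (simp add: plane_bipartite_graph_def plane_drawing bipartite_graph)
  moreover have "complex_graph D \<simeq>\<^sub>g resonance_graph graph parabola"
  proof (rule resonance_iso)
    show "inj (\<lambda>i. (i, True))" by (simp add: inj_def)
    show "(\<lambda>i. (i, True)) ` coords D = inner" using inn by auto
    show "\<sigma> \<in> D \<longleftrightarrow> \<sigma> \<subseteq> coords D \<and>
        (\<forall>i\<in>\<sigma>. \<forall>j\<in>\<sigma>. i \<noteq> j \<longrightarrow> visible (i, True) \<inter> visible (j, True) = {})" for \<sigma>
      unfolding complex_eq_independent_sets[OF F] using share by (meson subsetD)
  qed
  moreover have "elementary graph \<and> \<not> graph \<simeq>\<^sub>g K2" if conn: "connected_graph (coord_graph D)"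
  proof
    obtain i0 where i0: "i0 \<in> coords D" using conn V by (auto simp: connected_graph_def)
    then have i0': "(i0, True) \<in> inner" using inn by simp
    then show "\<not> graph \<simeq>\<^sub>g K2" by (rule graph_not_K2)
    show "elementary graph"
    proof (rule graph_elementary)
      show "inner \<noteq> {}" using i0' by blast
      fix S assume S: "S \<subseteq> inner" "S \<noteq> {}"
        and cl: "\<And>i j. i \<in> S \<Longrightarrow> j \<in> inner \<Longrightarrow> visible i \<inter> visible j \<noteq> {} \<Longrightarrow> j \<in> S"
      obtain i where i: "(i, True) \<in> S" using S inn by auto
      have step: "(q, True) \<in> S" if "(p, True) \<in> S" "adj (coord_graph D) p q" for p q
      proof -
        have pq: "p \<in> coords D" "q \<in> coords D" "tau_adj D p q" using that(2) by (auto simp: adj_coord_graph)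
        moreover have "p \<noteq> q" using pq(3) by (simp add: tau_adj_def)
        ultimately have "visible (p, True) \<inter> visible (q, True) \<noteq> {}" using share by blast
        then show ?thesis using cl[OF that(1)] pq(2) inn by simp
      qed
      have along: "(last ws, True) \<in> S"
        if "successively (adj (coord_graph D)) ws" "ws \<noteq> []" "(hd ws, True) \<in> S" for ws
        using that
      proof (induction ws rule: path_edges.induct)
        case (1 x y ws)
        then have "(y, True) \<in> S" using step[of x y] by simp
        then show ?case using 1 by simp
      qed auto
      have "(j, True) \<in> S" if "j \<in> coords D" for j
      proof -
        have "i \<in> coords D" using S i inn by auto
        then obtain ws where "walk (coord_graph D) i ws j"
          using conn \<open>j \<in> coords D\<close> unfolding connected_graph_def V by blast
        then show ?thesis using along[of ws] i by (auto simp: walk_def)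
      qed
      then show "S = inner" using S inn by auto
    qed
  qed
  ultimately show thesis using that by blast
qed

end

theorem forest_if_resonance_graph:
  assumes D: "simplicial_complex D" and G: "plane_bipartite_graph G \<gamma>"
    and iso: "complex_graph D \<simeq>\<^sub>g resonance_graph G \<gamma>"
  shows "forest (coord_graph D)"
    and "elementary G \<Longrightarrow> \<not> G \<simeq>\<^sub>g K2 \<Longrightarrow> connected_graph (coord_graph D)"
proof -
  interpret simplicial_complex D by (rule D)
  interpret plane G \<gamma> using G by unfold_locales (simp add: plane_bipartite_graph_def)
  obtain M where M: "bij_betw M (verts (complex_graph D)) (verts (resonance_graph G \<gamma>))"
    and adj: "\<And>u v. u \<in> verts (complex_graph D) \<Longrightarrow> v \<in> verts (complex_graph D) \<Longrightarrow>
      adj (complex_graph D) u v \<longleftrightarrow> adj (resonance_graph G \<gamma>) (M u) (M v)"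
    using iso by (auto simp: graph_iso_def)
  have V: "verts (complex_graph D) = D" "verts (resonance_graph G \<gamma>) = {N. perfect_matching G N}"
    by (simp_all add: complex_graph_def resonance_graph_def)
  interpret resonant_daisy G \<gamma> D M
  proof
    show "bipartite G" using G by (simp add: plane_bipartite_graph_def)
    show bij: "bij_betw M D {N. perfect_matching G N}" using M V by simp
    fix \<sigma> \<rho> assume s: "\<sigma> \<in> D" "\<rho> \<in> D"
    then have "M \<sigma> \<in> {N. perfect_matching G N}" "M \<rho> \<in> {N. perfect_matching G N}"
      using bij_betw_apply[OF bij] by blast+
    then show "card (sym_diff \<sigma> \<rho>) = 1 \<longleftrightarrow> face_cycle (sym_diff (M \<sigma>) (M \<rho>))"
      using adj[of \<sigma> \<rho>] s V adj_resonance adj_complex_graph by simp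
  qed
  show "forest (coord_graph D)" by (rule coord_graph_forest)
  show "elementary G \<Longrightarrow> \<not> G \<simeq>\<^sub>g K2 \<Longrightarrow> connected_graph (coord_graph D)" by (rule coord_graph_connected)
qed

theorem theorem4p3:
  fixes H :: "'a sgraph"
  assumes "daisy_cube H"
  shows "(edges H \<noteq> {} \<longrightarrow>
           ((\<exists>G \<gamma>. plane_bipartite_graph G \<gamma> \<and> H \<simeq>\<^sub>g resonance_graph G \<gamma>)
             \<longleftrightarrow> forest (tau_graph H))) \<and>
         ((\<exists>G \<gamma>. plane_bipartite_graph G \<gamma> \<and> elementary G \<and> \<not> G \<simeq>\<^sub>g K2 \<and>
               H \<simeq>\<^sub>g resonance_graph G \<gamma>)
             \<longleftrightarrow> tree (tau_graph H))"
proof -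
  obtain D where D: "simplicial_complex D" and iso: "H \<simeq>\<^sub>g complex_graph D"
    using daisy_cube_complex[OF assms] .
  interpret simplicial_complex D by (rule D)
  obtain f where f: "bij_betw f (verts H) (verts (complex_graph D))"
    and adj: "\<And>u v. u \<in> verts H \<Longrightarrow> v \<in> verts H \<Longrightarrow> adj H u v \<longleftrightarrow> adj (complex_graph D) (f u) (f v)"
    using iso by (auto simp: graph_iso_def)
  have V: "verts (complex_graph D) = D" by (simp add: complex_graph_def)
  interpret cube_coordinates D H f
  proof
    show bij: "bij_betw f (verts H) D" using f V by simp
    fix u v assume uv: "u \<in> verts H" "v \<in> verts H"
    then have "f u \<in> D" "f v \<in> D" using bij_betw_apply[OF bij] by blast+
    then show "adj H u v \<longleftrightarrow> card (sym_diff (f u) (f v)) = 1" using adj[OF uv] adj_complex_graph by simp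
  next
    show "simple_graph H" using assms by (simp add: daisy_cube_def)
  qed
  have forest: "forest (tau_graph H) \<longleftrightarrow> forest (coord_graph D)"
    using forest_iso[OF tau_graph_iso] forest_iso[OF graph_iso_sym[OF tau_graph_iso]] by blast
  have tree: "tree (tau_graph H) \<longleftrightarrow> connected_graph (coord_graph D) \<and> forest (coord_graph D)"
    using tree_iso[OF tau_graph_iso] by (simp add: tree_def)
  have to_D: "complex_graph D \<simeq>\<^sub>g resonance_graph G \<gamma>" if "H \<simeq>\<^sub>g resonance_graph G \<gamma>" for G \<gamma>
    using graph_iso_trans[OF graph_iso_sym[OF iso] that] .
  have from_D: "H \<simeq>\<^sub>g resonance_graph G \<gamma>" if "complex_graph D \<simeq>\<^sub>g resonance_graph G \<gamma>" for G \<gamma>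
    using graph_iso_trans[OF iso that] .
  have "(\<exists>G \<gamma>. plane_bipartite_graph G \<gamma> \<and> H \<simeq>\<^sub>g resonance_graph G \<gamma>) \<longleftrightarrow> forest (tau_graph H)"
  proof
    assume "\<exists>G \<gamma>. plane_bipartite_graph G \<gamma> \<and> H \<simeq>\<^sub>g resonance_graph G \<gamma>"
    then show "forest (tau_graph H)" using forest_if_resonance_graph(1)[OF D] to_D forest by blast
  next
    assume "forest (tau_graph H)"
    then show "\<exists>G \<gamma>. plane_bipartite_graph G \<gamma> \<and> H \<simeq>\<^sub>g resonance_graph G \<gamma>"
      using resonance_graph_exists from_D forest by metis
  qed
  moreover have "(\<exists>G \<gamma>. plane_bipartite_graph G \<gamma> \<and> elementary G \<and> \<not> G \<simeq>\<^sub>g K2 \<and>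
      H \<simeq>\<^sub>g resonance_graph G \<gamma>) \<longleftrightarrow> tree (tau_graph H)"
  proof
    assume "\<exists>G \<gamma>. plane_bipartite_graph G \<gamma> \<and> elementary G \<and> \<not> G \<simeq>\<^sub>g K2 \<and> H \<simeq>\<^sub>g resonance_graph G \<gamma>"
    then show "tree (tau_graph H)" using forest_if_resonance_graph[OF D] to_D tree by blast
  next
    assume "tree (tau_graph H)"
    then have conn: "connected_graph (coord_graph D)" and F: "forest (coord_graph D)" using tree by auto
    obtain G \<gamma> where "plane_bipartite_graph G \<gamma>" "complex_graph D \<simeq>\<^sub>g resonance_graph G \<gamma>"
      "elementary G \<and> \<not> G \<simeq>\<^sub>g K2"
      using resonance_graph_exists[OF F] conn by metis
    then show "\<exists>G \<gamma>. plane_bipartite_graph G \<gamma> \<and> elementary G \<and> \<not> G \<simeq>\<^sub>g K2 \<and> H \<simeq>\<^sub>g resonance_graph G \<gamma>"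
      using from_D by blast
  qed
  ultimately show ?thesis by blast
qed

end
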